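(* Let $c(\nu,r)=(1-\nu^2)\sum_{j\ge0}\frac{\nu^{2j}}{j+r}$. Then \[ \mathrm{gap}\,L\le\lambda^2\,\frac{\sum_{j\ge0}\frac{j+1}{(j+r+1)^2(j+r)}\nu^{2j}}{\sum_{j\ge0}\big(\frac{1}{j+r}-c(\nu,r)\big)^2\nu^{2j}}. \] In particular, for every fixed $\nu\in(0,1)$ (with $\mu$ fixed), $\mathrm{gap}\,L\to0$ as $r\to0$.
   Context: Let $\mathsf h=\ell^2(\mathbb N)$ with canonical orthonormal basis $(e_n)_{n\ge0}$, $Ne_n=ne_n$. Fix $r>0$, $\omega_n=n(n+r-1)$. On $\mathrm{Dom}(N)$ define $Be_n=\omega_n^{1/2}e_{n-1}$ ($n\ge1$), $Be_0=0$, $B^+e_n=\omega_{n+1}^{1/2}e_{n+1}$. Fix real $0<\lambda<\mu$ and $\zeta^\pm\in\mathbb R$, and put $\nu=\lambda/\mu$. Let $G$ on $\mathrm{Dom}(N^2)$ be $Ge_n=-\big((\tfrac{\lambda^2}{2}+i\zeta^+)\omega_{n+1}+(\tfrac{\mu^2}{2}+i\zeta^-)\omega_n\big)e_n$, $P_t=e^{tG}$, $L_1=\mu B$, $L_2=\lambda B^+$, and let $\mathcal T$ be the minimal quantum dynamical semigroup associated with $G,L_1,L_2$ (the minimal solution of $\langle v,\mathcal T_t(x)u\rangle=\langle P_tv,xP_tu\rangle+\sum_{\ell=1}^2\int_0^t\langle L_\ell P_{t-s}v,\mathcal T_s(x)L_\ell P_{t-s}u\rangle ds$), a quantum Markov semigroup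 with generator formally $\mathcal L(x)=-\frac{\lambda^2}{2}(BB^+x-2BxB^++xBB^+)-\frac{\mu^2}{2}(B^+Bx-2B^+xB+xB^+B)+i[\zeta^+BB^++\zeta^-B^+B,x]$. Let $\rho=(1-\nu^2)\sum_n\nu^{2n}|e_n\rangle\langle e_n|$. Let $L_2(\mathsf h)$ be the Hilbert–Schmidt operators with $\langle x,y\rangle=\mathrm{tr}(x^*y)$, $\iota(x)=\rho^{1/4}x\rho^{1/4}$, and let $T=(T_t)$ be the strongly continuous contraction semigroup on $L_2(\mathsf h)$ determined by $T_t(\iota(x))=\iota(\mathcal T_t(x))$, with generator $L$. With the Dirichlet form $\mathcal E(\xi)=-\mathrm{Re}\langle\xi,L(\xi)\rangle$, the spectral gap is $\mathrm{gap}\,L=\inf\{\mathcal E(\xi):\|\xi\|=1,\ \xi\in D(L)\cap(\mathrm{Ker}\,L)^\perp\}$. *)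

theory Defs
  imports "HOL-Analysis.Analysis"
begin

text \<open>Vectors of h = l2(N) are coordinate functions (v n = <e_n, v>);
  operators are represented by their matrices x m n = <e_m, x e_n>;
  Hilbert-Schmidt operators are square-summable matrices.\<close>

type_synonym vec = "nat \<Rightarrow> complex"
type_synonym mat = "nat \<Rightarrow> nat \<Rightarrow> complex"

definition l2 :: "vec set" where
  "l2 = {v. summable (\<lambda>n. (cmod (v n))\<^sup>2)}"

definition vinner :: "vec \<Rightarrow> vec \<Rightarrow> complex" where
  "vinner v u = (\<Sum>n. cnj (v n) * u n)"

definition vnorm :: "vec \<Rightarrow> real" where
  "vnorm v = sqrt (\<Sum>n. (cmod (v n))\<^sup>2)"

definition mat_app :: "mat \<Rightarrow> vec \<Rightarrow> vec" where
  "mat_app x u = (\<lambda>m. \<Sum>n. x m n * u n)"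

definition bounded_op :: "mat \<Rightarrow> bool" where
  "bounded_op x \<longleftrightarrow> (\<forall>m. (\<lambda>n. x m n) \<in> l2) \<and>
     (\<exists>C. \<forall>u\<in>l2. mat_app x u \<in> l2 \<and> vnorm (mat_app x u) \<le> C * vnorm u)"

definition pos_op :: "mat \<Rightarrow> bool" where
  "pos_op x \<longleftrightarrow> bounded_op x \<and>
     (\<forall>u\<in>l2. Im (vinner u (mat_app x u)) = 0 \<and> Re (vinner u (mat_app x u)) \<ge> 0)"

definition op_le :: "mat \<Rightarrow> mat \<Rightarrow> bool" where
  "op_le x y \<longleftrightarrow> pos_op (\<lambda>m n. y m n - x m n)"

definition omega :: "real \<Rightarrow> nat \<Rightarrow> real" where
  "omega r n = real n * (real n + r - 1)"

definition domG :: "vec set" where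
  "domG = {u \<in> l2. summable (\<lambda>n. (real n ^ 2 * cmod (u n))\<^sup>2)}"

text \<open>Diagonal entries of G: G e_n = gG n e_n.\<close>
definition gG :: "real \<Rightarrow> real \<Rightarrow> real \<Rightarrow> real \<Rightarrow> real \<Rightarrow> nat \<Rightarrow> complex" where
  "gG r lam mu zp zm n =
     - ((complex_of_real (lam\<^sup>2 / 2) + \<i> * complex_of_real zp) * complex_of_real (omega r (n + 1))
      + (complex_of_real (mu\<^sup>2 / 2) + \<i> * complex_of_real zm) * complex_of_real (omega r n))"

definition Pt :: "real \<Rightarrow> real \<Rightarrow> real \<Rightarrow> real \<Rightarrow> real \<Rightarrow> real \<Rightarrow> vec \<Rightarrow> vec" where
  "Pt r lam mu zp zm t u = (\<lambda>n. exp (complex_of_real t * gG r lam mu zp zm n) * u n)"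

text \<open>B e_n = sqrt(omega_n) e_(n-1), B+ e_n = sqrt(omega_(n+1)) e_(n+1).\<close>
definition Bv :: "real \<Rightarrow> vec \<Rightarrow> vec" where
  "Bv r w = (\<lambda>m. complex_of_real (sqrt (omega r (m + 1))) * w (m + 1))"

definition Bplusv :: "real \<Rightarrow> vec \<Rightarrow> vec" where
  "Bplusv r w = (\<lambda>m. if m = 0 then 0 else complex_of_real (sqrt (omega r m)) * w (m - 1))"

definition L1v :: "real \<Rightarrow> real \<Rightarrow> vec \<Rightarrow> vec" where
  "L1v r mu w = (\<lambda>m. complex_of_real mu * Bv r w m)"

definition L2v :: "real \<Rightarrow> real \<Rightarrow> vec \<Rightarrow> vec" where
  "L2v r lam w = (\<lambda>m. complex_of_real lam * Bplusv r w m)"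

definition qds_solution ::
  "real \<Rightarrow> real \<Rightarrow> real \<Rightarrow> real \<Rightarrow> real \<Rightarrow> (real \<Rightarrow> mat \<Rightarrow> mat) \<Rightarrow> bool" where
  "qds_solution r lam mu zp zm S \<longleftrightarrow>
     (\<forall>t\<ge>0. \<forall>x. bounded_op x \<longrightarrow> bounded_op (S t x)) \<and>
     (\<forall>t\<ge>0. \<forall>x. pos_op x \<longrightarrow> pos_op (S t x)) \<and>
     (\<forall>t\<ge>0. \<forall>x y a. bounded_op x \<longrightarrow> bounded_op y \<longrightarrow>
         S t (\<lambda>m n. x m n + a * y m n) = (\<lambda>m n. S t x m n + a * S t y m n)) \<and>
     (\<forall>t\<ge>0. \<forall>x u v. bounded_op x \<longrightarrow> u \<in> domG \<longrightarrow> v \<in> domG \<longrightarrow>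
        ((\<lambda>s. vinner (L1v r mu (Pt r lam mu zp zm (t - s) v))
                      (mat_app (S s x) (L1v r mu (Pt r lam mu zp zm (t - s) u)))
             + vinner (L2v r lam (Pt r lam mu zp zm (t - s) v))
                      (mat_app (S s x) (L2v r lam (Pt r lam mu zp zm (t - s) u))))
         has_integral
           (vinner v (mat_app (S t x) u)
            - vinner (Pt r lam mu zp zm t v) (mat_app x (Pt r lam mu zp zm t u)))) {0..t})"

definition minimal_qds ::
  "real \<Rightarrow> real \<Rightarrow> real \<Rightarrow> real \<Rightarrow> real \<Rightarrow> (real \<Rightarrow> mat \<Rightarrow> mat) \<Rightarrow> bool" where
  "minimal_qds r lam mu zp zm T \<longleftrightarrow> qds_solution r lam mu zp zm T \<and>
     (\<forall>S. qds_solution r lam mu zp zm S \<longrightarrow>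
        (\<forall>t\<ge>0. \<forall>x. pos_op x \<longrightarrow> op_le (T t x) (S t x)))"

definition hs :: "mat set" where
  "hs = {\<xi>. (\<lambda>(m, n). (cmod (\<xi> m n))\<^sup>2) summable_on UNIV}"

definition hs_inner :: "mat \<Rightarrow> mat \<Rightarrow> complex" where
  "hs_inner \<xi> \<eta> = (\<Sum>\<^sub>\<infinity>(m, n). cnj (\<xi> m n) * \<eta> m n)"

definition hs_norm :: "mat \<Rightarrow> real" where
  "hs_norm \<xi> = sqrt (\<Sum>\<^sub>\<infinity>(m, n). (cmod (\<xi> m n))\<^sup>2)"

text \<open>rho^(1/4), rho = (1 - nu^2) sum nu^(2n) |e_n><e_n|, and iota(x) = rho^(1/4) x rho^(1/4).\<close>
definition rho14 :: "real \<Rightarrow> nat \<Rightarrow> real" where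
  "rho14 nu n = ((1 - nu\<^sup>2) * nu ^ (2 * n)) powr (1 / 4)"

definition iota :: "real \<Rightarrow> mat \<Rightarrow> mat" where
  "iota nu x = (\<lambda>m n. complex_of_real (rho14 nu m) * x m n * complex_of_real (rho14 nu n))"

definition hs_extension :: "real \<Rightarrow> (real \<Rightarrow> mat \<Rightarrow> mat) \<Rightarrow> (real \<Rightarrow> mat \<Rightarrow> mat) \<Rightarrow> bool" where
  "hs_extension nu T TT \<longleftrightarrow>
     (\<forall>t\<ge>0. (\<forall>\<xi>\<in>hs. TT t \<xi> \<in> hs) \<and>
        (\<forall>\<xi>\<in>hs. \<forall>\<eta>\<in>hs. \<forall>a. TT t (\<lambda>m n. \<xi> m n + a * \<eta> m n) = (\<lambda>m n. TT t \<xi> m n + a * TT t \<eta> m n)) \<and>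
        (\<exists>C. \<forall>\<xi>\<in>hs. hs_norm (TT t \<xi>) \<le> C * hs_norm \<xi>) \<and>
        (\<forall>x. bounded_op x \<longrightarrow> TT t (iota nu x) = iota nu (T t x)))"

definition gen_has :: "(real \<Rightarrow> mat \<Rightarrow> mat) \<Rightarrow> mat \<Rightarrow> mat \<Rightarrow> bool" where
  "gen_has TT \<xi> \<eta> \<longleftrightarrow> \<eta> \<in> hs \<and>
     ((\<lambda>t. hs_norm (\<lambda>m n. (TT t \<xi> m n - \<xi> m n) / complex_of_real t - \<eta> m n)) \<longlongrightarrow> 0) (at_right 0)"

definition genD :: "(real \<Rightarrow> mat \<Rightarrow> mat) \<Rightarrow> mat set" where
  "genD TT = {\<xi> \<in> hs. \<exists>\<eta>. gen_has TT \<xi> \<eta>}"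

definition genL :: "(real \<Rightarrow> mat \<Rightarrow> mat) \<Rightarrow> mat \<Rightarrow> mat" where
  "genL TT \<xi> = (SOME \<eta>. gen_has TT \<xi> \<eta>)"

definition genKer :: "(real \<Rightarrow> mat \<Rightarrow> mat) \<Rightarrow> mat set" where
  "genKer TT = {\<xi> \<in> genD TT. genL TT \<xi> = (\<lambda>m n. 0)}"

definition hs_perp :: "mat set \<Rightarrow> mat set" where
  "hs_perp K = {\<xi> \<in> hs. \<forall>\<eta>\<in>K. hs_inner \<eta> \<xi> = 0}"

definition dirichlet :: "(real \<Rightarrow> mat \<Rightarrow> mat) \<Rightarrow> mat \<Rightarrow> real" where
  "dirichlet TT \<xi> = - Re (hs_inner \<xi> (genL TT \<xi>))"

definition spectral_gap :: "(real \<Rightarrow> mat \<Rightarrow> mat) \<Rightarrow> real" where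
  "spectral_gap TT = Inf {dirichlet TT \<xi> | \<xi>. \<xi> \<in> genD TT \<and> \<xi> \<in> hs_perp (genKer TT) \<and> hs_norm \<xi> = 1}"

definition cnr :: "real \<Rightarrow> real \<Rightarrow> real" where
  "cnr nu r = (1 - nu\<^sup>2) * (\<Sum>j. nu ^ (2 * j) / (real j + r))"

definition gap_bound :: "real \<Rightarrow> real \<Rightarrow> real \<Rightarrow> real" where
  "gap_bound lam nu r = lam\<^sup>2 *
     ((\<Sum>j. (real j + 1) / ((real j + r + 1)\<^sup>2 * (real j + r)) * nu ^ (2 * j)) /
      (\<Sum>j. (1 / (real j + r) - cnr nu r)\<^sup>2 * nu ^ (2 * j)))"

end

theory Submission
  imports Defs
begin

text \<open>Matrix entries decouple along diagonals, and on the main one the semigroup solves the backward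
  equation of a birth and death chain with rates \<open>\<lambda>\<^sup>2 (n + 1) (n + r)\<close> and
  \<open>\<mu>\<^sup>2 n (n + r - 1)\<close>, for which the weights \<open>\<nu>^(2 n)\<close> are reversible. The other
  diagonals satisfy the same energy estimate by the inequality of arithmetic and geometric means. For
  bounded solutions the truncated weighted energy decreases up to a boundary flux of order \<open>K^3 \<nu>^K\<close>; letting
  \<open>K\<close> tend to infinity gives both contractivity in the weighted norm and uniqueness. The test vector is
  the embedded centred diagonal matrix \<open>1 / (n + r) - c(\<nu>, r)\<close>: it and its image under the formal
  generator are bounded, so it lies in the domain, and its Dirichlet form is evaluated by
  summation by parts. Kernel elements are constant multiples of the weights on the main diagonal,
  so centring gives orthogonality. Boundedness of the solution comes from comparing the given minimal
  solution with the limit of the Picard iterates of the integral equation, which is sub-unital.\<close>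

section \<open>Finite sections of forms\<close>

text \<open>The hypotheses give little: a weak integral equation tested on \<open>domG\<close>,
  minimality, and for each time some bound on the extension. Neither the semigroup law nor
  continuity in time nor contractivity is among them. So everything is read off from matrix entries,
  where the equation is a countable system of ordinary differential equations, each with finitely
  many neighbours. The generator then has to be identified on the Hilbert-Schmidt space, with
  quotients converging in norm, and the Dirichlet form has to be shown nonnegative, since the
  infimum of a set without lower bound says nothing.

  The small gap has a simple cause. State 0 is left at rate lam^2 r, while its stationary mass 1 -
  nu^2 does not depend on r. For small r the state is nearly absorbing and its indicator nearly
  invariant. The sequence 1/(n + r), dominated by its value 1/r at n = 0, is a smoothed multiple of
  that indicator.\<close>

definition form :: "mat \<Rightarrow> vec \<Rightarrow> vec \<Rightarrow> nat \<Rightarrow> complex" where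
  "form x v u K = (\<Sum>m<K. \<Sum>n<K. cnj (v m) * x m n * u n)"

text \<open>Only finite corners enter, so no boundedness is presupposed and the notion is closed
  under entrywise limits and integrals. \<open>pos_op_iff\<close> relates it to
  \<open>pos_op\<close>.\<close>

definition psd :: "mat \<Rightarrow> bool" where
  "psd x \<longleftrightarrow> (\<forall>u K. form x u u K \<in> \<real>\<^sub>\<ge>\<^sub>0)"

abbreviation l2n :: "vec \<Rightarrow> nat \<Rightarrow> real" where
  "l2n u K \<equiv> L2_set (\<lambda>n. cmod (u n)) {..<K}"

definition form_bd :: "real \<Rightarrow> mat \<Rightarrow> bool" where
  "form_bd C x \<longleftrightarrow> (\<forall>v u K. cmod (form x v u K) \<le> C * l2n v K * l2n u K)"

definition diag :: "vec \<Rightarrow> mat" where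
  "diag d = (\<lambda>m n. if m = n then d n else 0)"

abbreviation idm :: mat where "idm \<equiv> diag (\<lambda>_. 1)"

definition unit_vec :: "nat \<Rightarrow> vec" where
  "unit_vec m = (\<lambda>n. if n = m then 1 else 0)"

lemma nonneg_Reals_iff_Re_Im: "z \<in> \<real>\<^sub>\<ge>\<^sub>0 \<longleftrightarrow> 0 \<le> Re z \<and> Im z = 0"
  by (simp add: complex_nonneg_Reals_iff)

lemma form_add_mult: "form (\<lambda>m n. x m n + a * y m n) v u K = form x v u K + a * form y v u K"
  by (simp add: form_def sum_distrib_left sum.distrib algebra_simps)

lemma form_diff: "form (\<lambda>m n. x m n - y m n) v u K = form x v u K - form y v u K"
  by (simp add: form_def sum_subtractf algebra_simps)

lemma form_add: "form (\<lambda>m n. x m n + y m n) v u K = form x v u K + form y v u K"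
  by (simp add: form_def sum.distrib algebra_simps)

lemma form_cmult: "form (\<lambda>m n. a * x m n) v u K = a * form x v u K"
  by (simp add: form_def sum_distrib_left algebra_simps)

lemma form_diag: "form (diag d) v u K = (\<Sum>n<K. cnj (v n) * d n * u n)"
proof -
  have "(\<Sum>n<K. cnj (v m) * diag d m n * u n) = cnj (v m) * d m * u m" if "m < K" for m
  proof -
    have "(\<Sum>n<K. cnj (v m) * diag d m n * u n)
        = (\<Sum>n<K. if n = m then cnj (v m) * d m * u m else 0)"
      by (rule sum.cong) (auto simp: diag_def)
    also have "\<dots> = cnj (v m) * d m * u m"
      using that by simp
    finally show ?thesis .
  qed
  then show ?thesis by (simp add: form_def)
qed

lemma l2n_squared: "(l2n u K)\<^sup>2 = (\<Sum>n<K. (cmod (u n))\<^sup>2)"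
  by (simp add: L2_set_def sum_nonneg)

lemma l2n_mono: "K \<le> J \<Longrightarrow> l2n u K \<le> l2n u J"
  unfolding L2_set_def by (intro real_sqrt_le_mono sum_mono2) auto

lemma form_idm: "form idm u u K = complex_of_real ((l2n u K)\<^sup>2)"
  by (simp add: form_diag l2n_squared complex_norm_square mult.commute del: of_real_power)

lemma form_quad:
  "form x (\<lambda>n. a * v n + b * u n) (\<lambda>n. a * v n + b * u n) K =
     cnj a * a * form x v v K + cnj a * b * form x v u K +
     cnj b * a * form x u v K + cnj b * b * form x u u K"
  by (simp add: form_def sum_distrib_left sum.distrib algebra_simps)

lemma form_unit: "m < K \<Longrightarrow> n < K \<Longrightarrow> form x (unit_vec m) (unit_vec n) K = x m n"
proof -
  assume mn: "m < K" "n < K"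
  have "(\<Sum>j<K. cnj (unit_vec m i) * x i j * unit_vec n j)
      = (if i = m then (\<Sum>j<K. if j = n then x m n else 0) else 0)" for i
    using mn by (cases "i = m") (auto simp: unit_vec_def if_distrib[of "\<lambda>a. _ * a"] cong: if_cong)
  then have "form x (unit_vec m) (unit_vec n) K
      = (\<Sum>i<K. if i = m then (\<Sum>j<K. if j = n then x m n else 0) else 0)"
    unfolding form_def by simp
  then show ?thesis using mn by simp
qed

lemma psd_diagonal: "psd x \<Longrightarrow> x n n \<in> \<real>\<^sub>\<ge>\<^sub>0"
  using form_unit[of n "Suc n" n x] unfolding psd_def by (metis lessI)

text \<open>Polarisation: real values of the form at e_m + e_n settle the imaginary parts, real
  values at e_m + i e_n the real parts.\<close>

lemma psd_hermitian:
  assumes "psd x" shows "x n m = cnj (x m n)"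
proof -
  define K where "K = Suc (max m n)"
  have K: "m < K" "n < K" by (auto simp: K_def)
  have Q: "cnj a * a * x m m + cnj a * b * x m n + cnj b * a * x n m + cnj b * b * x n n \<in> \<real>\<^sub>\<ge>\<^sub>0"
    for a b
    using assms[unfolded psd_def, rule_format, of "\<lambda>i. a * unit_vec m i + b * unit_vec n i" K]
    by (simp add: form_quad form_unit K)
  have d: "Im (x m m) = 0" "Im (x n n) = 0"
    using psd_diagonal[OF assms] by (auto simp: nonneg_Reals_iff_Re_Im)
  have 1: "Im (x m n) + Im (x n m) = 0"
    using Q[of 1 1] d by (simp add: nonneg_Reals_iff_Re_Im)
  have 2: "Re (x m n) - Re (x n m) = 0"
    using Q[of 1 \<i>] d by (simp add: nonneg_Reals_iff_Re_Im)
  show ?thesis using 1 2 by (simp add: complex_eq_iff)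
qed

lemma psd_form_swap:
  assumes "psd x" shows "form x u v K = cnj (form x v u K)"
proof -
  have "cnj (cnj (v m) * x m n * u n) = cnj (u n) * x n m * v m" for m n
    by (subst psd_hermitian[OF assms, of n m]) (simp add: mult_ac)
  then have "cnj (form x v u K) = (\<Sum>m<K. \<Sum>n<K. cnj (u n) * x n m * v m)"
    unfolding form_def cnj_sum by (intro sum.cong refl) blast
  also have "\<dots> = form x u v K"
    unfolding form_def by (rule sum.swap)
  finally show ?thesis by simp
qed

lemma psd_add: "psd x \<Longrightarrow> psd y \<Longrightarrow> psd (\<lambda>m n. x m n + y m n)"
  unfolding psd_def by (simp add: form_add)

lemma psd_cmult: "0 \<le> a \<Longrightarrow> psd x \<Longrightarrow> psd (\<lambda>m n. complex_of_real a * x m n)"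
  unfolding psd_def by (simp add: form_cmult)

lemma psd_idm: "psd idm"
  unfolding psd_def by (simp add: form_idm del: of_real_power)

lemma psd_lim:
  assumes "\<And>k. psd (x k)" "\<And>m n. (\<lambda>k. x k m n) \<longlonglongrightarrow> y m n"
  shows "psd y"
  unfolding psd_def
proof (intro allI)
  fix u K
  have "(\<lambda>k. form (x k) u u K) \<longlonglongrightarrow> form y u u K"
    unfolding form_def by (intro tendsto_intros assms)
  moreover have "form (x k) u u K \<in> \<real>\<^sub>\<ge>\<^sub>0" for k
    using assms(1)[of k] unfolding psd_def by blast
  ultimately show "form y u u K \<in> \<real>\<^sub>\<ge>\<^sub>0"
    by (rule closed_sequentially[OF closed_nonneg_Reals_complex, rotated])
qed

lemma form_bd_lim:
  assumes "\<And>k. form_bd C (x k)" "\<And>m n. (\<lambda>k. x k m n) \<longlonglongrightarrow> y m n"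
  shows "form_bd C y"
  unfolding form_bd_def
proof (intro allI)
  fix v u K
  have "(\<lambda>k. cmod (form (x k) v u K)) \<longlonglongrightarrow> cmod (form y v u K)"
    unfolding form_def by (intro tendsto_intros assms)
  then show "cmod (form y v u K) \<le> C * l2n v K * l2n u K"
    using assms(1) unfolding form_bd_def
    by (intro LIMSEQ_le_const2[where X = "\<lambda>k. cmod (form (x k) v u K)"]) auto
qed

lemma form_bd_entry: "form_bd C x \<Longrightarrow> cmod (x m n) \<le> C"
proof -
  assume C: "form_bd C x"
  define K where "K = Suc (max m n)"
  have K: "m < K" "n < K" by (auto simp: K_def)
  have u: "l2n (unit_vec i) K = 1" if "i < K" for i
  proof -
    have "(\<Sum>n<K. (cmod (unit_vec i n))\<^sup>2) = (\<Sum>n<K. if n = i then 1 else 0)"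
      by (intro sum.cong refl) (auto simp: unit_vec_def)
    then show ?thesis using that by (simp add: L2_set_def)
  qed
  show ?thesis
    using C[unfolded form_bd_def, rule_format, of "unit_vec m" "unit_vec n" K]
    by (simp add: form_unit K u)
qed

lemma l2n_zeroD: "l2n u K = 0 \<Longrightarrow> n < K \<Longrightarrow> u n = 0"
  by (simp add: L2_set_eq_0_iff)

text \<open>Cauchy-Schwarz with the upper bound built in, so that no factor is lost: positivity at a
  combination of \<open>v\<close> and \<open>u\<close> bounds the cross term by the two diagonal
  values, and each of those is at most \<open>C\<close> times a squared norm.\<close>

lemma psd_le_form_bd:
  assumes x: "psd x" and Cx: "psd (\<lambda>m n. complex_of_real C * idm m n - x m n)"
  shows "form_bd C x"
  unfolding form_bd_def
proof (intro allI)
  fix v u K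
  define \<alpha> \<beta> where "\<alpha> = l2n u K" and "\<beta> = l2n v K"
  define z where "z = form x v u K"
  have nn: "\<alpha> \<ge> 0" "\<beta> \<ge> 0" by (auto simp: \<alpha>_def \<beta>_def)
  have le: "Re (form x w w K) \<le> C * (l2n w K)\<^sup>2" for w
    using Cx[unfolded psd_def, rule_format, of w K]
    by (simp add: form_diff form_cmult form_idm nonneg_Reals_iff_Re_Im)
  show "cmod (form x v u K) \<le> C * l2n v K * l2n u K"
  proof (cases "\<alpha> = 0 \<or> \<beta> = 0 \<or> z = 0")
    case True
    consider "\<alpha> = 0" | "\<beta> = 0" | "z = 0" "\<alpha> > 0" using True nn by force
    then show ?thesis
    proof cases
      case 1
      then have "form x v u K = 0"
        unfolding form_def \<alpha>_def by (intro sum.neutral ballI) (use l2n_zeroD in auto)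
      with 1 show ?thesis by (simp add: \<alpha>_def)
    next
      case 2
      then have "form x v u K = 0"
        unfolding form_def \<beta>_def by (intro sum.neutral ballI) (use l2n_zeroD in auto)
      with 2 show ?thesis by (simp add: \<beta>_def)
    next
      case 3
      have "0 \<le> Re (form x u u K)"
        using x unfolding psd_def nonneg_Reals_iff_Re_Im by blast
      with le[of u] have "0 \<le> C * \<alpha>\<^sup>2" by (simp add: \<alpha>_def)
      with 3 have "0 \<le> C" by (simp add: zero_le_mult_iff)
      with 3 show ?thesis by (simp add: z_def)
    qed
  next
    case False
    \<comment> \<open>The phase \<open>c\<close> turns the cross term into its modulus. In
      \<open>w\<close> each vector is scaled by the norm of the other, so that both diagonal terms
      have the same bound \<open>C * \<alpha>\<^sup>2 * \<beta>\<^sup>2\<close>.\<close>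
    define c where "c = cnj z / complex_of_real (cmod z)"
    have cz: "c * z = complex_of_real (cmod z)"
    proof -
      have "c * z = (z * cnj z) / complex_of_real (cmod z)" by (simp add: c_def mult.commute)
      also have "\<dots> = complex_of_real (cmod z)"
        unfolding complex_norm_square[symmetric] using False by (simp add: power2_eq_square)
      finally show ?thesis .
    qed
    have ccz: "cnj c * cnj z = complex_of_real (cmod z)"
      using arg_cong[OF cz, of cnj] by simp
    have cc: "cnj c * c = 1"
    proof -
      have "cnj c * c = (z * cnj z) / (complex_of_real (cmod z))\<^sup>2"
        by (simp add: c_def power2_eq_square)
      also have "\<dots> = 1"
        unfolding complex_norm_square[symmetric] using False by simp
      finally show ?thesis .
    qed
    define w where "w = (\<lambda>n. complex_of_real \<alpha> * v n + (- complex_of_real \<beta> * c) * u n)"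
    have "form x w w K = complex_of_real (\<alpha>\<^sup>2) * form x v v K
        - complex_of_real (\<alpha> * \<beta>) * (c * z) - complex_of_real (\<alpha> * \<beta>) * (cnj c * cnj z)
        + complex_of_real (\<beta>\<^sup>2) * (cnj c * c) * form x u u K"
      unfolding w_def form_quad psd_form_swap[OF x, of u v] z_def[symmetric]
      by (simp add: power2_eq_square algebra_simps)
    then have "Re (form x w w K) = \<alpha>\<^sup>2 * Re (form x v v K) - 2 * \<alpha> * \<beta> * cmod z + \<beta>\<^sup>2 * Re (form x u u K)"
      by (simp add: cz ccz cc del: of_real_power)
    moreover have "Re (form x w w K) \<ge> 0"
      using x unfolding psd_def nonneg_Reals_iff_Re_Im by blast
    moreover have "\<alpha>\<^sup>2 * Re (form x v v K) \<le> \<alpha>\<^sup>2 * (C * \<beta>\<^sup>2)"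
      using le[of v] by (intro mult_left_mono) (auto simp: \<beta>_def)
    moreover have "\<beta>\<^sup>2 * Re (form x u u K) \<le> \<beta>\<^sup>2 * (C * \<alpha>\<^sup>2)"
      using le[of u] by (intro mult_left_mono) (auto simp: \<alpha>_def)
    ultimately have "2 * (\<alpha> * \<beta>) * cmod z \<le> 2 * (\<alpha> * \<beta>) * (C * \<beta> * \<alpha>)"
      by (simp add: power2_eq_square algebra_simps)
    moreover have "0 < 2 * (\<alpha> * \<beta>)" using False nn by auto
    ultimately have "cmod z \<le> C * \<beta> * \<alpha>" by (rule mult_left_le_imp_le)
    then show ?thesis by (simp add: z_def \<alpha>_def \<beta>_def)
  qed
qed

section \<open>Bounds for forms, and positive sub-unital maps\<close>

lemma form_cnj_transpose: "form (\<lambda>m n. cnj (x n m)) v u K = cnj (form x u v K)"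
proof -
  have "cnj (form x u v K) = (\<Sum>m<K. \<Sum>n<K. u m * cnj (x m n) * cnj (v n))"
    unfolding form_def cnj_sum by simp
  also have "\<dots> = (\<Sum>n<K. \<Sum>m<K. u m * cnj (x m n) * cnj (v n))"
    by (rule sum.swap)
  finally show ?thesis by (simp add: form_def mult_ac)
qed

lemma form_bd_nonneg: "form_bd C x \<Longrightarrow> 0 \<le> C"
  using form_bd_entry[of C x 0 0] norm_ge_zero order_trans by blast

lemma form_bd_add_mult:
  assumes "form_bd C x" "form_bd D y"
  shows "form_bd (C + cmod a * D) (\<lambda>m n. x m n + a * y m n)"
  unfolding form_bd_def form_add_mult
proof (intro allI)
  fix v u K
  have "cmod (form x v u K + a * form y v u K) \<le> cmod (form x v u K) + cmod a * cmod (form y v u K)"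
    using norm_triangle_ineq[of "form x v u K" "a * form y v u K"] by (simp add: norm_mult)
  also have "\<dots> \<le> C * l2n v K * l2n u K + cmod a * (D * l2n v K * l2n u K)"
    using assms unfolding form_bd_def by (intro add_mono mult_left_mono) auto
  finally show "cmod (form x v u K + a * form y v u K) \<le> (C + cmod a * D) * l2n v K * l2n u K"
    by (simp add: algebra_simps)
qed

lemma form_bd_diag:
  assumes "\<And>n. cmod (d n) \<le> C" shows "form_bd C (diag d)"
  unfolding form_bd_def
proof (intro allI)
  fix v u K
  have C: "0 \<le> C" using assms[of 0] norm_ge_zero order_trans by blast
  have "cmod (form (diag d) v u K) \<le> (\<Sum>n<K. C * (\<bar>cmod (v n)\<bar> * \<bar>cmod (u n)\<bar>))"
    unfolding form_diag
  proof (intro sum_norm_le)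
    fix n
    have "cmod (v n) * cmod (u n) * cmod (d n) \<le> cmod (v n) * cmod (u n) * C"
      by (intro mult_left_mono assms) auto
    then show "cmod (cnj (v n) * d n * u n) \<le> C * (\<bar>cmod (v n)\<bar> * \<bar>cmod (u n)\<bar>)"
      by (simp add: norm_mult mult_ac)
  qed
  also have "\<dots> \<le> C * (l2n v K * l2n u K)"
    unfolding sum_distrib_left[symmetric] by (intro mult_left_mono L2_set_mult_ineq C)
  finally show "cmod (form (diag d) v u K) \<le> C * l2n v K * l2n u K" by simp
qed

text \<open>The crude bound by the sum of all moduli suffices: it makes every finite corner of a
  Hilbert-Schmidt matrix the \<open>iota\<close>-image of a bounded operator.\<close>

lemma form_bd_finite:
  assumes "\<And>m n. J \<le> m \<or> J \<le> n \<Longrightarrow> x m n = 0"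
  shows "\<exists>C. form_bd C x"
proof
  define C where "C = (\<Sum>m<J. \<Sum>n<J. cmod (x m n))"
  have le: "cmod (v i) \<le> l2n v K" if "i < K" for v i K
    using member_le_L2_set[of "{..<K}" i "\<lambda>n. cmod (v n)"] that by auto
  show "form_bd C x"
    unfolding form_bd_def
  proof (intro allI)
    fix v u K
    have "cmod (form x v u K) \<le> (\<Sum>m<K. \<Sum>n<K. cmod (x m n) * (l2n v K * l2n u K))"
      unfolding form_def
    proof (intro sum_norm_le)
      fix m n assume "m \<in> {..<K}" "n \<in> {..<K}"
      then have "cmod (x m n) * (cmod (v m) * cmod (u n)) \<le> cmod (x m n) * (l2n v K * l2n u K)"
        by (intro mult_left_mono mult_mono le) auto
      then show "cmod (cnj (v m) * x m n * u n) \<le> cmod (x m n) * (l2n v K * l2n u K)"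
        by (simp add: norm_mult mult_ac)
    qed
    also have "\<dots> = (\<Sum>m<K. \<Sum>n<K. cmod (x m n)) * (l2n v K * l2n u K)"
      by (simp add: sum_distrib_right)
    also have "\<dots> \<le> C * (l2n v K * l2n u K)"
    proof (intro mult_right_mono)
      have "(\<Sum>m<K. \<Sum>n<K. cmod (x m n)) \<le> (\<Sum>m<max J K. \<Sum>n<max J K. cmod (x m n))"
        by (intro order_trans[OF sum_mono sum_mono2] sum_mono2 sum_nonneg) auto
      also have "\<dots> = (\<Sum>m<J. \<Sum>n<max J K. cmod (x m n))"
        by (intro sum.mono_neutral_right) (auto simp: assms)
      also have "\<dots> = C"
        unfolding C_def by (intro sum.cong refl sum.mono_neutral_right) (auto simp: assms)
      finally show "(\<Sum>m<K. \<Sum>n<K. cmod (x m n)) \<le> C" .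
    qed auto
    finally show "cmod (form x v u K) \<le> C * l2n v K * l2n u K" by simp
  qed
qed

text \<open>A form-bounded \<open>x\<close> is a combination of \<open>0 \<le> Re x + C, Im x + C \<le> 2 C\<close> and the identity,
  which replaces the positive and negative parts of self-adjoint operators.\<close>

lemma form_bd_decomp:
  assumes "form_bd C x"
  obtains y z where
    "form_bd (2 * C) y" "form_bd (2 * C) z" "psd y" "psd z"
    "psd (\<lambda>m n. complex_of_real (2 * C) * idm m n - y m n)"
    "psd (\<lambda>m n. complex_of_real (2 * C) * idm m n - z m n)"
    "x = (\<lambda>m n. (y m n + \<i> * z m n) + (- complex_of_real C * (1 + \<i>)) * idm m n)"
proof -
  define y where "y = (\<lambda>m n. (1/2) * (x m n + cnj (x n m)) + complex_of_real C * idm m n)"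
  define z where "z = (\<lambda>m n. (- \<i>/2) * (x m n + (-1) * cnj (x n m)) + complex_of_real C * idm m n)"
  have fy: "form y u u K = complex_of_real (Re (form x u u K) + C * (l2n u K)\<^sup>2)" for u K
    unfolding y_def form_add form_cmult form_add_mult form_cnj_transpose form_idm
    by (simp add: complex_eq_iff)
  have fz: "form z u u K = complex_of_real (Im (form x u u K) + C * (l2n u K)\<^sup>2)" for u K
    unfolding z_def form_add_mult form_cmult form_cnj_transpose form_idm form_add_mult
    by (simp add: complex_eq_iff)
  have b: "cmod (form x u u K) \<le> C * (l2n u K)\<^sup>2" for u K
    using assms[unfolded form_bd_def, rule_format, of u u K] by (simp add: power2_eq_square)
  have bR: "\<bar>Re (form x u u K)\<bar> \<le> C * (l2n u K)\<^sup>2" and bI: "\<bar>Im (form x u u K)\<bar> \<le> C * (l2n u K)\<^sup>2" for u K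
    using b[of u K] abs_Re_le_cmod[of "form x u u K"] abs_Im_le_cmod[of "form x u u K"]
    by linarith+
  have 1: "psd y" unfolding psd_def fy nonneg_Reals_iff_Re_Im
  proof (intro allI conjI)
    fix u K show "0 \<le> Re (complex_of_real (Re (form x u u K) + C * (l2n u K)\<^sup>2))"
      using bR[of u K] unfolding abs_le_iff Re_complex_of_real by linarith
  qed (simp only: Im_complex_of_real)
  have 2: "psd z" unfolding psd_def fz nonneg_Reals_iff_Re_Im
  proof (intro allI conjI)
    fix u K show "0 \<le> Re (complex_of_real (Im (form x u u K) + C * (l2n u K)\<^sup>2))"
      using bI[of u K] unfolding abs_le_iff Re_complex_of_real by linarith
  qed (simp only: Im_complex_of_real)
  have 3: "psd (\<lambda>m n. complex_of_real (2 * C) * idm m n - y m n)"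
    unfolding psd_def form_diff form_cmult fy form_idm nonneg_Reals_iff_Re_Im
  proof (intro allI conjI)
    fix u K
    show "0 \<le> Re (complex_of_real (2 * C) * complex_of_real ((l2n u K)\<^sup>2) -
                complex_of_real (Re (form x u u K) + C * (l2n u K)\<^sup>2))"
      using bR[of u K] unfolding abs_le_iff by simp
  qed (simp)
  have 4: "psd (\<lambda>m n. complex_of_real (2 * C) * idm m n - z m n)"
    unfolding psd_def form_diff form_cmult fz form_idm nonneg_Reals_iff_Re_Im
  proof (intro allI conjI)
    fix u K
    show "0 \<le> Re (complex_of_real (2 * C) * complex_of_real ((l2n u K)\<^sup>2) -
                complex_of_real (Im (form x u u K) + C * (l2n u K)\<^sup>2))"
      using bI[of u K] unfolding abs_le_iff by simp
  qed (simp)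
  have 5: "x = (\<lambda>m n. (y m n + \<i> * z m n) + (- complex_of_real C * (1 + \<i>)) * idm m n)"
    by (intro ext) (simp add: y_def z_def algebra_simps)
  show ?thesis
    using that[OF psd_le_form_bd[OF 1 3] psd_le_form_bd[OF 2 4] 1 2 3 4 5] .
qed

text \<open>The image of each of the two positive parts lies between 0 and 2 C, and the scalar part
  contributes at most 2 C, whence 6 = 2 + 2 + 2. What counts is that the constant depends neither on
  time nor on the iterate.\<close>

lemma positive_subunital_form_bd:
  fixes F :: "mat \<Rightarrow> mat"
  assumes lin: "\<And>x y a C D. form_bd C x \<Longrightarrow> form_bd D y \<Longrightarrow>
      F (\<lambda>m n. x m n + a * y m n) = (\<lambda>m n. F x m n + a * F y m n)"
    and pos: "\<And>x C. form_bd C x \<Longrightarrow> psd x \<Longrightarrow> psd (F x)"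
    and sub: "psd (\<lambda>m n. idm m n - F idm m n)"
    and x: "form_bd C x"
  shows "form_bd (6 * C) (F x)"
proof -
  have C: "0 \<le> C" using form_bd_nonneg[OF x] .
  have idm: "form_bd 1 idm" by (rule form_bd_diag) simp
  have *: "form_bd (2 * C) (F y)"
    if y: "form_bd (2 * C) y" "psd y" "psd (\<lambda>m n. complex_of_real (2 * C) * idm m n - y m n)" for y
  proof (rule psd_le_form_bd)
    show "psd (F y)" using y pos by blast
    have zero: "form_bd 0 (\<lambda>_ _. 0)" by (simp add: form_bd_def form_def)
    \<comment> \<open>Linearity is given in the form x + a y only; x = y = 0 and a = -1 yield the
      value at 0.\<close>
    have F0: "F (\<lambda>m n. 0) = (\<lambda>m n. 0)"
      using lin[OF zero zero, of "-1"] by simp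
    have b1: "form_bd (2*C) (\<lambda>m n. 0 + complex_of_real (2 * C) * idm m n)"
      using form_bd_add_mult[OF zero idm, of "complex_of_real (2 * C)"] C by (simp add: norm_mult)
    have b2: "form_bd (2*C + 2*C) (\<lambda>m n. (0 + complex_of_real (2 * C) * idm m n) + (-1) * y m n)"
      using form_bd_add_mult[OF b1 y(1), of "-1"] by simp
    have "psd (F (\<lambda>m n. (0 + complex_of_real (2 * C) * idm m n) + (-1) * y m n))"
      by (rule pos[OF b2]) (use y(3) in simp)
    then have p: "psd (\<lambda>m n. complex_of_real (2 * C) * F idm m n - F y m n)"
      unfolding lin[OF b1 y(1)] lin[OF zero idm] F0 by simp
    have "psd (\<lambda>m n. complex_of_real (2 * C) * (idm m n - F idm m n)
       + (complex_of_real (2 * C) * F idm m n - F y m n))"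
      by (intro psd_add psd_cmult sub p) (use C in auto)
    then show "psd (\<lambda>m n. complex_of_real (2 * C) * idm m n - F y m n)"
      by (simp add: algebra_simps)
  qed
  obtain y z where yz: "form_bd (2 * C) y" "form_bd (2 * C) z" "psd y" "psd z"
    "psd (\<lambda>m n. complex_of_real (2 * C) * idm m n - y m n)"
    "psd (\<lambda>m n. complex_of_real (2 * C) * idm m n - z m n)"
    "x = (\<lambda>m n. (y m n + \<i> * z m n) + (- complex_of_real C * (1 + \<i>)) * idm m n)"
    using form_bd_decomp[OF x] .
  have F: "F x = (\<lambda>m n. (F y m n + \<i> * F z m n) + (- complex_of_real C * (1 + \<i>)) * F idm m n)"
    by (subst yz(7)) (simp only: lin[OF form_bd_add_mult[OF yz(1,2)] idm] lin[OF yz(1,2)])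
  have Fid: "form_bd 1 (F idm)"
    by (rule psd_le_form_bd) (use pos[OF idm psd_idm] sub in auto)
  have "cmod (- complex_of_real C * (1 + \<i>)) \<le> C * 2"
    using C norm_triangle_ineq[of 1 \<i>] by (simp add: norm_mult mult_left_mono)
  moreover have "form_bd (2 * C + 1 * (2 * C) + cmod (- complex_of_real C * (1 + \<i>)) * 1) (F x)"
    unfolding F using form_bd_add_mult[OF form_bd_add_mult[OF *[OF yz(1,3,5)] *[OF yz(2,4,6)], of \<i>] Fid, of "- complex_of_real C * (1 + \<i>)"]
    by simp
  ultimately show ?thesis
    unfolding form_bd_def
    by (smt (verit, best) L2_set_nonneg mult_right_mono)
qed

section \<open>Bounded and positive operators\<close>

definition trunc :: "vec \<Rightarrow> nat \<Rightarrow> vec" where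
  "trunc u K = (\<lambda>n. if n < K then u n else 0)"

lemma finite_support_l2: "(\<And>n. K \<le> n \<Longrightarrow> u n = 0) \<Longrightarrow> u \<in> l2"
  unfolding l2_def by (auto intro!: summable_finite[of "{..<K}"]) (meson not_le)

lemma vnorm_nonneg: "u \<in> l2 \<Longrightarrow> 0 \<le> vnorm u"
  unfolding vnorm_def l2_def by (auto intro!: suminf_nonneg)

lemma vnorm_finite: "(\<And>n. K \<le> n \<Longrightarrow> u n = 0) \<Longrightarrow> vnorm u = l2n u K"
  unfolding vnorm_def L2_set_def by (subst suminf_finite[of "{..<K}"]) auto

lemma l2n_le_vnorm: "u \<in> l2 \<Longrightarrow> l2n u K \<le> vnorm u"
  unfolding l2_def vnorm_def L2_set_def by (auto intro!: sum_le_suminf)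

lemma l2_boundI:
  assumes "\<And>K. l2n u K \<le> C"
  shows "u \<in> l2 \<and> vnorm u \<le> C"
proof -
  have C: "0 \<le> C" using assms[of 0] by simp
  have b: "(\<Sum>n<K. (cmod (u n))\<^sup>2) \<le> C\<^sup>2" for K
    using power_mono[OF assms[of K], of 2] by (simp add: l2n_squared)
  have s: "summable (\<lambda>n. (cmod (u n))\<^sup>2)"
    by (rule summableI_nonneg_bounded[of _ "C\<^sup>2"]) (auto intro: b)
  have "(\<Sum>n. (cmod (u n))\<^sup>2) \<le> C\<^sup>2"
    by (rule suminf_le_const[OF s]) (rule b)
  then have "vnorm u \<le> C" unfolding vnorm_def using C real_le_lsqrt by blast
  with s show ?thesis by (simp add: l2_def)
qed

lemma l2_cnj: "u \<in> l2 \<Longrightarrow> (\<lambda>n. cnj (u n)) \<in> l2"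
  by (simp add: l2_def)

lemma l2_product:
  assumes "v \<in> l2" "u \<in> l2"
  shows "summable (\<lambda>n. norm (cnj (v n) * u n))" "norm (vinner v u) \<le> vnorm v * vnorm u"
proof -
  have b: "(\<Sum>n<K. norm (cnj (v n) * u n)) \<le> vnorm v * vnorm u" for K
  proof -
    have "(\<Sum>n<K. norm (cnj (v n) * u n)) \<le> l2n v K * l2n u K"
      using L2_set_mult_ineq[of "\<lambda>n. cmod (v n)" "\<lambda>n. cmod (u n)" "{..<K}"] by (simp add: norm_mult)
    also have "\<dots> \<le> vnorm v * vnorm u"
      by (intro mult_mono l2n_le_vnorm assms vnorm_nonneg L2_set_nonneg)
    finally show ?thesis .
  qed
  show s: "summable (\<lambda>n. norm (cnj (v n) * u n))"
    by (rule summableI_nonneg_bounded[of _ "vnorm v * vnorm u"]) (auto intro: b)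
  have "norm (vinner v u) \<le> (\<Sum>n. norm (cnj (v n) * u n))"
    unfolding vinner_def by (rule summable_norm[OF s])
  also have "\<dots> \<le> vnorm v * vnorm u" by (rule suminf_le_const[OF s b])
  finally show "norm (vinner v u) \<le> vnorm v * vnorm u" .
qed

lemma l2_product': "v \<in> l2 \<Longrightarrow> u \<in> l2 \<Longrightarrow> summable (\<lambda>n. v n * u n)"
  using summable_norm_cancel[OF l2_product(1)[OF l2_cnj, of v u]] by simp

lemma mat_app_finite:
  assumes "\<And>n. K \<le> n \<Longrightarrow> u n = 0"
  shows "mat_app x u m = (\<Sum>n<K. x m n * u n)"
  unfolding mat_app_def by (rule suminf_finite) (use assms in auto)

lemma vinner_mat_app_finite:
  assumes "\<And>n. K \<le> n \<Longrightarrow> v n = 0" "\<And>n. K \<le> n \<Longrightarrow> u n = 0"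
  shows "vinner v (mat_app x u) = form x v u K"
proof -
  have "vinner v (mat_app x u) = (\<Sum>m<K. cnj (v m) * mat_app x u m)"
    unfolding vinner_def by (rule suminf_finite) (use assms in auto)
  then show ?thesis
    by (simp add: mat_app_finite[OF assms(2)] form_def sum_distrib_left mult.assoc)
qed

lemma form_trunc: "form x (trunc v K) (trunc u K) K = form x v u K"
  by (simp add: form_def trunc_def)

lemma bounded_op_form_bd:
  assumes "bounded_op x" obtains C where "form_bd C x"
proof -
  obtain C where C: "\<And>u. u \<in> l2 \<Longrightarrow> mat_app x u \<in> l2 \<and> vnorm (mat_app x u) \<le> C * vnorm u"
    using assms unfolding bounded_op_def by blast
  have "form_bd C x"
    unfolding form_bd_def
  proof (intro allI)
    fix v u K
    have u: "trunc u K \<in> l2" "trunc v K \<in> l2" by (auto intro!: finite_support_l2[of K] simp: trunc_def)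
    have n: "vnorm (trunc w K) = l2n w K" for w
      by (subst vnorm_finite[of K]) (auto simp: trunc_def L2_set_def)
    have "form x v u K = vinner (trunc v K) (mat_app x (trunc u K))"
      by (subst vinner_mat_app_finite[of K]) (simp_all add: form_trunc, simp_all add: trunc_def)
    also have "cmod \<dots> \<le> vnorm (trunc v K) * vnorm (mat_app x (trunc u K))"
      by (rule l2_product) (use u C in auto)
    also have "\<dots> \<le> vnorm (trunc v K) * (C * vnorm (trunc u K))"
      using C u vnorm_nonneg by (intro mult_left_mono) auto
    finally show "cmod (form x v u K) \<le> C * l2n v K * l2n u K"
      unfolding n by (simp add: mult_ac)
  qed
  then show ?thesis using that by blast
qed

text \<open>Testing with the basis vector e_m and the conjugate of the row itself turns the bound
  into norm^2 <= C norm on every corner containing \<open>m\<close>.\<close>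

lemma form_bd_row:
  assumes "form_bd C x" shows "(\<lambda>n. x m n) \<in> l2"
proof -
  have C: "0 \<le> C" using form_bd_nonneg[OF assms] .
  have "l2n (\<lambda>n. x m n) K \<le> C" for K
  proof -
    define J where "J = max K (Suc m)"
    have mJ: "m < J" by (auto simp: J_def)
    have "(\<Sum>i<J. (cmod (unit_vec m i))\<^sup>2) = (\<Sum>i<J. if i = m then 1 else 0)"
      by (intro sum.cong refl) (auto simp: unit_vec_def)
    then have 1: "l2n (unit_vec m) J = 1" using mJ by (simp add: L2_set_def)
    have "(\<Sum>n<J. cnj (unit_vec m i) * x i n * cnj (x m n))
        = (if i = m then \<Sum>n<J. x m n * cnj (x m n) else 0)" for i
      by (auto simp: unit_vec_def)
    then have "form x (unit_vec m) (\<lambda>n. cnj (x m n)) J = (\<Sum>n<J. x m n * cnj (x m n))"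
      unfolding form_def using mJ by simp
    also have "\<dots> = complex_of_real ((l2n (\<lambda>n. x m n) J)\<^sup>2)"
      by (simp add: l2n_squared complex_norm_square del: of_real_power)
    finally have "(l2n (\<lambda>n. x m n) J)\<^sup>2 \<le> C * l2n (\<lambda>n. x m n) J"
      using assms[unfolded form_bd_def, rule_format, of "unit_vec m" "\<lambda>n. cnj (x m n)" J] 1
      by (simp add: norm_power)
    then have "l2n (\<lambda>n. x m n) J \<le> C"
      by (smt (verit) L2_set_nonneg C mult_right_le_imp_le power2_eq_square)
    then show ?thesis using l2n_mono[of K J] by (simp add: J_def) (meson order_trans max.cobounded1)
  qed
  then show ?thesis using l2_boundI by blast
qed

text \<open>The partial image \<open>w L\<close>, tested against its own truncation to
  \<open>K\<close> coordinates, again gives norm^2 <= C norm times the norm of \<open>u\<close>.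
  Then \<open>L\<close> grows with \<open>K\<close> fixed.\<close>

lemma form_bd_mat_app:
  assumes x: "form_bd C x" and u: "u \<in> l2"
  shows "mat_app x u \<in> l2 \<and> vnorm (mat_app x u) \<le> C * vnorm u"
proof (rule l2_boundI)
  fix K
  have C: "0 \<le> C" using form_bd_nonneg[OF x] .
  define w where "w = (\<lambda>L m. \<Sum>n<L. x m n * u n)"
  have lim: "(\<lambda>L. w L m) \<longlonglongrightarrow> mat_app x u m" for m
    unfolding w_def mat_app_def using l2_product'[OF form_bd_row[OF x] u] by (rule summable_LIMSEQ)
  have lim2: "(\<lambda>L. l2n (w L) K) \<longlonglongrightarrow> l2n (mat_app x u) K"
    unfolding L2_set_def by (intro tendsto_intros lim)
  have "l2n (w L) K \<le> C * vnorm u" if "K \<le> L" for L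
  proof -
    define v where "v = trunc (w L) K"
    have "form x v u L = (\<Sum>m<L. cnj (v m) * w L m)"
      by (simp add: form_def w_def sum_distrib_left mult.assoc)
    also have "\<dots> = (\<Sum>m<K. cnj (v m) * w L m)"
      using that by (intro sum.mono_neutral_right) (auto simp: v_def trunc_def)
    also have "\<dots> = complex_of_real ((l2n (w L) K)\<^sup>2)"
      by (simp add: v_def trunc_def l2n_squared complex_norm_square mult.commute del: of_real_power)
    finally have f: "cmod (form x v u L) = (l2n (w L) K)\<^sup>2" by (simp add: norm_power)
    have "(\<Sum>m<L. (cmod (v m))\<^sup>2) = (\<Sum>m<K. (cmod (w L m))\<^sup>2)"
      using that by (intro sum.mono_neutral_cong_right) (auto simp: v_def trunc_def)
    then have "l2n v L = l2n (w L) K" by (simp add: L2_set_def)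
    then have "(l2n (w L) K)\<^sup>2 \<le> C * l2n (w L) K * l2n u L"
      using x[unfolded form_bd_def, rule_format, of v u L] f by simp
    then have "l2n (w L) K * l2n (w L) K \<le> (C * l2n u L) * l2n (w L) K"
      by (simp add: power2_eq_square mult.commute mult.left_commute)
    then have "l2n (w L) K \<le> C * l2n u L \<or> l2n (w L) K = 0"
      using mult_right_le_imp_le[of "l2n (w L) K" "l2n (w L) K" "C * l2n u L"]
        L2_set_nonneg[of "\<lambda>n. cmod (w L n)" "{..<K}"] by linarith
    moreover have "C * l2n u L \<le> C * vnorm u"
      by (intro mult_left_mono l2n_le_vnorm u C)
    ultimately show ?thesis using mult_nonneg_nonneg[OF C vnorm_nonneg[OF u]] by linarith
  qed
  then show "l2n (mat_app x u) K \<le> C * vnorm u"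
    by (intro LIMSEQ_le_const2[OF lim2]) blast
qed

text \<open>From here on boundedness is a statement about finite sums, and convergence of series is
  needed only where the weak equation mentions \<open>vinner\<close> and
  \<open>mat_app\<close>.\<close>

lemma bounded_op_iff: "bounded_op x \<longleftrightarrow> (\<exists>C. form_bd C x)"
proof
  assume "\<exists>C. form_bd C x"
  then obtain C where "form_bd C x" ..
  then show "bounded_op x"
    unfolding bounded_op_def using form_bd_row form_bd_mat_app by blast
qed (use bounded_op_form_bd in blast)

text \<open>Rows and columns are cut at the same \<open>K\<close>. The cut column sum is the full
  image minus the image of the tail \<open>u'\<close>, and that correction is at most a constant
  times the norm of the tail.\<close>

lemma form_tendsto_vinner:
  assumes x: "form_bd C x" and v: "v \<in> l2" and u: "u \<in> l2"
  shows "(\<lambda>K. form x v u K) \<longlonglongrightarrow> vinner v (mat_app x u)"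
proof -
  have C: "0 \<le> C" using form_bd_nonneg[OF x] .
  define u' where "u' = (\<lambda>K n. if n < K then 0 else u n)"
  have su: "summable (\<lambda>n. (cmod (u n))\<^sup>2)" using u by (simp add: l2_def)
  have u'l: "u' K \<in> l2" for K
    unfolding l2_def by (auto simp: u'_def intro!: summable_comparison_test[OF _ su])
  have u'n: "vnorm (u' K) = sqrt ((\<Sum>n. (cmod (u n))\<^sup>2) - (\<Sum>n<K. (cmod (u n))\<^sup>2))" for K
  proof -
    have "(\<Sum>n. (cmod (u' K n))\<^sup>2) = (\<Sum>n. (cmod (u n))\<^sup>2 - (if n < K then (cmod (u n))\<^sup>2 else 0))"
      by (intro suminf_cong) (auto simp: u'_def)
    also have "\<dots> = (\<Sum>n. (cmod (u n))\<^sup>2) - (\<Sum>n. (if n < K then (cmod (u n))\<^sup>2 else 0))"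
      by (intro suminf_diff[symmetric] su summable_finite[of "{..<K}"]) auto
    also have "(\<Sum>n. (if n < K then (cmod (u n))\<^sup>2 else 0)) = (\<Sum>n<K. (cmod (u n))\<^sup>2)"
      by (subst suminf_finite[of "{..<K}"]) auto
    finally show ?thesis by (simp add: vnorm_def)
  qed
  have "(\<lambda>K. (\<Sum>n. (cmod (u n))\<^sup>2) - (\<Sum>n<K. (cmod (u n))\<^sup>2)) \<longlonglongrightarrow>
      (\<Sum>n. (cmod (u n))\<^sup>2) - (\<Sum>n. (cmod (u n))\<^sup>2)"
    by (intro tendsto_intros summable_LIMSEQ su)
  from tendsto_real_sqrt[OF this] have u'0: "(\<lambda>K. vnorm (u' K)) \<longlonglongrightarrow> 0"
    by (simp add: u'n)
  have split: "mat_app x u m = (\<Sum>n<K. x m n * u n) + mat_app x (u' K) m" for K m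
  proof -
    have "(\<Sum>n. x m n * u n) = (\<Sum>n. (if n < K then x m n * u n else 0) + x m n * u' K n)"
      by (intro suminf_cong) (auto simp: u'_def)
    also have "\<dots> = (\<Sum>n. (if n < K then x m n * u n else 0)) + (\<Sum>n. x m n * u' K n)"
      by (intro suminf_add[symmetric] l2_product' form_bd_row[OF x] u'l summable_finite[of "{..<K}"]) auto
    also have "(\<Sum>n. (if n < K then x m n * u n else 0)) = (\<Sum>n<K. x m n * u n)"
      by (subst suminf_finite[of "{..<K}"]) auto
    finally show ?thesis by (simp add: mat_app_def)
  qed
  have eq: "form x v u K = (\<Sum>m<K. cnj (v m) * mat_app x u m) - (\<Sum>m<K. cnj (v m) * mat_app x (u' K) m)" for K
    by (simp add: form_def split[of _ K] algebra_simps sum.distrib sum_distrib_left)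
  have "(\<lambda>K. \<Sum>m<K. cnj (v m) * mat_app x (u' K) m) \<longlonglongrightarrow> 0"
  proof (rule Lim_null_comparison)
    show "\<forall>\<^sub>F K in sequentially. cmod (\<Sum>m<K. cnj (v m) * mat_app x (u' K) m) \<le> vnorm v * (C * vnorm (u' K))"
    proof (intro always_eventually allI)
      fix K
      have "cmod (\<Sum>m<K. cnj (v m) * mat_app x (u' K) m) \<le> (\<Sum>m<K. \<bar>cmod (v m)\<bar> * \<bar>cmod (mat_app x (u' K) m)\<bar>)"
        by (intro sum_norm_le) (auto simp: norm_mult)
      also have "\<dots> \<le> l2n v K * l2n (mat_app x (u' K)) K" by (rule L2_set_mult_ineq)
      also have "\<dots> \<le> vnorm v * (C * vnorm (u' K))"
        using form_bd_mat_app[OF x u'l[of K]] l2n_le_vnorm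
        by (intro mult_mono l2n_le_vnorm v vnorm_nonneg) (auto intro: order_trans)
      finally show "cmod (\<Sum>m<K. cnj (v m) * mat_app x (u' K) m) \<le> vnorm v * (C * vnorm (u' K))" .
    qed
    have "(\<lambda>K. vnorm v * (C * vnorm (u' K))) \<longlonglongrightarrow> vnorm v * (C * 0)"
      by (intro tendsto_intros u'0)
    then show "(\<lambda>K. vnorm v * (C * vnorm (u' K))) \<longlonglongrightarrow> 0" by simp
  qed
  moreover have "(\<lambda>K. \<Sum>m<K. cnj (v m) * mat_app x u m) \<longlonglongrightarrow> vinner v (mat_app x u)"
    unfolding vinner_def
    using form_bd_mat_app[OF x u] l2_product(1)[OF v] by (intro summable_LIMSEQ) (blast intro: summable_norm_cancel)
  ultimately show ?thesis
    unfolding eq using tendsto_diff by force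
qed

lemma form_bd_vinner:
  assumes x: "form_bd C x" and v: "v \<in> l2" and u: "u \<in> l2"
  shows "cmod (form x v u K) \<le> C * vnorm v * vnorm u"
proof -
  have "cmod (form x v u K) \<le> C * l2n v K * l2n u K"
    using x unfolding form_bd_def by blast
  also have "\<dots> \<le> C * vnorm v * vnorm u"
    by (intro mult_mono l2n_le_vnorm v u mult_nonneg_nonneg vnorm_nonneg form_bd_nonneg[OF x] L2_set_nonneg order_refl)
  finally show ?thesis .
qed

lemma pos_op_iff: "pos_op x \<longleftrightarrow> psd x \<and> (\<exists>C. form_bd C x)"
proof
  assume x: "pos_op x"
  have "psd x"
    unfolding psd_def
  proof (intro allI)
    fix u K
    have u: "trunc u K \<in> l2" by (auto intro!: finite_support_l2[of K] simp: trunc_def)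
    have "form x u u K = vinner (trunc u K) (mat_app x (trunc u K))"
      by (subst vinner_mat_app_finite[of K]) (simp_all add: form_trunc, simp_all add: trunc_def)
    then show "form x u u K \<in> \<real>\<^sub>\<ge>\<^sub>0"
      using x u by (simp add: pos_op_def nonneg_Reals_iff_Re_Im)
  qed
  with x show "psd x \<and> (\<exists>C. form_bd C x)" by (simp add: pos_op_def bounded_op_iff)
next
  assume x: "psd x \<and> (\<exists>C. form_bd C x)"
  then obtain C where C: "form_bd C x" by blast
  have "vinner u (mat_app x u) \<in> \<real>\<^sub>\<ge>\<^sub>0" if "u \<in> l2" for u
    using x form_tendsto_vinner[OF C that that] unfolding psd_def
    by (intro Lim_in_closed_set[OF closed_nonneg_Reals_complex _ _ form_tendsto_vinner[OF C that that]]) auto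
  with x show "pos_op x" by (auto simp: pos_op_def bounded_op_iff nonneg_Reals_iff_Re_Im)
qed

section \<open>The minimal solution\<close>

lemma form_has_integral:
  assumes "\<And>m n. ((\<lambda>s. Y s m n) has_integral Z m n) I"
  shows "((\<lambda>s. form (Y s) v u K) has_integral form Z v u K) I"
  unfolding form_def
  by (intro has_integral_sum has_integral_mult_left has_integral_mult_right assms) auto

lemma has_integral_nonneg_Reals:
  fixes f :: "real \<Rightarrow> complex"
  assumes f: "(f has_integral i) I" and nn: "\<And>s. s \<in> I \<Longrightarrow> f s \<in> \<real>\<^sub>\<ge>\<^sub>0"
  shows "i \<in> \<real>\<^sub>\<ge>\<^sub>0"
proof -
  have "0 \<le> Re i"
    using has_integral_linear[OF f bounded_linear_Re] nn
    by (intro has_integral_nonneg[of "Re \<circ> f" "Re i" I]) (auto simp: nonneg_Reals_iff_Re_Im)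
  moreover have "Im i = 0"
    using has_integral_unique[OF has_integral_linear[OF f bounded_linear_Im] has_integral_is_0[of I "Im \<circ> f"]] nn
    by (auto simp: nonneg_Reals_iff_Re_Im)
  ultimately show ?thesis by (simp add: nonneg_Reals_iff_Re_Im)
qed

lemma psd_has_integral:
  fixes I :: "real set"
  assumes "\<And>m n. ((\<lambda>s. Y s m n) has_integral Z m n) I" "\<And>s. s \<in> I \<Longrightarrow> psd (Y s)"
  shows "psd Z"
  unfolding psd_def
proof (intro allI)
  fix u K
  have "((\<lambda>s. form (Y s) u u K) has_integral form Z u u K) I"
    by (rule form_has_integral) (rule assms(1))
  then show "form Z u u K \<in> \<real>\<^sub>\<ge>\<^sub>0"
    by (rule has_integral_nonneg_Reals) (use assms(2) in \<open>auto simp: psd_def\<close>)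
qed

lemma omega_nonneg: "0 < r \<Longrightarrow> 0 \<le> omega r n"
  by (cases n) (auto simp: omega_def)

lemma omega_zero [simp]: "omega r 0 = 0"
  by (simp add: omega_def)

text \<open>Pulling exp(t a) out of the convolution leaves an ordinary indefinite integral, to which
  continuity and the fundamental theorem apply.\<close>

lemma duhamel_factor:
  fixes h :: "real \<Rightarrow> complex"
  shows "(\<lambda>s. exp (complex_of_real (t - s) * a) * h s)
       = (\<lambda>s. exp (complex_of_real t * a) * (exp (- (complex_of_real s * a)) * h s))"
proof
  fix s
  have "complex_of_real (t - s) * a = complex_of_real t * a + - (complex_of_real s * a)"
    by (simp add: algebra_simps)
  then show "exp (complex_of_real (t - s) * a) * h s
      = exp (complex_of_real t * a) * (exp (- (complex_of_real s * a)) * h s)"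
    by (simp only: exp_add mult.assoc)
qed

lemma duhamel_continuous:
  fixes h :: "real \<Rightarrow> complex"
  assumes "(\<lambda>s. exp (- (complex_of_real s * a)) * h s) integrable_on {0..b}"
  shows "continuous_on {0..b} (\<lambda>t. integral {0..t} (\<lambda>s. exp (complex_of_real (t - s) * a) * h s))"
  unfolding duhamel_factor integral_mult_right
  by (intro continuous_intros indefinite_integral_continuous_1 assms)

section \<open>Rates, jumps and damping in matrix entries\<close>

locale birth_death =
  fixes r lam mu zp zm :: real
  assumes r_pos: "0 < r" and lam_pos: "0 < lam" and lam_less_mu: "lam < mu"
begin

abbreviation "om \<equiv> omega r"
abbreviation "P \<equiv> Pt r lam mu zp zm"
abbreviation "L1 \<equiv> L1v r mu"
abbreviation "L2 \<equiv> L2v r lam"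

lemma mu_pos: "0 < mu" using lam_pos lam_less_mu by simp

lemma om_nonneg [simp]: "0 \<le> om n" using omega_nonneg[OF r_pos] .

text \<open>The factor by which x -> (adjoint of G) x + x G acts on the entry (m, n).\<close>

definition rate :: "nat \<Rightarrow> nat \<Rightarrow> complex" where
  "rate m n = cnj (gG r lam mu zp zm m) + gG r lam mu zp zm n"

definition down :: "nat \<Rightarrow> nat \<Rightarrow> real" where
  "down m n = mu\<^sup>2 * (sqrt (om m) * sqrt (om n))"

definition up :: "nat \<Rightarrow> nat \<Rightarrow> real" where
  "up m n = lam\<^sup>2 * (sqrt (om (Suc m)) * sqrt (om (Suc n)))"

text \<open>The entries of the sum over l of (adjoint of L_l) y L_l. For m = 0 or n = 0 the
  truncated subtraction reads an unrelated entry, which is multiplied by \<open>down\<close> =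
  0.\<close>

definition jump :: "mat \<Rightarrow> mat" where
  "jump y m n = complex_of_real (down m n) * y (m - 1) (n - 1)
     + complex_of_real (up m n) * y (Suc m) (Suc n)"

definition Phi :: "real \<Rightarrow> mat \<Rightarrow> mat" where
  "Phi t y m n = exp (complex_of_real t * rate m n) * jump y m n"

definition damp :: "real \<Rightarrow> mat \<Rightarrow> mat" where
  "damp t x m n = exp (complex_of_real t * rate m n) * x m n"

lemma Re_rate: "Re (rate m n) = - (lam\<^sup>2 * (om (Suc m) + om (Suc n)) + mu\<^sup>2 * (om m + om n)) / 2"
  by (simp add: rate_def gG_def field_simps)

lemma Re_rate_nonpos: "Re (rate m n) \<le> 0"
proof -
  have "0 \<le> lam\<^sup>2 * (om (Suc m) + om (Suc n)) + mu\<^sup>2 * (om m + om n)"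
    by (intro add_nonneg_nonneg mult_nonneg_nonneg) auto
  then show ?thesis unfolding Re_rate by (intro divide_nonpos_pos) (simp_all only: neg_le_0_iff_le zero_less_numeral)
qed

lemma exp_rate: "exp (complex_of_real t * rate m n)
    = cnj (exp (complex_of_real t * gG r lam mu zp zm m)) * exp (complex_of_real t * gG r lam mu zp zm n)"
  by (simp add: rate_def exp_cnj exp_add[symmetric] distrib_left)

lemma norm_exp_rate_le: "0 \<le> t \<Longrightarrow> cmod (exp (complex_of_real t * rate m n)) \<le> 1"
  by (simp add: mult_nonneg_nonpos Re_rate_nonpos)

lemma norm_exp_g_le: "0 \<le> t \<Longrightarrow> cmod (exp (complex_of_real t * gG r lam mu zp zm n)) \<le> 1"
proof -
  assume "0 \<le> t"
  have "0 \<le> lam\<^sup>2 * om (Suc n) + mu\<^sup>2 * om n"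
    by (intro add_nonneg_nonneg mult_nonneg_nonneg) auto
  moreover have "Re (gG r lam mu zp zm n) = - (lam\<^sup>2 * om (Suc n) + mu\<^sup>2 * om n) / 2"
    by (simp add: gG_def field_simps)
  ultimately have "Re (gG r lam mu zp zm n) \<le> 0"
    by (simp only: divide_nonpos_pos neg_le_0_iff_le zero_less_numeral)
  with \<open>0 \<le> t\<close> show ?thesis by (simp add: mult_nonneg_nonpos)
qed

lemma down_zero [simp]: "down 0 n = 0" "down m 0 = 0" by (simp_all add: down_def)
lemma down_nonneg [simp]: "0 \<le> down m n" by (simp add: down_def)
lemma up_nonneg [simp]: "0 \<le> up m n" by (simp add: up_def)

text \<open>Formal conservativity: G plus its adjoint cancels the sum of (adjoint of L_l) L_l, so
  the formal generator kills the identity.\<close>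

lemma rate_diagonal: "rate n n = - complex_of_real (down n n + up n n)"
proof -
  have "Im (rate n n) = 0" by (simp add: rate_def)
  then show ?thesis
    by (simp add: complex_eq_iff Re_rate down_def up_def field_simps)
qed

lemma form_damp: "form (damp t x) v u K = form x (P t v) (P t u) K"
  by (simp add: form_def damp_def exp_rate Pt_def mult_ac)

text \<open>\<open>L1\<close> lowers indices and \<open>L2\<close> raises them, so a corner of size
  K + 1 meets corners of sizes K and K + 2. The right-hand side is a congruence of \<open>y\<close>,
  which is why \<open>Phi\<close> preserves positivity.\<close>

lemma form_Phi:
  "form (Phi t y) v u (Suc K) = form y (L1 (P t v)) (L1 (P t u)) K
     + form y (L2 (P t v)) (L2 (P t u)) (Suc (Suc K))"
proof -
  define V U where "V = P t v" and "U = P t u"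
  have "form (Phi t y) v u (Suc K) =
     (\<Sum>m<Suc K. \<Sum>n<Suc K. cnj (V m) * (complex_of_real (down m n) * y (m - 1) (n - 1)) * U n)
   + (\<Sum>m<Suc K. \<Sum>n<Suc K. cnj (V m) * (complex_of_real (up m n) * y (Suc m) (Suc n)) * U n)"
    unfolding form_def sum.distrib[symmetric]
    by (intro sum.cong refl) (simp add: Phi_def jump_def exp_rate V_def U_def Pt_def algebra_simps)
  also have "(\<Sum>m<Suc K. \<Sum>n<Suc K. cnj (V m) * (complex_of_real (down m n) * y (m - 1) (n - 1)) * U n)
     = form y (L1 V) (L1 U) K"
    unfolding form_def sum.lessThan_Suc_shift
    by (auto simp: L1v_def Bv_def down_def power2_eq_square mult_ac simp flip: of_real_mult intro!: sum.cong)
  also have "(\<Sum>m<Suc K. \<Sum>n<Suc K. cnj (V m) * (complex_of_real (up m n) * y (Suc m) (Suc n)) * U n)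
     = form y (L2 V) (L2 U) (Suc (Suc K))"
    unfolding form_def sum.lessThan_Suc_shift[of _ "Suc K"]
    by (auto simp: L2v_def Bplusv_def up_def power2_eq_square mult_ac intro!: sum.cong)
  finally show ?thesis by (simp add: V_def U_def)
qed

lemma psd_damp: "psd x \<Longrightarrow> psd (damp t x)"
  unfolding psd_def form_damp by blast

lemma psd_Phi: "psd y \<Longrightarrow> psd (Phi t y)"
  unfolding psd_def
proof (intro allI)
  fix u K assume "\<forall>u K. form y u u K \<in> \<real>\<^sub>\<ge>\<^sub>0"
  then show "form (Phi t y) u u K \<in> \<real>\<^sub>\<ge>\<^sub>0"
    by (cases K) (auto simp: form_Phi form_def[of _ _ _ 0])
qed

lemma jump_add_mult: "jump (\<lambda>m n. x m n + a * y m n) m n = jump x m n + a * jump y m n"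
  by (simp add: jump_def algebra_simps)

lemma Phi_add_mult: "Phi t (\<lambda>m n. x m n + a * y m n) m n = Phi t x m n + a * Phi t y m n"
  by (simp add: Phi_def jump_add_mult algebra_simps)

lemma Phi_diff: "Phi t (\<lambda>m n. x m n - y m n) m n = Phi t x m n - Phi t y m n"
  using Phi_add_mult[of t x "-1" y m n] by simp

text \<open>By \<open>rate_diagonal\<close> the diagonal integrand is an exact derivative. The
  identity is thus a stationary solution, the barrier under which all Picard iterates of the
  identity stay.\<close>

lemma idm_mild:
  "0 \<le> t \<Longrightarrow> ((\<lambda>s. Phi (t - s) idm m n) has_integral (idm m n - damp t idm m n)) {0..t}"
proof (cases "m = n")
  case True
  assume t: "0 \<le> t"
  have j: "jump idm n n = - rate n n"
    unfolding rate_diagonal by (cases n) (auto simp: jump_def diag_def)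
  have "((\<lambda>s. exp (complex_of_real (t - s) * rate n n) * - rate n n) has_integral
      (exp (complex_of_real (t - t) * rate n n) - exp (complex_of_real (t - 0) * rate n n))) {0..t}"
    using t
  proof (rule fundamental_theorem_of_calculus)
    fix s
    have "((\<lambda>z. exp ((complex_of_real t - z) * rate n n)) has_field_derivative
        exp ((complex_of_real t - complex_of_real s) * rate n n) * - rate n n) (at (complex_of_real s))"
      by (auto intro!: derivative_eq_intros)
    from has_vector_derivative_real_field[OF this]
    show "((\<lambda>s. exp (complex_of_real (t - s) * rate n n)) has_vector_derivative
        exp (complex_of_real (t - s) * rate n n) * - rate n n) (at s within {0..t})"
      by simp
  qed
  then show ?thesis using True by (simp add: Phi_def j damp_def) (simp add: diag_def)
next
  case False
  have "jump idm m n = 0"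
    using False by (cases m; cases n) (auto simp: jump_def diag_def)
  then show ?thesis using False by (simp add: Phi_def damp_def diag_def has_integral_0)
qed

section \<open>Monotone Picard iteration\<close>

primrec picard :: "nat \<Rightarrow> mat \<Rightarrow> real \<Rightarrow> mat" where
  "picard 0 x t = damp t x"
| "picard (Suc k) x t = (\<lambda>m n. damp t x m n + integral {0..t} (\<lambda>s. Phi (t - s) (picard k x s) m n))"

lemma jump_continuous:
  "(\<And>m n. continuous_on A (\<lambda>s. Y s m n)) \<Longrightarrow> continuous_on A (\<lambda>s. jump (Y s) m n)"
  unfolding jump_def by (intro continuous_intros)

lemma Phi_continuous:
  "(\<And>m n. continuous_on A (\<lambda>s. Y s m n)) \<Longrightarrow> continuous_on A (\<lambda>s. Phi (t - s) (Y s) m n)"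
  unfolding Phi_def by (intro continuous_intros jump_continuous) auto

lemma picard_continuous: "continuous_on {0..b} (\<lambda>t. picard k x t m n)"
proof (induction k arbitrary: m n)
  case 0
  show ?case unfolding picard.simps damp_def by (intro continuous_intros)
next
  case (Suc k)
  have "continuous_on {0..b} (\<lambda>t. integral {0..t} (\<lambda>s. Phi (t - s) (picard k x s) m n))"
    unfolding Phi_def
    by (intro duhamel_continuous integrable_continuous_interval continuous_intros jump_continuous Suc)
  then show ?case
    unfolding picard.simps damp_def by (intro continuous_intros)
qed

lemma picard_has_integral:
  "((\<lambda>s. Phi (t - s) (picard k x s) m n) has_integral (picard (Suc k) x t m n - damp t x m n)) {0..t}"
  using integrable_integral[OF integrable_continuous_interval[OF Phi_continuous[OF picard_continuous]]]
  by simp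

lemma picard_add_mult:
  "picard k (\<lambda>m n. x m n + a * y m n) t = (\<lambda>m n. picard k x t m n + a * picard k y t m n)"
proof (induction k arbitrary: t)
  case 0
  show ?case by (simp add: damp_def algebra_simps)
next
  case (Suc k)
  show ?case
  proof (intro ext)
    fix m n
    have "((\<lambda>s. Phi (t - s) (picard k (\<lambda>m n. x m n + a * y m n) s) m n) has_integral
        (picard (Suc k) x t m n - damp t x m n + a * (picard (Suc k) y t m n - damp t y m n))) {0..t}"
      unfolding Suc Phi_add_mult
      by (intro has_integral_add has_integral_mult_right picard_has_integral)
    from has_integral_unique[OF this picard_has_integral]
    show "picard (Suc k) (\<lambda>m n. x m n + a * y m n) t m n = picard (Suc k) x t m n + a * picard (Suc k) y t m n"
      by (simp add: damp_def algebra_simps del: picard.simps)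
  qed
qed

lemma psd_picard: "psd x \<Longrightarrow> psd (picard k x t)"
proof (induction k arbitrary: t)
  case 0
  then show ?case by (simp add: psd_damp)
next
  case (Suc k)
  have "psd (\<lambda>m n. picard (Suc k) x t m n - damp t x m n)"
    by (rule psd_has_integral[OF picard_has_integral]) (use Suc psd_Phi in auto)
  from psd_add[OF psd_damp[OF Suc.prems, of t] this] show ?case by (simp del: picard.simps)
qed

text \<open>Subtracting the integral equations of the identity and of an iterate leaves the integral
  of \<open>Phi\<close> applied to the previous difference, which is positive by induction.\<close>

lemma psd_picard_idm: "0 \<le> t \<Longrightarrow> psd (\<lambda>m n. idm m n - picard k idm t m n)"
proof (induction k arbitrary: t)
  case 0
  show ?case
    unfolding picard.simps
    by (rule psd_has_integral[OF idm_mild[OF 0]]) (intro psd_Phi psd_idm)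
next
  case (Suc k)
  have "psd (\<lambda>m n. (idm m n - damp t idm m n) - (picard (Suc k) idm t m n - damp t idm m n))"
  proof (rule psd_has_integral[OF has_integral_diff[OF idm_mild[OF Suc.prems] picard_has_integral]])
    fix s assume "s \<in> {0..t}"
    then have "psd (Phi (t - s) (\<lambda>m n. idm m n - picard k idm s m n))"
      using Suc by (intro psd_Phi) auto
    then show "psd (\<lambda>m n. Phi (t - s) idm m n - Phi (t - s) (picard k idm s) m n)"
      by (simp add: Phi_diff[abs_def])
  qed
  then show ?case by (simp del: picard.simps)
qed

lemma psd_picard_mono: "psd x \<Longrightarrow> psd (\<lambda>m n. picard (Suc k) x t m n - picard k x t m n)"
proof (induction k arbitrary: t)
  case 0
  show ?case
    unfolding picard.simps(1)
    by (rule psd_has_integral[OF picard_has_integral]) (use psd_Phi psd_damp 0 in auto)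
next
  case (Suc k)
  have "psd (\<lambda>m n. (picard (Suc (Suc k)) x t m n - damp t x m n) - (picard (Suc k) x t m n - damp t x m n))"
  proof (rule psd_has_integral[OF has_integral_diff[OF picard_has_integral picard_has_integral]])
    fix s assume "s \<in> {0..t}"
    then have "psd (Phi (t - s) (\<lambda>m n. picard (Suc k) x s m n - picard k x s m n))"
      using Suc by (intro psd_Phi) auto
    then show "psd (\<lambda>m n. Phi (t - s) (picard (Suc k) x s) m n - Phi (t - s) (picard k x s) m n)"
      by (simp add: Phi_diff[abs_def] del: picard.simps)
  qed
  then show ?case by (simp del: picard.simps)
qed

lemma form_bd_picard:
  assumes "form_bd C x" "0 \<le> t" shows "form_bd (6 * C) (picard k x t)"
  by (rule positive_subunital_form_bd[of "\<lambda>x. picard k x t"])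
    (use assms picard_add_mult psd_picard psd_picard_idm in auto)

text \<open>Quadratic forms of the iterates increase and stay bounded, hence converge; entries are
  recovered by polarisation.\<close>

lemma convergent_picard_psd:
  assumes x: "form_bd C x" "psd x" and t: "0 \<le> t"
  shows "convergent (\<lambda>k. picard k x t m n)"
proof -
  have Q: "convergent (\<lambda>k. form (picard k x t) u u K)" for u K
  proof -
    define R where "R k = Re (form (picard k x t) u u K)" for k
    have R: "form (picard k x t) u u K = complex_of_real (R k)" for k
      using psd_picard[OF x(2), of k t]
      by (simp add: psd_def nonneg_Reals_iff_Re_Im complex_eq_iff R_def)
    have "R k \<le> 6 * C * l2n u K * l2n u K" for k
      unfolding R_def
      by (rule order_trans[OF complex_Re_le_cmod form_bd_picard[OF x(1) t, of k, unfolded form_bd_def, rule_format]])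
    moreover have "R k \<le> R (Suc k)" for k
      using psd_picard_mono[OF x(2), of k t]
      by (simp add: psd_def form_diff nonneg_Reals_iff_Re_Im R_def del: picard.simps)
    then have "incseq R" by (intro incseq_SucI)
    ultimately obtain L where "R \<longlonglongrightarrow> L" using incseq_convergent by metis
    then have "(\<lambda>k. complex_of_real (R k)) \<longlonglongrightarrow> complex_of_real L" by (intro tendsto_intros)
    then show ?thesis unfolding R convergent_def by blast
  qed
  define K where "K = Suc (max m n)"
  have K: "m < K" "n < K" by (auto simp: K_def)
  \<comment> \<open>The form at e_m + b e_n for b = 1, -1, i, -i; the combination with factors 1,
    -1, -i, i isolates four times the entry (m, n), also when m = n.\<close>
  define q where "q y b = form y (\<lambda>i. 1 * unit_vec m i + b * unit_vec n i) (\<lambda>i. 1 * unit_vec m i + b * unit_vec n i) K"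
    for y and b :: complex
  have q: "q y b = y m m + b * y m n + cnj b * y n m + cnj b * b * y n n" for y b
    unfolding q_def form_quad by (simp add: form_unit K)
  have "y m n = (q y 1 - q y (-1) - \<i> * q y \<i> + \<i> * q y (-\<i>)) / 4" for y
    unfolding q by (simp add: algebra_simps)
  moreover obtain L where "\<And>b. (\<lambda>k. q (picard k x t) b) \<longlonglongrightarrow> L b"
    using that[of "\<lambda>b. lim (\<lambda>k. q (picard k x t) b)"] Q unfolding q_def convergent_LIMSEQ_iff by blast
  then have "(\<lambda>k. (q (picard k x t) 1 - q (picard k x t) (-1) - \<i> * q (picard k x t) \<i>
       + \<i> * q (picard k x t) (-\<i>)) / 4) \<longlonglongrightarrow> (L 1 - L (-1) - \<i> * L \<i> + \<i> * L (-\<i>)) / 4"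
    by (intro tendsto_divide tendsto_add tendsto_diff tendsto_mult tendsto_const) auto
  ultimately have "(\<lambda>k. picard k x t m n) \<longlonglongrightarrow> (L 1 - L (-1) - \<i> * L \<i> + \<i> * L (-\<i>)) / 4"
    by presburger
  then show ?thesis unfolding convergent_def by blast
qed


text \<open>The competitor against which minimality of the given solution is tested.\<close>

definition minsol :: "real \<Rightarrow> mat \<Rightarrow> mat" where
  "minsol t x m n = lim (\<lambda>k. picard k x t m n)"

lemma picard_tendsto:
  assumes x: "form_bd C x" and t: "0 \<le> t"
  shows "(\<lambda>k. picard k x t m n) \<longlonglongrightarrow> minsol t x m n"
proof -
  obtain y z where yz: "form_bd (2 * C) y" "form_bd (2 * C) z" "psd y" "psd z"
    "x = (\<lambda>m n. (y m n + \<i> * z m n) + (- complex_of_real C * (1 + \<i>)) * idm m n)"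
    by (rule form_bd_decomp[OF x]) (rule that)
  have idm: "form_bd 1 idm" by (rule form_bd_diag) simp
  have "convergent (\<lambda>k. picard k y t m n)" "convergent (\<lambda>k. picard k z t m n)"
    "convergent (\<lambda>k. picard k idm t m n)"
    using convergent_picard_psd[OF yz(1,3) t] convergent_picard_psd[OF yz(2,4) t]
      convergent_picard_psd[OF idm psd_idm t] by blast+
  then obtain a b c where "(\<lambda>k. picard k y t m n) \<longlonglongrightarrow> a" "(\<lambda>k. picard k z t m n) \<longlonglongrightarrow> b"
    "(\<lambda>k. picard k idm t m n) \<longlonglongrightarrow> c"
    unfolding convergent_def by blast
  then have "(\<lambda>k. (picard k y t m n + \<i> * picard k z t m n) + (- complex_of_real C * (1 + \<i>)) * picard k idm t m n)
      \<longlonglongrightarrow> (a + \<i> * b) + (- complex_of_real C * (1 + \<i>)) * c"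
    by (intro tendsto_intros)
  then have "convergent (\<lambda>k. picard k x t m n)"
    unfolding yz(5) picard_add_mult convergent_def by blast
  then show ?thesis unfolding minsol_def by (simp add: convergent_LIMSEQ_iff)
qed

lemma form_bd_minsol: "form_bd C x \<Longrightarrow> 0 \<le> t \<Longrightarrow> form_bd (6 * C) (minsol t x)"
  by (rule form_bd_lim[OF form_bd_picard picard_tendsto])

lemma psd_minsol: "form_bd C x \<Longrightarrow> psd x \<Longrightarrow> 0 \<le> t \<Longrightarrow> psd (minsol t x)"
  by (rule psd_lim[OF psd_picard picard_tendsto])

lemma psd_minsol_idm:
  assumes "0 \<le> t" shows "psd (\<lambda>m n. idm m n - minsol t idm m n)"
proof (rule psd_lim[OF psd_picard_idm[OF assms]])
  show "(\<lambda>k. idm m n - picard k idm t m n) \<longlonglongrightarrow> idm m n - minsol t idm m n" for m n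
    by (intro tendsto_intros picard_tendsto[OF form_bd_diag[of _ 1] assms]) simp
qed

lemma minsol_add_mult:
  assumes "form_bd C x" "form_bd D y" "0 \<le> t"
  shows "minsol t (\<lambda>m n. x m n + a * y m n) = (\<lambda>m n. minsol t x m n + a * minsol t y m n)"
proof (intro ext)
  fix m n
  have "(\<lambda>k. picard k x t m n + a * picard k y t m n) \<longlonglongrightarrow> minsol t x m n + a * minsol t y m n"
    by (intro tendsto_intros picard_tendsto[OF assms(1,3)] picard_tendsto[OF assms(2,3)])
  moreover have "(\<lambda>k. picard k x t m n + a * picard k y t m n) \<longlonglongrightarrow> minsol t (\<lambda>m n. x m n + a * y m n) m n"
    using picard_tendsto[OF form_bd_add_mult[OF assms(1,2), of a] assms(3)] unfolding picard_add_mult .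
  ultimately show "minsol t (\<lambda>m n. x m n + a * y m n) m n = minsol t x m n + a * minsol t y m n"
    using LIMSEQ_unique by blast
qed

lemma norm_jump_le:
  assumes "\<And>m n. cmod (y m n) \<le> M"
  shows "cmod (jump y m n) \<le> (down m n + up m n) * M"
proof -
  have "cmod (jump y m n) \<le> down m n * cmod (y (m - 1) (n - 1)) + up m n * cmod (y (Suc m) (Suc n))"
    unfolding jump_def by (rule norm_triangle_mono) (auto simp: norm_mult)
  also have "\<dots> \<le> down m n * M + up m n * M"
    by (intro add_mono mult_left_mono assms) auto
  finally show ?thesis by (simp add: algebra_simps)
qed

lemma norm_Phi_le:
  assumes "\<And>m n. cmod (y m n) \<le> M" "0 \<le> t"
  shows "cmod (Phi t y m n) \<le> (down m n + up m n) * M"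
proof -
  have "cmod (Phi t y m n) \<le> 1 * ((down m n + up m n) * M)"
    unfolding Phi_def norm_mult
    by (intro mult_mono norm_exp_rate_le norm_jump_le assms) auto
  then show ?thesis by simp
qed

text \<open>Dominated convergence: for a fixed entry only two neighbours enter, with fixed weights,
  and the iterates obey the uniform bound 6 C.\<close>

lemma minsol_has_integral:
  assumes x: "form_bd C x" and t: "0 \<le> t"
  shows "((\<lambda>s. Phi (t - s) (minsol s x) m n) has_integral (minsol t x m n - damp t x m n)) {0..t}"
proof -
  let ?f = "\<lambda>k s. Phi (t - s) (picard k x s) m n"
  have int: "?f k integrable_on {0..t}" for k
    using picard_has_integral by blast
  have bd: "cmod (?f k s) \<le> (down m n + up m n) * (6 * C)" if "s \<in> {0..t}" for k s
    using that form_bd_entry[OF form_bd_picard[OF x, of s k]] by (intro norm_Phi_le) auto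
  have lim: "(\<lambda>k. ?f k s) \<longlonglongrightarrow> Phi (t - s) (minsol s x) m n" if "s \<in> {0..t}" for s
    using that unfolding Phi_def jump_def by (intro tendsto_intros picard_tendsto[OF x]) auto
  note dc = dominated_convergence[OF int integrable_const_ivl bd lim]
  have "(\<lambda>k. picard (Suc k) x t m n - damp t x m n) \<longlonglongrightarrow> minsol t x m n - damp t x m n"
    by (intro tendsto_intros LIMSEQ_Suc picard_tendsto[OF x t])
  then have "(\<lambda>k. integral {0..t} (?f k)) \<longlonglongrightarrow> minsol t x m n - damp t x m n"
    unfolding integral_unique[OF picard_has_integral] .
  from LIMSEQ_unique[OF this dc(2)] dc(1) show ?thesis
    by (simp add: integrable_integral)
qed

section \<open>The weak equation on the domain of G\<close>

lemma L1_P_l2: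
  assumes u: "u \<in> domG" and t: "0 \<le> t"
  shows "L1 (P t u) \<in> l2 \<and> vnorm (L1 (P t u)) \<le> vnorm (L1 u)"
proof -
  have s: "summable (\<lambda>n. (real n ^ 2 * cmod (u n))\<^sup>2)" using u by (simp add: domG_def)
  \<comment> \<open>\<open>om\<close> grows quadratically, while \<open>domG\<close> controls n^4
    times the squared modulus of the coordinate.\<close>
  have om: "om n \<le> (1 + r) * (real n ^ 2)\<^sup>2" for n
  proof (cases n)
    case (Suc k)
    have "om n \<le> (1 + r) * real n ^ 2"
      using r_pos Suc by (simp add: omega_def power2_eq_square algebra_simps)
    also have "\<dots> \<le> (1 + r) * (real n ^ 2)\<^sup>2"
      using r_pos Suc by (intro mult_left_mono self_le_power) auto
    finally show ?thesis .
  qed simp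
  have L1u: "L1 u \<in> l2"
    unfolding l2_def mem_Collect_eq
  proof (rule summable_comparison_test)
    show "summable (\<lambda>n. mu\<^sup>2 * (1 + r) * (real (Suc n) ^ 2 * cmod (u (Suc n)))\<^sup>2)"
      using s by (intro summable_mult) (subst summable_Suc_iff)
    have "(cmod (L1 u n))\<^sup>2 = mu\<^sup>2 * om (Suc n) * (cmod (u (Suc n)))\<^sup>2" for n
      by (simp add: L1v_def Bv_def norm_mult power_mult_distrib)
    also have "\<dots> n \<le> mu\<^sup>2 * ((1 + r) * (real (Suc n) ^ 2)\<^sup>2) * (cmod (u (Suc n)))\<^sup>2" for n
      by (intro mult_right_mono mult_left_mono om) auto
    finally show "\<exists>N. \<forall>n\<ge>N. norm ((cmod (L1 u n))\<^sup>2) \<le> mu\<^sup>2 * (1 + r) * (real (Suc n) ^ 2 * cmod (u (Suc n)))\<^sup>2"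
      by (auto simp: power_mult_distrib mult_ac)
  qed
  show ?thesis
  proof (rule l2_boundI)
    fix K
    have "l2n (L1 (P t u)) K \<le> l2n (L1 u) K"
    proof (rule L2_set_mono)
      fix n
      have "cmod (L1 (P t u) n) = cmod (exp (complex_of_real t * gG r lam mu zp zm (Suc n))) * cmod (L1 u n)"
        by (simp add: L1v_def Bv_def Pt_def norm_mult)
      also have "\<dots> \<le> 1 * cmod (L1 u n)"
        by (intro mult_right_mono norm_exp_g_le t) auto
      finally show "cmod (L1 (P t u) n) \<le> cmod (L1 u n)" by simp
    qed auto
    also have "\<dots> \<le> vnorm (L1 u)" by (rule l2n_le_vnorm[OF L1u])
    finally show "l2n (L1 (P t u)) K \<le> vnorm (L1 u)" .
  qed
qed

lemma L2_P_l2: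
  assumes u: "u \<in> domG" and t: "0 \<le> t"
  shows "L2 (P t u) \<in> l2 \<and> vnorm (L2 (P t u)) \<le> vnorm (L2 u)"
proof -
  have s: "summable (\<lambda>n. (real n ^ 2 * cmod (u n))\<^sup>2)" "summable (\<lambda>n. (cmod (u n))\<^sup>2)"
    using u by (auto simp: domG_def l2_def)
  \<comment> \<open>The summand 1 covers n = 0, where the weight of \<open>domG\<close> vanishes; it
    is paid for by square summability of \<open>u\<close> itself.\<close>
  have om: "om (Suc n) \<le> (1 + r) * (4 * (real n ^ 2)\<^sup>2 + 1)" for n
  proof -
    have "om (Suc n) \<le> (1 + r) * (real n + 1)\<^sup>2"
      using r_pos by (simp add: omega_def power2_eq_square algebra_simps)
    also have "(real n + 1)\<^sup>2 \<le> 4 * (real n ^ 2)\<^sup>2 + 1"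
    proof (cases n)
      case (Suc k)
      have "(real n + 1)\<^sup>2 \<le> (2 * real n)\<^sup>2" using Suc by (intro power_mono) auto
      also have "\<dots> = 4 * real n ^ 2" by (simp add: power2_eq_square)
      also have "\<dots> \<le> 4 * (real n ^ 2)\<^sup>2"
        using Suc by (intro mult_left_mono self_le_power) auto
      finally show ?thesis by simp
    qed simp
    finally show ?thesis using r_pos by (simp add: mult_left_mono)
  qed
  have L2u: "L2 u \<in> l2"
    unfolding l2_def mem_Collect_eq
  proof (subst summable_Suc_iff[symmetric], rule summable_comparison_test)
    show "summable (\<lambda>n. lam\<^sup>2 * (1 + r) * (4 * (real n ^ 2 * cmod (u n))\<^sup>2 + (cmod (u n))\<^sup>2))"
      using s by (intro summable_mult summable_add)
    have "(cmod (L2 u (Suc n)))\<^sup>2 = lam\<^sup>2 * om (Suc n) * (cmod (u n))\<^sup>2" for n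
      by (simp add: L2v_def Bplusv_def norm_mult power_mult_distrib)
    also have "\<dots> n \<le> lam\<^sup>2 * ((1 + r) * (4 * (real n ^ 2)\<^sup>2 + 1)) * (cmod (u n))\<^sup>2" for n
      by (intro mult_right_mono mult_left_mono om) auto
    finally show "\<exists>N. \<forall>n\<ge>N. norm ((cmod (L2 u (Suc n)))\<^sup>2)
        \<le> lam\<^sup>2 * (1 + r) * (4 * (real n ^ 2 * cmod (u n))\<^sup>2 + (cmod (u n))\<^sup>2)"
      by (auto simp: power_mult_distrib algebra_simps)
  qed
  show ?thesis
  proof (rule l2_boundI)
    fix K
    have "l2n (L2 (P t u)) K \<le> l2n (L2 u) K"
    proof (rule L2_set_mono)
      fix n
      have "cmod (L2 (P t u) n) = cmod (exp (complex_of_real t * gG r lam mu zp zm (n - 1))) * cmod (L2 u n)"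
        by (simp add: L2v_def Bplusv_def Pt_def norm_mult)
      also have "\<dots> \<le> 1 * cmod (L2 u n)"
        by (intro mult_right_mono norm_exp_g_le t) auto
      finally show "cmod (L2 (P t u) n) \<le> cmod (L2 u n)" by simp
    qed auto
    also have "\<dots> \<le> vnorm (L2 u)" by (rule l2n_le_vnorm[OF L2u])
    finally show "l2n (L2 (P t u)) K \<le> vnorm (L2 u)" .
  qed
qed

lemma P_l2:
  assumes u: "u \<in> l2" and t: "0 \<le> t"
  shows "P t u \<in> l2"
proof -
  have "l2n (P t u) K \<le> vnorm u" for K
  proof -
    have "l2n (P t u) K \<le> l2n u K"
    proof (rule L2_set_mono)
      fix n
      have "cmod (P t u n) \<le> 1 * cmod (u n)"
        unfolding Pt_def norm_mult by (intro mult_right_mono norm_exp_g_le t) auto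
      then show "cmod (P t u n) \<le> cmod (u n)" by simp
    qed auto
    also have "\<dots> \<le> vnorm u" by (rule l2n_le_vnorm[OF u])
    finally show ?thesis .
  qed
  then show ?thesis using l2_boundI by blast
qed

text \<open>Entry equations add up to forms over corners, and the corners exhaust the pairing. The
  norms of \<open>L1 u\<close>, \<open>L2 u\<close>, \<open>L1 v\<close> and \<open>L2 v\<close>
  dominate the integrand because damping only shrinks coordinates.\<close>

lemma minsol_weak_equation:
  assumes x: "form_bd C x" and u: "u \<in> domG" and v: "v \<in> domG" and t: "0 \<le> t"
  shows "((\<lambda>s. vinner (L1 (P (t - s) v)) (mat_app (minsol s x) (L1 (P (t - s) u)))
             + vinner (L2 (P (t - s) v)) (mat_app (minsol s x) (L2 (P (t - s) u))))
         has_integral (vinner v (mat_app (minsol t x) u) - vinner (P t v) (mat_app x (P t u)))) {0..t}"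
proof -
  let ?f = "\<lambda>K s. form (Phi (t - s) (minsol s x)) v u (Suc K)"
  let ?g = "\<lambda>s. vinner (L1 (P (t - s) v)) (mat_app (minsol s x) (L1 (P (t - s) u)))
             + vinner (L2 (P (t - s) v)) (mat_app (minsol s x) (L2 (P (t - s) u)))"
  have uv: "u \<in> l2" "v \<in> l2" using u v by (auto simp: domG_def)
  have C: "0 \<le> C" using form_bd_nonneg[OF x] .
  have hi: "(?f K has_integral form (minsol t x) v u (Suc K) - form x (P t v) (P t u) (Suc K)) {0..t}" for K
    unfolding form_damp[symmetric] form_diff[symmetric]
    by (rule form_has_integral) (rule minsol_has_integral[OF x t])
  have bd: "cmod (?f K s) \<le> 6 * C * vnorm (L1 v) * vnorm (L1 u) + 6 * C * vnorm (L2 v) * vnorm (L2 u)"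
    if "s \<in> {0..t}" for K s
  proof -
    have ts: "0 \<le> t - s" and s: "0 \<le> s" using that by auto
    note 1 = L1_P_l2[OF u ts] L1_P_l2[OF v ts] L2_P_l2[OF u ts] L2_P_l2[OF v ts]
    have "cmod (?f K s) \<le> 6 * C * vnorm (L1 (P (t - s) v)) * vnorm (L1 (P (t - s) u))
        + 6 * C * vnorm (L2 (P (t - s) v)) * vnorm (L2 (P (t - s) u))"
      unfolding form_Phi using 1
      by (intro norm_triangle_mono form_bd_vinner form_bd_minsol x s) auto
    also have "\<dots> \<le> 6 * C * vnorm (L1 v) * vnorm (L1 u) + 6 * C * vnorm (L2 v) * vnorm (L2 u)"
    proof -
      note nn = vnorm_nonneg[OF conjunct1[OF 1(1)]] vnorm_nonneg[OF conjunct1[OF 1(2)]]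
        vnorm_nonneg[OF conjunct1[OF 1(3)]] vnorm_nonneg[OF conjunct1[OF 1(4)]]
      have nn': "0 \<le> vnorm (L1 v)" "0 \<le> vnorm (L2 v)"
        using order_trans[OF nn(2) conjunct2[OF 1(2)]] order_trans[OF nn(4) conjunct2[OF 1(4)]] .
      show ?thesis
        by (intro add_mono mult_mono mult_nonneg_nonneg order_refl C nn nn' conjunct2[OF 1(1)]
            conjunct2[OF 1(2)] conjunct2[OF 1(3)] conjunct2[OF 1(4)]) simp_all
    qed
    finally show ?thesis .
  qed
  have lim: "(\<lambda>K. ?f K s) \<longlonglongrightarrow> ?g s" if "s \<in> {0..t}" for s
  proof -
    have ts: "0 \<le> t - s" and s: "0 \<le> s" using that by auto
    show ?thesis
      unfolding form_Phi using L1_P_l2[OF u ts] L1_P_l2[OF v ts] L2_P_l2[OF u ts] L2_P_l2[OF v ts]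
      by (intro tendsto_add form_tendsto_vinner[OF form_bd_minsol[OF x s]]
          LIMSEQ_Suc[OF LIMSEQ_Suc[OF form_tendsto_vinner[OF form_bd_minsol[OF x s]]]]) auto
  qed
  note dc = dominated_convergence[OF has_integral_integrable[OF hi] integrable_const_ivl bd lim]
  have "(\<lambda>K. form (minsol t x) v u (Suc K) - form x (P t v) (P t u) (Suc K))
      \<longlonglongrightarrow> vinner v (mat_app (minsol t x) u) - vinner (P t v) (mat_app x (P t u))"
    by (intro tendsto_diff LIMSEQ_Suc form_tendsto_vinner[OF form_bd_minsol[OF x t]]
        form_tendsto_vinner[OF x] uv P_l2 t)
  then have "(\<lambda>K. integral {0..t} (?f K))
      \<longlonglongrightarrow> vinner v (mat_app (minsol t x) u) - vinner (P t v) (mat_app x (P t u))"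
    unfolding integral_unique[OF hi] .
  from LIMSEQ_unique[OF this dc(2)] dc(1) show ?thesis
    by (simp add: integrable_integral)
qed

lemma qds_solution_minsol: "qds_solution r lam mu zp zm minsol"
  unfolding qds_solution_def
proof (intro conjI allI impI)
  fix t :: real and x assume t: "0 \<le> t"
  show "bounded_op (minsol t x)" if "bounded_op x"
    using that form_bd_minsol[OF _ t] unfolding bounded_op_iff by blast
  show "pos_op (minsol t x)" if "pos_op x"
    using that form_bd_minsol[OF _ t] psd_minsol[OF _ _ t] unfolding pos_op_iff by blast
  show "minsol t (\<lambda>m n. x m n + a * y m n) = (\<lambda>m n. minsol t x m n + a * minsol t y m n)"
    if "bounded_op x" "bounded_op y" for y a
    using that minsol_add_mult[OF _ _ t] unfolding bounded_op_iff by blast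
  show "((\<lambda>s. vinner (L1 (P (t - s) v)) (mat_app (minsol s x) (L1 (P (t - s) u)))
             + vinner (L2 (P (t - s) v)) (mat_app (minsol s x) (L2 (P (t - s) u))))
         has_integral (vinner v (mat_app (minsol t x) u) - vinner (P t v) (mat_app x (P t u)))) {0..t}"
    if "bounded_op x" "u \<in> domG" "v \<in> domG" for u v
    using that minsol_weak_equation[OF _ _ _ t] unfolding bounded_op_iff by blast
qed

end

section \<open>The evolution equation and its energy\<close>

text \<open>With q = p^3 each of the three linear factors receives its own p^n.\<close>

lemma poly3_times_power_tendsto_0:
  fixes q a b c :: real
  assumes "0 \<le> q" "q < 1"
  shows "(\<lambda>n. (2 * real n + a) * (real n + b) * (real n + c) * q ^ n) \<longlonglongrightarrow> 0"
proof -
  define p where "p = root 3 q"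
  have p: "0 \<le> p" "p < 1" "p ^ 3 = q"
    using assms by (auto simp: p_def real_root_pow_pos2)
  have 1: "(\<lambda>n. real n * p ^ n) \<longlonglongrightarrow> 0"
    using powser_times_n_limit_0[of p] p by simp
  have 2: "(\<lambda>n. p ^ n) \<longlonglongrightarrow> 0" using p by (intro LIMSEQ_realpow_zero) auto
  have "(\<lambda>n. (2 * (real n * p ^ n) + a * p ^ n) * (real n * p ^ n + b * p ^ n) * (real n * p ^ n + c * p ^ n))
      \<longlonglongrightarrow> (2 * 0 + a * 0) * (0 + b * 0) * (0 + c * 0)"
    by (intro tendsto_intros 1 2)
  moreover have "(2 * (real n * p ^ n) + a * p ^ n) * (real n * p ^ n + b * p ^ n) * (real n * p ^ n + c * p ^ n)
      = (2 * real n + a) * (real n + b) * (real n + c) * q ^ n" for n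
  proof -
    have "q ^ n = p ^ n * p ^ n * p ^ n"
      unfolding p(3)[symmetric] power_mult[symmetric] power_add[symmetric] by (simp add: mult.commute numeral_3_eq_3 add.assoc)
    then show ?thesis by (simp add: algebra_simps)
  qed
  ultimately show ?thesis by simp
qed

lemma two_Re_cnj_mult_le: "2 * Re (cnj z * w) \<le> (cmod z)\<^sup>2 + (cmod w)\<^sup>2"
proof -
  have "0 \<le> (Re z - Re w)\<^sup>2 + (Im z - Im w)\<^sup>2" by simp
  then show ?thesis unfolding cmod_power2 by (simp add: power2_eq_square algebra_simps)
qed

lemma has_real_derivative_cmod_squared:
  assumes "(f has_vector_derivative f') (at t within S)"
  shows "((\<lambda>t. (cmod (f t))\<^sup>2) has_real_derivative 2 * Re (cnj (f t) * f')) (at t within S)"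
proof -
  have "((\<lambda>t. Re (f t)) has_real_derivative Re f') (at t within S)"
    "((\<lambda>t. Im (f t)) has_real_derivative Im f') (at t within S)"
    using bounded_linear.has_vector_derivative[OF bounded_linear_Re assms]
      bounded_linear.has_vector_derivative[OF bounded_linear_Im assms]
    by (simp_all add: has_real_derivative_iff_has_vector_derivative)
  from DERIV_add[OF DERIV_power[OF this(1), of 2] DERIV_power[OF this(2), of 2]]
  show ?thesis
    unfolding cmod_power2 by (simp add: algebra_simps)
qed

context birth_death
begin

section \<open>From the weak equation to differential equations for entries\<close>

lemma unit_vec_domG: "unit_vec n \<in> domG"
  unfolding domG_def
  by (auto simp: unit_vec_def intro!: finite_support_l2[of "Suc n"] summable_finite[of "{n}"] split: if_splits)

text \<open>Testing with basis vectors: these lie in \<open>domG\<close>, and damping and jumps keep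
  the support finite, so every pairing collapses to a finite corner.\<close>

lemma qds_mild_equation:
  assumes S: "qds_solution r lam mu zp zm S" and x: "bounded_op x" and t: "0 \<le> t"
  shows "((\<lambda>s. Phi (t - s) (S s x) m n) has_integral (S t x m n - damp t x m n)) {0..t}"
proof -
  define K where "K = max m n"
  have K: "m < Suc K" "n < Suc K" by (auto simp: K_def)
  have u0: "unit_vec m j = 0" "unit_vec n j = 0" if "K < j" for j
    using that by (auto simp: unit_vec_def K_def)
  have P0: "P \<tau> (unit_vec m) j = 0" "P \<tau> (unit_vec n) j = 0" if "K < j" for j \<tau>
    using u0[OF that] by (simp_all add: Pt_def)
  have L10: "L1 (P \<tau> (unit_vec m)) j = 0" "L1 (P \<tau> (unit_vec n)) j = 0" if "K \<le> j" for j \<tau>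
    using P0[of "Suc j"] that by (simp_all add: L1v_def Bv_def)
  have L20: "L2 (P \<tau> (unit_vec m)) j = 0" "L2 (P \<tau> (unit_vec n)) j = 0" if "Suc (Suc K) \<le> j" for j \<tau>
    using P0[of "j - 1"] that by (simp_all add: L2v_def Bplusv_def)
  have "((\<lambda>s. vinner (L1 (P (t - s) (unit_vec m))) (mat_app (S s x) (L1 (P (t - s) (unit_vec n))))
             + vinner (L2 (P (t - s) (unit_vec m))) (mat_app (S s x) (L2 (P (t - s) (unit_vec n)))))
         has_integral (vinner (unit_vec m) (mat_app (S t x) (unit_vec n))
           - vinner (P t (unit_vec m)) (mat_app x (P t (unit_vec n))))) {0..t}"
    using S[unfolded qds_solution_def, THEN conjunct2, THEN conjunct2, THEN conjunct2, rule_format,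
        OF t x unit_vec_domG unit_vec_domG, of m n] .
  moreover have "vinner (L1 (P \<tau> (unit_vec m))) (mat_app y (L1 (P \<tau> (unit_vec n))))
      + vinner (L2 (P \<tau> (unit_vec m))) (mat_app y (L2 (P \<tau> (unit_vec n)))) = Phi \<tau> y m n" for \<tau> y
  proof -
    have "vinner (L1 (P \<tau> (unit_vec m))) (mat_app y (L1 (P \<tau> (unit_vec n))))
        = form y (L1 (P \<tau> (unit_vec m))) (L1 (P \<tau> (unit_vec n))) K"
      by (rule vinner_mat_app_finite) (fact L10)+
    moreover have "vinner (L2 (P \<tau> (unit_vec m))) (mat_app y (L2 (P \<tau> (unit_vec n))))
        = form y (L2 (P \<tau> (unit_vec m))) (L2 (P \<tau> (unit_vec n))) (Suc (Suc K))"
      by (rule vinner_mat_app_finite) (fact L20)+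
    ultimately show ?thesis
      by (simp only: form_Phi[symmetric] form_unit[OF K])
  qed
  moreover have "vinner (unit_vec m) (mat_app y (unit_vec n)) = y m n" for y
    by (subst vinner_mat_app_finite[of "Suc K"]) (auto simp: u0 form_unit[OF K])
  moreover have "vinner (P t (unit_vec m)) (mat_app x (P t (unit_vec n))) = damp t x m n"
    by (subst vinner_mat_app_finite[of "Suc K"]) (auto simp: P0 form_unit[OF K] form_damp[symmetric])
  ultimately show ?thesis by simp
qed

text \<open>Solutions of the integral equation are not unique: the associated birth and death process
  comes down from infinity, and mass entering from infinity can be added. Minimality is what
  forces the sub-unital bound.\<close>

lemma minimal_qds_form_bd:
  assumes T: "minimal_qds r lam mu zp zm T" and x: "form_bd C x" and t: "0 \<le> t"
  shows "form_bd (6 * C) (T t x)"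
proof (rule positive_subunital_form_bd[of "T t", OF _ _ _ x])
  have idm: "form_bd 1 idm" by (rule form_bd_diag) simp
  have sol: "qds_solution r lam mu zp zm T" using T by (simp add: minimal_qds_def)
  show "T t (\<lambda>m n. x m n + a * y m n) = (\<lambda>m n. T t x m n + a * T t y m n)"
    if "form_bd C x" "form_bd D y" for x y a C D
    using sol t that unfolding qds_solution_def bounded_op_iff by blast
  show "psd (T t x)" if "form_bd C x" "psd x" for x C
    using sol t that unfolding qds_solution_def pos_op_iff by blast
  have "pos_op idm" using psd_idm idm by (auto simp: pos_op_iff)
  then have "op_le (T t idm) (minsol t idm)"
    using T qds_solution_minsol t unfolding minimal_qds_def by blast
  then have "psd (\<lambda>m n. minsol t idm m n - T t idm m n)" by (simp add: op_le_def pos_op_iff)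
  from psd_add[OF this psd_minsol_idm[OF t]] show "psd (\<lambda>m n. idm m n - T t idm m n)" by simp
qed

definition gen :: "mat \<Rightarrow> mat" where
  "gen y m n = rate m n * y m n + jump y m n"

text \<open>No regularity in time is assumed of \<open>X\<close>. Integrability alone makes the
  indefinite integral, hence every entry, continuous; then the integrand is continuous, and the
  entry differentiable. The initial value is the case t = 0 of the integral equation.\<close>

lemma mild_solution_ode:
  assumes mild: "\<And>t m n. 0 \<le> t \<Longrightarrow>
      ((\<lambda>s. Phi (t - s) (X s) m n) has_integral (X t m n - damp t x m n)) {0..t}"
    and t: "t \<in> {0..b}"
  shows "((\<lambda>t. X t m n) has_vector_derivative gen (X t) m n) (at t within {0..b})" "X 0 = x"
proof -
  define h where "h m n s = exp (- (complex_of_real s * rate m n)) * jump (X s) m n" for m n s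
  have Phi: "Phi (t - s) (X s) m n = exp (complex_of_real t * rate m n) * h m n s" for t s m n
    using duhamel_factor[of t "rate m n" "\<lambda>s. jump (X s) m n"] by (simp add: Phi_def h_def fun_eq_iff)
  have hi: "(h m n has_integral (exp (- (complex_of_real t * rate m n)) * X t m n - x m n)) {0..t}"
    if "0 \<le> t" for t m n
  proof -
    have "((\<lambda>s. exp (- (complex_of_real t * rate m n)) * Phi (t - s) (X s) m n) has_integral
        exp (- (complex_of_real t * rate m n)) * (X t m n - damp t x m n)) {0..t}"
      by (intro has_integral_mult_right mild that)
    then show ?thesis
      by (simp add: Phi damp_def mult.assoc[symmetric] exp_add[symmetric] right_diff_distrib)
  qed
  have X: "X t m n = exp (complex_of_real t * rate m n) * (x m n + integral {0..t} (h m n))"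
    if "0 \<le> t" for t m n
    unfolding integral_unique[OF hi[OF that]]
    by (simp add: mult.assoc[symmetric] exp_add[symmetric])
  have b: "0 \<le> b" using t by simp
  have "continuous_on {0..b} (\<lambda>t. exp (complex_of_real t * rate m n) * (x m n + integral {0..t} (h m n)))" for m n
    using hi[OF b] by (intro continuous_intros indefinite_integral_continuous_1) blast
  then have Xc: "continuous_on {0..b} (\<lambda>t. X t m n)" for m n
    by (rule continuous_on_eq) (simp add: X)
  have hc: "continuous_on {0..b} (h m n)"
    unfolding h_def by (intro continuous_intros jump_continuous Xc)
  have "((\<lambda>z. exp (z * rate m n)) has_field_derivative exp (complex_of_real t * rate m n) * rate m n)
      (at (complex_of_real t))"
    by (auto intro!: derivative_eq_intros)
  from has_vector_derivative_real_field[OF this]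
  have e: "((\<lambda>t. exp (complex_of_real t * rate m n)) has_vector_derivative
      exp (complex_of_real t * rate m n) * rate m n) (at t within {0..b})" .
  have "((\<lambda>t. exp (complex_of_real t * rate m n) * (x m n + integral {0..t} (h m n))) has_vector_derivative
      exp (complex_of_real t * rate m n) * (0 + h m n t) +
      exp (complex_of_real t * rate m n) * rate m n * (x m n + integral {0..t} (h m n))) (at t within {0..b})"
    by (intro has_vector_derivative_mult e has_vector_derivative_add has_vector_derivative_const
        integral_has_vector_derivative hc t)
  moreover have "exp (complex_of_real t * rate m n) * h m n t = jump (X t) m n"
    by (simp add: h_def mult.assoc[symmetric] exp_add[symmetric])
  then have "exp (complex_of_real t * rate m n) * (0 + h m n t) +
      exp (complex_of_real t * rate m n) * rate m n * (x m n + integral {0..t} (h m n)) = gen (X t) m n"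
    using X[of t m n] t by (simp add: gen_def)
  ultimately have "((\<lambda>t. exp (complex_of_real t * rate m n) * (x m n + integral {0..t} (h m n))) has_vector_derivative
      gen (X t) m n) (at t within {0..b})" by simp
  then show "((\<lambda>t. X t m n) has_vector_derivative gen (X t) m n) (at t within {0..b})"
    by (rule has_vector_derivative_transform[OF t, rotated]) (simp add: X)
  show "X 0 = x" by (intro ext) (simp add: X[of 0])
qed

section \<open>Reversible weights and the weighted energy\<close>

definition nu :: real where "nu = lam / mu"

lemma nu_bounds: "0 < nu" "nu < 1"
  using lam_pos lam_less_mu by (auto simp: nu_def)

text \<open>The square of the factor that \<open>iota\<close> puts on the entry (m, n), see
  \<open>rho_mult_squared\<close>; hence \<open>energy\<close> is a corner of the squared
  Hilbert-Schmidt norm.\<close>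

definition wt :: "nat \<Rightarrow> nat \<Rightarrow> real" where
  "wt m n = (1 - nu\<^sup>2) * nu ^ (m + n)"

lemma nu_squared_less_1: "nu\<^sup>2 < 1"
  using nu_bounds by (simp add: power_less_one_iff)

lemma wt_pos: "0 < wt m n"
  unfolding wt_def using nu_bounds nu_squared_less_1 by (intro mult_pos_pos) auto

text \<open>One step along a diagonal raises m + n by 2 and costs nu^2 = lam^2 / mu^2, the ratio of
  the two rate constants; the factors \<open>om\<close> agree.\<close>

lemma wt_detailed_balance: "wt (Suc m) (Suc n) * down (Suc m) (Suc n) = wt m n * up m n"
proof -
  have "nu\<^sup>2 * mu\<^sup>2 = lam\<^sup>2" using mu_pos by (simp add: nu_def power_divide)
  moreover have "wt (Suc m) (Suc n) = wt m n * nu\<^sup>2"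
    by (simp add: wt_def power2_eq_square)
  ultimately show ?thesis
    by (simp only: down_def up_def mult.assoc) (simp only: mult.assoc[symmetric])
qed

lemma up_plus_down_le: "2 * up m n + 2 * down m n \<le> - 2 * Re (rate m n)"
proof -
  have am: "2 * (sqrt a * sqrt b) \<le> a + b" if "0 \<le> a" "0 \<le> b" for a b
    using that sum_squares_bound[of "sqrt a" "sqrt b"] by simp
  have "lam\<^sup>2 * (2 * (sqrt (om (Suc m)) * sqrt (om (Suc n)))) \<le> lam\<^sup>2 * (om (Suc m) + om (Suc n))"
    "mu\<^sup>2 * (2 * (sqrt (om m) * sqrt (om n))) \<le> mu\<^sup>2 * (om m + om n)"
    by (intro mult_left_mono am; simp)+
  then show ?thesis by (simp add: up_def down_def Re_rate algebra_simps)
qed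

text \<open>By detailed balance the dissipation of the energy telescopes along the diagonals.\<close>

definition flux :: "mat \<Rightarrow> nat \<Rightarrow> nat \<Rightarrow> real" where
  "flux y m n = wt m n * up m n * ((cmod (y (Suc m) (Suc n)))\<^sup>2 - (cmod (y m n))\<^sup>2)"

text \<open>Young's inequality bounds the coupling to both neighbours, and
  \<open>up_plus_down_le\<close> absorbs the excess into the damping. What remains is an upward
  current minus a downward one, and detailed balance makes the latter the upward flux of the
  predecessor.\<close>

lemma energy_rate_le_flux:
  "wt m n * (2 * Re (cnj (y m n) * gen y m n))
     \<le> flux y m n - (if m = 0 \<or> n = 0 then 0 else flux y (m - 1) (n - 1))"
proof -
  define z z1 z2 where "z = y m n" and "z1 = y (m - 1) (n - 1)" and "z2 = y (Suc m) (Suc n)"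
  have cc: "cnj z * z = complex_of_real ((cmod z)\<^sup>2)"
    by (simp add: complex_norm_square mult.commute del: of_real_power)
  have "cnj z * gen y m n = rate m n * (cnj z * z) + complex_of_real (down m n) * (cnj z * z1)
      + complex_of_real (up m n) * (cnj z * z2)"
    by (simp add: gen_def jump_def z_def z1_def z2_def algebra_simps)
  then have "2 * Re (cnj z * gen y m n) = 2 * Re (rate m n) * (cmod z)\<^sup>2
      + down m n * (2 * Re (cnj z * z1)) + up m n * (2 * Re (cnj z * z2))"
    unfolding cc by (simp add: algebra_simps del: of_real_power)
  also have "\<dots> \<le> - (2 * up m n + 2 * down m n) * (cmod z)\<^sup>2
      + down m n * ((cmod z)\<^sup>2 + (cmod z1)\<^sup>2) + up m n * ((cmod z)\<^sup>2 + (cmod z2)\<^sup>2)"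
    using up_plus_down_le[of m n]
    by (intro add_mono mult_left_mono mult_right_mono two_Re_cnj_mult_le) auto
  also have "\<dots> = up m n * ((cmod z2)\<^sup>2 - (cmod z)\<^sup>2) - down m n * ((cmod z)\<^sup>2 - (cmod z1)\<^sup>2)"
    by (simp add: algebra_simps)
  finally have "wt m n * (2 * Re (cnj z * gen y m n))
      \<le> wt m n * (up m n * ((cmod z2)\<^sup>2 - (cmod z)\<^sup>2) - down m n * ((cmod z)\<^sup>2 - (cmod z1)\<^sup>2))"
    using wt_pos[of m n] by simp
  also have "\<dots> = flux y m n - (if m = 0 \<or> n = 0 then 0 else flux y (m - 1) (n - 1))"
  proof (cases "m = 0 \<or> n = 0")
    case True
    then show ?thesis by (auto simp: flux_def z_def z2_def)
  next
    case False
    then obtain i j where "m = Suc i" "n = Suc j" by (meson not0_implies_Suc)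
    then show ?thesis
      using wt_detailed_balance[of i j]
      by (simp add: flux_def z_def z1_def z2_def right_diff_distrib mult.assoc[symmetric])
  qed
  finally show ?thesis by (simp add: z_def)
qed

definition energy :: "nat \<Rightarrow> mat \<Rightarrow> real" where
  "energy K y = (\<Sum>m<K. \<Sum>n<K. wt m n * (cmod (y m n))\<^sup>2)"

lemma energy_mono: "K \<le> J \<Longrightarrow> energy K y \<le> energy J y"
  unfolding energy_def
  by (intro order_trans[OF sum_mono sum_mono2] sum_mono2 sum_nonneg mult_nonneg_nonneg)
    (auto intro: less_imp_le wt_pos)

text \<open>A corner of size J + 1 has 2 J + 1 cells in its last row and column. Each has weight at
  most nu^J and rate at most lam^2 \<open>om (Suc J)\<close>.\<close>

definition leak :: "nat \<Rightarrow> real" where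
  "leak J = (2 * real J + 1) * (lam\<^sup>2 * nu ^ J * om (Suc J))"

lemma leak_tendsto_0: "leak \<longlonglongrightarrow> 0"
proof -
  have "(\<lambda>J. lam\<^sup>2 * ((2 * real J + 1) * (real J + 1) * (real J + r) * nu ^ J)) \<longlonglongrightarrow> lam\<^sup>2 * 0"
    using nu_bounds by (intro tendsto_intros poly3_times_power_tendsto_0) auto
  moreover have "leak J = lam\<^sup>2 * ((2 * real J + 1) * (real J + 1) * (real J + r) * nu ^ J)" for J
    by (simp add: leak_def omega_def algebra_simps)
  then have "leak = (\<lambda>J. lam\<^sup>2 * ((2 * real J + 1) * (real J + 1) * (real J + r) * nu ^ J))" ..
  ultimately show ?thesis by simp
qed

lemma om_Suc_mono: "m \<le> n \<Longrightarrow> om (Suc m) \<le> om (Suc n)"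
  unfolding omega_def using r_pos by (intro mult_mono) auto

lemma flux_boundary_le:
  assumes M: "\<And>m n. cmod (y m n) \<le> M" and J: "m \<le> J" "n \<le> J" "m = J \<or> n = J"
  shows "flux y m n \<le> lam\<^sup>2 * nu ^ J * om (Suc J) * M\<^sup>2"
proof -
  have "wt m n \<le> nu ^ J"
  proof -
    have "nu ^ (m + n) \<le> nu ^ J" using J nu_bounds by (intro power_decreasing) auto
    then have "wt m n \<le> 1 * nu ^ J"
      unfolding wt_def using nu_bounds nu_squared_less_1 by (intro mult_mono) auto
    then show ?thesis by simp
  qed
  moreover have "up m n \<le> lam\<^sup>2 * om (Suc J)"
  proof -
    have "sqrt (om (Suc m)) * sqrt (om (Suc n)) \<le> sqrt (om (Suc J)) * sqrt (om (Suc J))"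
      using J by (intro mult_mono real_sqrt_le_mono om_Suc_mono) auto
    then show ?thesis unfolding up_def by (intro mult_left_mono) auto
  qed
  ultimately have 1: "wt m n * up m n \<le> nu ^ J * (lam\<^sup>2 * om (Suc J))"
    using nu_bounds by (intro mult_mono) auto
  have "(cmod (y (Suc m) (Suc n)))\<^sup>2 - (cmod (y m n))\<^sup>2 \<le> M\<^sup>2"
    using power_mono[OF M[of "Suc m" "Suc n"] norm_ge_zero, of 2] zero_le_power2[of "cmod (y m n)"]
    by linarith
  then have "flux y m n \<le> (wt m n * up m n) * M\<^sup>2"
    unfolding flux_def using wt_pos[of m n] by (intro mult_left_mono) auto
  also have "\<dots> \<le> (nu ^ J * (lam\<^sup>2 * om (Suc J))) * M\<^sup>2"
    by (intro mult_right_mono 1) auto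
  finally show ?thesis by (simp add: mult_ac)
qed

text \<open>Inner fluxes cancel along each diagonal, leaving the flux through the last column (J
  cells) and the last row (J + 1 cells).\<close>

lemma energy_rate_le_leak:
  assumes M: "\<And>m n. cmod (y m n) \<le> M"
  shows "(\<Sum>m<Suc J. \<Sum>n<Suc J. wt m n * (2 * Re (cnj (y m n) * gen y m n))) \<le> leak J * M\<^sup>2"
proof -
  let ?c = "lam\<^sup>2 * nu ^ J * om (Suc J) * M\<^sup>2"
  have "(\<Sum>m<Suc J. \<Sum>n<Suc J. wt m n * (2 * Re (cnj (y m n) * gen y m n)))
      \<le> (\<Sum>m<Suc J. \<Sum>n<Suc J. flux y m n - (if m = 0 \<or> n = 0 then 0 else flux y (m - 1) (n - 1)))"
    by (intro sum_mono energy_rate_le_flux)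
  also have "\<dots> = (\<Sum>m<Suc J. \<Sum>n<Suc J. flux y m n)
      - (\<Sum>m<Suc J. \<Sum>n<Suc J. (if m = 0 \<or> n = 0 then 0 else flux y (m - 1) (n - 1)))"
    unfolding sum_subtractf ..
  also have "(\<Sum>m<Suc J. \<Sum>n<Suc J. (if m = 0 \<or> n = 0 then 0 else flux y (m - 1) (n - 1)))
      = (\<Sum>m<J. \<Sum>n<J. flux y m n)"
    unfolding sum.lessThan_Suc_shift by simp
  also have "(\<Sum>m<Suc J. \<Sum>n<Suc J. flux y m n)
      = (\<Sum>m<J. \<Sum>n<J. flux y m n) + ((\<Sum>m<J. flux y m J) + (\<Sum>n<Suc J. flux y J n))"
    by (simp add: sum.distrib)
  also have "\<dots> - (\<Sum>m<J. \<Sum>n<J. flux y m n) \<le> (\<Sum>m<J. ?c) + (\<Sum>n<Suc J. ?c)"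
    using flux_boundary_le[of y M, OF M] by (simp only: add_diff_cancel_left')
      (intro add_mono sum_mono, auto)
  also have "\<dots> = leak J * M\<^sup>2"
    by (simp add: leak_def algebra_simps)
  finally show ?thesis .
qed

text \<open>The mean value theorem bounds the energy gained in the corner J + 1 by b
  \<open>leak J\<close> M^2. The uniform bound \<open>M\<close> is what makes this vanish as
  \<open>J\<close> grows; a fixed smaller corner has less energy.\<close>

lemma energy_bound:
  assumes ode: "\<And>t m n. t \<in> {0..b} \<Longrightarrow>
      ((\<lambda>t. X t m n) has_vector_derivative gen (X t) m n) (at t within {0..b})"
    and M: "\<And>t m n. t \<in> {0..b} \<Longrightarrow> cmod (X t m n) \<le> M"
    and E: "\<And>K. energy K (X 0) \<le> E" and b: "0 \<le> b"
  shows "energy K (X b) \<le> E"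
proof -
  have step: "energy (Suc J) (X b) \<le> E + b * (leak J * M\<^sup>2)" for J
  proof -
    let ?d = "\<lambda>t. \<Sum>m<Suc J. \<Sum>n<Suc J. wt m n * (2 * Re (cnj (X t m n) * gen (X t) m n))"
    have "((\<lambda>t. energy (Suc J) (X t)) has_real_derivative ?d t) (at t within {0..b})"
      if "t \<in> {0..b}" for t
      unfolding energy_def
      by (intro DERIV_sum DERIV_cmult has_real_derivative_cmod_squared ode that)
    then have "((\<lambda>t. energy (Suc J) (X t)) has_derivative (*) (?d t)) (at t within {0..b})"
      if "0 \<le> t" "t \<le> b" for t
      using that unfolding has_field_derivative_def by simp
    from mvt_very_simple[OF b this] obtain t where t: "t \<in> {0..b}"
      "energy (Suc J) (X b) - energy (Suc J) (X 0) = ?d t * (b - 0)" by blast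
    have "?d t * (b - 0) \<le> (leak J * M\<^sup>2) * (b - 0)"
      using b by (intro mult_right_mono energy_rate_le_leak M t) auto
    with t(2) E[of "Suc J"] show ?thesis by (simp add: mult.commute)
  qed
  have "(\<lambda>J. E + b * (leak J * M\<^sup>2)) \<longlonglongrightarrow> E + b * (0 * M\<^sup>2)"
    by (intro tendsto_intros leak_tendsto_0)
  then have lim: "(\<lambda>J. E + b * (leak J * M\<^sup>2)) \<longlonglongrightarrow> E" by simp
  show ?thesis
  proof (rule LIMSEQ_le_const[OF lim])
    show "\<exists>N. \<forall>J\<ge>N. energy K (X b) \<le> E + b * (leak J * M\<^sup>2)"
      using step energy_mono[of K] by (meson le_SucI order_trans)
  qed
qed

end

section \<open>Hilbert-Schmidt matrices\<close>

abbreviation hsn :: "mat \<Rightarrow> nat \<Rightarrow> real" where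
  "hsn \<xi> K \<equiv> L2_set (\<lambda>p. cmod (\<xi> (fst p) (snd p))) ({..<K} \<times> {..<K})"

definition hs_trunc :: "mat \<Rightarrow> nat \<Rightarrow> mat" where
  "hs_trunc \<xi> K = (\<lambda>m n. if m < K \<and> n < K then \<xi> m n else 0)"

lemma finite_subset_square:
  fixes F :: "(nat \<times> nat) set"
  assumes "finite F" obtains K where "F \<subseteq> {..<K} \<times> {..<K}"
proof
  show "F \<subseteq> {..<Suc (Max (fst ` F \<union> snd ` F))} \<times> {..<Suc (Max (fst ` F \<union> snd ` F))}"
  proof
    fix p assume "p \<in> F"
    then have "fst p \<le> Max (fst ` F \<union> snd ` F)" "snd p \<le> Max (fst ` F \<union> snd ` F)"
      using assms by (auto intro!: Max_ge)
    then show "p \<in> {..<Suc (Max (fst ` F \<union> snd ` F))} \<times> {..<Suc (Max (fst ` F \<union> snd ` F))}"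
      by (cases p) auto
  qed
qed

lemma hs_iff: "\<xi> \<in> hs \<longleftrightarrow> (\<lambda>p. (cmod (\<xi> (fst p) (snd p)))\<^sup>2) summable_on UNIV"
  by (simp add: hs_def case_prod_unfold)

lemma hs_norm_alt: "hs_norm \<xi> = sqrt (\<Sum>\<^sub>\<infinity>p. (cmod (\<xi> (fst p) (snd p)))\<^sup>2)"
  by (simp add: hs_norm_def case_prod_unfold)

lemma hs_norm_nonneg [simp]: "0 \<le> hs_norm \<xi>"
  unfolding hs_norm_alt by (intro real_sqrt_ge_zero infsum_nonneg) simp

lemma hs_boundI:
  assumes "\<And>K. hsn \<xi> K \<le> c"
  shows "\<xi> \<in> hs" "hs_norm \<xi> \<le> c"
proof -
  have c: "0 \<le> c" using assms[of 0] by simp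
  have b: "(\<Sum>p\<in>F. (cmod (\<xi> (fst p) (snd p)))\<^sup>2) \<le> c\<^sup>2" if "finite F" for F
  proof -
    obtain K where K: "F \<subseteq> {..<K} \<times> {..<K}" using finite_subset_square[OF \<open>finite F\<close>] .
    have "(\<Sum>p\<in>F. (cmod (\<xi> (fst p) (snd p)))\<^sup>2) \<le> (\<Sum>p\<in>{..<K} \<times> {..<K}. (cmod (\<xi> (fst p) (snd p)))\<^sup>2)"
      using K by (intro sum_mono2) auto
    also have "\<dots> = (hsn \<xi> K)\<^sup>2" by (simp add: L2_set_def sum_nonneg)
    also have "\<dots> \<le> c\<^sup>2" using assms by (intro power_mono) auto
    finally show ?thesis .
  qed
  show hs: "\<xi> \<in> hs"
    unfolding hs_iff by (intro nonneg_bdd_above_summable_on bdd_aboveI2[of _ _ "c\<^sup>2"]) (auto intro: b)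
  have "(\<Sum>\<^sub>\<infinity>p. (cmod (\<xi> (fst p) (snd p)))\<^sup>2) \<le> c\<^sup>2"
    using hs unfolding hs_iff by (intro infsum_le_finite_sums) (auto intro: b)
  then show "hs_norm \<xi> \<le> c"
    unfolding hs_norm_alt using c real_le_lsqrt by blast
qed

lemma L2_set_le_hs_norm:
  assumes "\<xi> \<in> hs" "finite F"
  shows "L2_set (\<lambda>p. cmod (\<xi> (fst p) (snd p))) F \<le> hs_norm \<xi>"
  unfolding L2_set_def hs_norm_alt using assms
  by (intro real_sqrt_le_mono finite_sum_le_infsum) (auto simp: hs_iff)

lemma hsn_le_hs_norm: "\<xi> \<in> hs \<Longrightarrow> hsn \<xi> K \<le> hs_norm \<xi>"
  by (rule L2_set_le_hs_norm) auto

lemma hs_entry_le: "\<xi> \<in> hs \<Longrightarrow> cmod (\<xi> m n) \<le> hs_norm \<xi>"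
  using L2_set_le_hs_norm[of \<xi> "{(m, n)}"] by (simp add: L2_set_def)

lemma hs_mono:
  assumes "\<eta> \<in> hs" "\<And>m n. cmod (\<xi> m n) \<le> cmod (\<eta> m n)"
  shows "\<xi> \<in> hs" "hs_norm \<xi> \<le> hs_norm \<eta>"
proof -
  have "hsn \<xi> K \<le> hs_norm \<eta>" for K
    by (rule order_trans[OF L2_set_mono hsn_le_hs_norm[OF assms(1)]]) (auto simp: assms(2))
  then show "\<xi> \<in> hs" "hs_norm \<xi> \<le> hs_norm \<eta>" by (rule hs_boundI)+
qed

lemma hs_add_mult:
  assumes "\<xi> \<in> hs" "\<eta> \<in> hs"
  shows "(\<lambda>m n. \<xi> m n + a * \<eta> m n) \<in> hs"
    "hs_norm (\<lambda>m n. \<xi> m n + a * \<eta> m n) \<le> hs_norm \<xi> + cmod a * hs_norm \<eta>"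
proof -
  have "hsn (\<lambda>m n. \<xi> m n + a * \<eta> m n) K \<le> hs_norm \<xi> + cmod a * hs_norm \<eta>" for K
  proof -
    have "hsn (\<lambda>m n. \<xi> m n + a * \<eta> m n) K
        \<le> L2_set (\<lambda>p. cmod (\<xi> (fst p) (snd p)) + cmod a * cmod (\<eta> (fst p) (snd p))) ({..<K} \<times> {..<K})"
      by (intro L2_set_mono) (auto simp: norm_triangle_mono norm_mult)
    also have "\<dots> \<le> hsn \<xi> K + L2_set (\<lambda>p. cmod a * cmod (\<eta> (fst p) (snd p))) ({..<K} \<times> {..<K})"
      by (rule L2_set_triangle_ineq)
    also have "\<dots> = hsn \<xi> K + cmod a * hsn \<eta> K" by (simp add: L2_set_right_distrib)
    also have "\<dots> \<le> hs_norm \<xi> + cmod a * hs_norm \<eta>"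
      by (intro add_mono mult_left_mono hsn_le_hs_norm assms) auto
    finally show ?thesis .
  qed
  then show "(\<lambda>m n. \<xi> m n + a * \<eta> m n) \<in> hs"
    "hs_norm (\<lambda>m n. \<xi> m n + a * \<eta> m n) \<le> hs_norm \<xi> + cmod a * hs_norm \<eta>"
    by (rule hs_boundI)+
qed

lemma hs_zero: "(\<lambda>m n. 0) \<in> hs" "hs_norm (\<lambda>m n. 0) = 0"
  using hs_boundI[of "\<lambda>m n. 0" 0] hs_norm_nonneg[of "\<lambda>m n. 0"] by (auto simp: L2_set_def intro: antisym)

lemma hs_cmult:
  assumes "\<eta> \<in> hs" shows "(\<lambda>m n. a * \<eta> m n) \<in> hs" "hs_norm (\<lambda>m n. a * \<eta> m n) \<le> cmod a * hs_norm \<eta>"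
  using hs_add_mult[OF hs_zero(1) assms, of a] hs_zero(2) by auto

lemma hs_diff:
  assumes "\<xi> \<in> hs" "\<eta> \<in> hs"
  shows "(\<lambda>m n. \<xi> m n - \<eta> m n) \<in> hs" "hs_norm (\<lambda>m n. \<xi> m n - \<eta> m n) \<le> hs_norm \<xi> + hs_norm \<eta>"
  using hs_add_mult[OF assms, of "-1"] by auto

lemma hs_norm_trunc:
  shows "hs_trunc \<xi> K \<in> hs" "hs_norm (hs_trunc \<xi> K) \<le> hsn \<xi> K"
proof -
  have "hsn (hs_trunc \<xi> K) J \<le> hsn \<xi> K" for J
    unfolding L2_set_def
  proof (rule real_sqrt_le_mono)
    have "(\<Sum>p\<in>{..<J} \<times> {..<J}. (cmod (hs_trunc \<xi> K (fst p) (snd p)))\<^sup>2)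
        = (\<Sum>p\<in>({..<J} \<times> {..<J}) \<inter> ({..<K} \<times> {..<K}). (cmod (\<xi> (fst p) (snd p)))\<^sup>2)"
      by (intro sum.mono_neutral_cong_right) (auto simp: hs_trunc_def)
    also have "\<dots> \<le> (\<Sum>p\<in>{..<K} \<times> {..<K}. (cmod (\<xi> (fst p) (snd p)))\<^sup>2)"
      by (intro sum_mono2) auto
    finally show "(\<Sum>p\<in>{..<J} \<times> {..<J}. (cmod (hs_trunc \<xi> K (fst p) (snd p)))\<^sup>2)
        \<le> (\<Sum>p\<in>{..<K} \<times> {..<K}. (cmod (\<xi> (fst p) (snd p)))\<^sup>2)" .
  qed
  then show "hs_trunc \<xi> K \<in> hs" "hs_norm (hs_trunc \<xi> K) \<le> hsn \<xi> K" by (rule hs_boundI)+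
qed

text \<open>The squares are cofinal among finite index sets, so the unordered sum is the limit of
  the sums over squares.\<close>

lemma hs_trunc_tendsto:
  assumes "\<xi> \<in> hs"
  shows "(\<lambda>K. hs_norm (\<lambda>m n. \<xi> m n - hs_trunc \<xi> K m n)) \<longlonglongrightarrow> 0"
proof -
  let ?f = "\<lambda>p. (cmod (\<xi> (fst p) (snd p)))\<^sup>2"
  let ?S = "\<lambda>K::nat. {..<K} \<times> {..<K}"
  have s: "?f summable_on UNIV" using assms by (simp add: hs_iff)
  have "(sum ?f \<longlongrightarrow> infsum ?f UNIV) (finite_subsets_at_top UNIV)"
    using has_sum_infsum[OF s] unfolding has_sum_def .
  moreover have "filterlim ?S (finite_subsets_at_top UNIV) sequentially"
    unfolding filterlim_finite_subsets_at_top
  proof (intro allI impI)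
    fix X :: "(nat \<times> nat) set" assume "finite X \<and> X \<subseteq> UNIV"
    then obtain K where K: "X \<subseteq> ?S K" using finite_subset_square by blast
    show "\<forall>\<^sub>F J in sequentially. finite (?S J) \<and> X \<subseteq> ?S J \<and> ?S J \<subseteq> UNIV"
      using eventually_ge_at_top[of K] by eventually_elim (use K in auto)
  qed
  ultimately have lim: "(\<lambda>K. sum ?f (?S K)) \<longlonglongrightarrow> infsum ?f UNIV"
    by (rule filterlim_compose)
  have eq: "hs_norm (\<lambda>m n. \<xi> m n - hs_trunc \<xi> K m n) = sqrt (infsum ?f UNIV - sum ?f (?S K))" for K
  proof -
    have "(\<Sum>\<^sub>\<infinity>p. (cmod (\<xi> (fst p) (snd p) - hs_trunc \<xi> K (fst p) (snd p)))\<^sup>2) = infsum ?f (UNIV - ?S K)"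
      by (rule infsum_cong_neutral) (auto simp: hs_trunc_def)
    also have "\<dots> = infsum ?f UNIV - infsum ?f (?S K)"
      by (intro infsum_Diff s summable_on_finite) auto
    finally show ?thesis by (simp add: hs_norm_alt)
  qed
  have "(\<lambda>K. sqrt (infsum ?f UNIV - sum ?f (?S K))) \<longlonglongrightarrow> sqrt (infsum ?f UNIV - infsum ?f UNIV)"
    by (intro tendsto_intros lim)
  then show ?thesis unfolding eq by simp
qed

section \<open>Inner product, and generators of contractions\<close>

lemma hs_inner_alt: "hs_inner \<xi> \<eta> = (\<Sum>\<^sub>\<infinity>p. cnj (\<xi> (fst p) (snd p)) * \<eta> (fst p) (snd p))"
  by (simp add: hs_inner_def case_prod_unfold)

lemma hs_inner_summable_le:
  assumes "\<xi> \<in> hs" "\<eta> \<in> hs"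
  shows "(\<lambda>p. cnj (\<xi> (fst p) (snd p)) * \<eta> (fst p) (snd p)) summable_on UNIV"
    "cmod (hs_inner \<xi> \<eta>) \<le> hs_norm \<xi> * hs_norm \<eta>"
proof -
  let ?f = "\<lambda>p. cnj (\<xi> (fst p) (snd p)) * \<eta> (fst p) (snd p)"
  have b: "(\<Sum>p\<in>F. norm (?f p)) \<le> hs_norm \<xi> * hs_norm \<eta>" if "finite F" for F
  proof -
    have "(\<Sum>p\<in>F. norm (?f p)) \<le> L2_set (\<lambda>p. cmod (\<xi> (fst p) (snd p))) F * L2_set (\<lambda>p. cmod (\<eta> (fst p) (snd p))) F"
      using L2_set_mult_ineq[of "\<lambda>p. cmod (\<xi> (fst p) (snd p))" "\<lambda>p. cmod (\<eta> (fst p) (snd p))" F]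
      by (simp add: norm_mult)
    also have "\<dots> \<le> hs_norm \<xi> * hs_norm \<eta>"
      by (intro mult_mono L2_set_le_hs_norm assms that) auto
    finally show ?thesis .
  qed
  have s: "(\<lambda>p. norm (?f p)) summable_on UNIV"
    by (intro nonneg_bdd_above_summable_on bdd_aboveI2[of _ _ "hs_norm \<xi> * hs_norm \<eta>"]) (auto intro: b)
  then show "?f summable_on UNIV" by (rule abs_summable_summable)
  have "cmod (hs_inner \<xi> \<eta>) \<le> (\<Sum>\<^sub>\<infinity>p. norm (?f p))"
    unfolding hs_inner_alt using s by (rule norm_infsum_bound)
  also have "\<dots> \<le> hs_norm \<xi> * hs_norm \<eta>"
    by (rule infsum_le_finite_sums[OF s]) (rule b)
  finally show "cmod (hs_inner \<xi> \<eta>) \<le> hs_norm \<xi> * hs_norm \<eta>" .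
qed

lemma hs_inner_add_mult:
  assumes "\<xi> \<in> hs" "\<eta> \<in> hs" "\<zeta> \<in> hs"
  shows "hs_inner \<xi> (\<lambda>m n. \<eta> m n + a * \<zeta> m n) = hs_inner \<xi> \<eta> + a * hs_inner \<xi> \<zeta>"
proof -
  have "hs_inner \<xi> (\<lambda>m n. \<eta> m n + a * \<zeta> m n) =
      (\<Sum>\<^sub>\<infinity>p. cnj (\<xi> (fst p) (snd p)) * \<eta> (fst p) (snd p) + a * (cnj (\<xi> (fst p) (snd p)) * \<zeta> (fst p) (snd p)))"
    unfolding hs_inner_alt by (intro infsum_cong) (simp add: algebra_simps)
  also have "\<dots> = hs_inner \<xi> \<eta> + (\<Sum>\<^sub>\<infinity>p. a * (cnj (\<xi> (fst p) (snd p)) * \<zeta> (fst p) (snd p)))"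
    unfolding hs_inner_alt using assms
    by (intro infsum_add hs_inner_summable_le summable_on_cmult_right)
  also have "(\<Sum>\<^sub>\<infinity>p. a * (cnj (\<xi> (fst p) (snd p)) * \<zeta> (fst p) (snd p))) = a * hs_inner \<xi> \<zeta>"
    unfolding hs_inner_alt using assms by (intro infsum_cmult_right hs_inner_summable_le)
  finally show ?thesis .
qed

lemma hs_inner_self: "\<xi> \<in> hs \<Longrightarrow> hs_inner \<xi> \<xi> = complex_of_real ((hs_norm \<xi>)\<^sup>2)"
proof -
  assume "\<xi> \<in> hs"
  have "hs_inner \<xi> \<xi> = (\<Sum>\<^sub>\<infinity>p. complex_of_real ((cmod (\<xi> (fst p) (snd p)))\<^sup>2))"
    unfolding hs_inner_alt
    by (intro infsum_cong) (simp add: complex_norm_square mult.commute del: of_real_power)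
  also have "\<dots> = complex_of_real (\<Sum>\<^sub>\<infinity>p. (cmod (\<xi> (fst p) (snd p)))\<^sup>2)"
    using \<open>\<xi> \<in> hs\<close> unfolding hs_iff by (intro infsumI has_sum_of_real has_sum_infsum)
  also have "(\<Sum>\<^sub>\<infinity>p. (cmod (\<xi> (fst p) (snd p)))\<^sup>2) = (hs_norm \<xi>)\<^sup>2"
    by (simp add: hs_norm_alt infsum_nonneg)
  finally show ?thesis .
qed

lemma gen_has_entry_tendsto:
  assumes TT: "\<And>t. 0 \<le> t \<Longrightarrow> TT t \<xi> \<in> hs" and \<xi>: "\<xi> \<in> hs" and g: "gen_has TT \<xi> \<eta>"
  shows "((\<lambda>t. (TT t \<xi> m n - \<xi> m n) / complex_of_real t) \<longlongrightarrow> \<eta> m n) (at_right 0)"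
proof -
  have \<eta>: "\<eta> \<in> hs" and
    lim: "((\<lambda>t. hs_norm (\<lambda>m n. (TT t \<xi> m n - \<xi> m n) / complex_of_real t - \<eta> m n)) \<longlongrightarrow> 0) (at_right 0)"
    using g by (auto simp: gen_has_def)
  have "((\<lambda>t. (TT t \<xi> m n - \<xi> m n) / complex_of_real t - \<eta> m n) \<longlongrightarrow> 0) (at_right 0)"
  proof (rule Lim_null_comparison[OF _ lim])
    show "\<forall>\<^sub>F t in at_right 0. cmod ((TT t \<xi> m n - \<xi> m n) / complex_of_real t - \<eta> m n)
        \<le> hs_norm (\<lambda>m n. (TT t \<xi> m n - \<xi> m n) / complex_of_real t - \<eta> m n)"
      using eventually_at_right_less[of "0::real"]
    proof eventually_elim
      case (elim t)
      have "(\<lambda>m n. 1 / complex_of_real t * (TT t \<xi> m n - \<xi> m n) - \<eta> m n) \<in> hs"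
        using elim by (intro hs_diff hs_cmult TT \<xi> \<eta>) auto
      then show ?case using hs_entry_le by fastforce
    qed
  qed
  then show ?thesis by (rule LIM_zero_cancel)
qed

text \<open>Contractivity and Cauchy-Schwarz make the real part of the pairing with each difference
  quotient nonpositive, and the quotients converge in norm.\<close>

lemma gen_has_dissipative:
  assumes TT: "\<And>t. 0 \<le> t \<Longrightarrow> TT t \<xi> \<in> hs" "\<And>t. 0 \<le> t \<Longrightarrow> hs_norm (TT t \<xi>) \<le> hs_norm \<xi>"
    and \<xi>: "\<xi> \<in> hs" and g: "gen_has TT \<xi> \<eta>"
  shows "Re (hs_inner \<xi> \<eta>) \<le> 0"
proof -
  have \<eta>: "\<eta> \<in> hs" and
    lim: "((\<lambda>t. hs_norm (\<lambda>m n. (TT t \<xi> m n - \<xi> m n) / complex_of_real t - \<eta> m n)) \<longlongrightarrow> 0) (at_right 0)"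
    using g by (auto simp: gen_has_def)
  have "((\<lambda>t. hs_norm \<xi> * hs_norm (\<lambda>m n. (TT t \<xi> m n - \<xi> m n) / complex_of_real t - \<eta> m n))
      \<longlongrightarrow> hs_norm \<xi> * 0) (at_right 0)"
    by (intro tendsto_intros lim)
  moreover have "\<forall>\<^sub>F t in at_right 0. Re (hs_inner \<xi> \<eta>)
      \<le> hs_norm \<xi> * hs_norm (\<lambda>m n. (TT t \<xi> m n - \<xi> m n) / complex_of_real t - \<eta> m n)"
    using eventually_at_right_less[of "0::real"]
  proof eventually_elim
    case (elim t)
    \<comment> \<open>The quotient is written as 0 + a (TT + (-1) xi) so that
      \<open>hs_inner_add_mult\<close> alone expands the pairing.\<close>
    define d where "d = (\<lambda>m n. 0 + complex_of_real (1 / t) * (TT t \<xi> m n + (-1) * \<xi> m n))"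
    have T: "TT t \<xi> \<in> hs" "hs_norm (TT t \<xi>) \<le> hs_norm \<xi>" using TT elim by auto
    have diff: "(\<lambda>m n. TT t \<xi> m n + (-1) * \<xi> m n) \<in> hs" by (intro hs_add_mult T \<xi>)
    have d: "d \<in> hs" unfolding d_def by (intro hs_add_mult hs_zero diff)
    have "hs_inner \<xi> d = complex_of_real (1 / t) * (hs_inner \<xi> (TT t \<xi>) - complex_of_real ((hs_norm \<xi>)\<^sup>2))"
      unfolding d_def hs_inner_add_mult[OF \<xi> hs_zero(1) diff] hs_inner_add_mult[OF \<xi> T(1) \<xi>] hs_inner_self[OF \<xi>]
      by (simp add: hs_inner_alt)
    then have "Re (hs_inner \<xi> d) = 1 / t * (Re (hs_inner \<xi> (TT t \<xi>)) - (hs_norm \<xi>)\<^sup>2)"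
      by (simp del: of_real_power of_real_divide)
    moreover have "Re (hs_inner \<xi> (TT t \<xi>)) \<le> (hs_norm \<xi>)\<^sup>2"
    proof -
      have "Re (hs_inner \<xi> (TT t \<xi>)) \<le> hs_norm \<xi> * hs_norm (TT t \<xi>)"
        using complex_Re_le_cmod hs_inner_summable_le(2)[OF \<xi> T(1)] by (rule order_trans)
      also have "\<dots> \<le> hs_norm \<xi> * hs_norm \<xi>" using T(2) by (intro mult_left_mono) auto
      finally show ?thesis by (simp add: power2_eq_square)
    qed
    ultimately have "Re (hs_inner \<xi> d) \<le> 0" using elim by (simp add: divide_nonpos_pos)
    moreover have "hs_inner \<xi> (\<lambda>m n. d m n + (-1) * \<eta> m n) = hs_inner \<xi> d - hs_inner \<xi> \<eta>"
      using hs_inner_add_mult[OF \<xi> d \<eta>, of "-1"] by simp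
    then have "Re (hs_inner \<xi> \<eta>) - Re (hs_inner \<xi> d) \<le> cmod (hs_inner \<xi> (\<lambda>m n. d m n + (-1) * \<eta> m n))"
      using abs_Re_le_cmod[of "hs_inner \<xi> d - hs_inner \<xi> \<eta>"] by simp
    moreover have "\<dots> \<le> hs_norm \<xi> * hs_norm (\<lambda>m n. d m n + (-1) * \<eta> m n)"
      by (intro hs_inner_summable_le hs_add_mult \<xi> d \<eta>)
    moreover have "(\<lambda>m n. d m n + (-1) * \<eta> m n) = (\<lambda>m n. (TT t \<xi> m n - \<xi> m n) / complex_of_real t - \<eta> m n)"
      by (simp add: d_def)
    ultimately show ?case by simp
  qed
  ultimately show ?thesis
    using tendsto_lowerbound[of _ "hs_norm \<xi> * 0" "at_right (0::real)"] by force
qed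

section \<open>The semigroup on Hilbert-Schmidt matrices\<close>

lemma has_vector_derivative_at_right_quotient:
  fixes f :: "real \<Rightarrow> complex"
  assumes "(f has_vector_derivative D) (at 0 within {0..b})" "0 < b"
  shows "((\<lambda>t. (f t - f 0) / complex_of_real t) \<longlongrightarrow> D) (at_right 0)"
proof -
  have "((\<lambda>t. Re (f t)) has_real_derivative Re D) (at_right 0)"
    "((\<lambda>t. Im (f t)) has_real_derivative Im D) (at_right 0)"
    using bounded_linear.has_vector_derivative[OF bounded_linear_Re assms(1)]
      bounded_linear.has_vector_derivative[OF bounded_linear_Im assms(1)]
    by (simp_all add: has_real_derivative_iff_has_vector_derivative at_within_Icc_at_right[OF assms(2)])
  then have "((\<lambda>t. (Re (f t) - Re (f 0)) / t) \<longlongrightarrow> Re D) (at_right 0)"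
    "((\<lambda>t. (Im (f t) - Im (f 0)) / t) \<longlongrightarrow> Im D) (at_right 0)"
    by (simp_all add: has_field_derivative_iff)
  then show ?thesis
    by (simp add: tendsto_complex_iff Re_divide_of_real Im_divide_of_real)
qed

lemma norm_diff_le_of_vector_derivative:
  fixes f :: "real \<Rightarrow> complex"
  assumes "\<And>s. s \<in> {0..t} \<Longrightarrow> (f has_vector_derivative D s) (at s within {0..t})"
    and "\<And>s. s \<in> {0..t} \<Longrightarrow> cmod (D s) \<le> B" "0 \<le> t"
  shows "cmod (f t - f 0) \<le> B * t"
proof -
  have "norm (f t - f 0) \<le> B * norm (t - 0)"
  proof (rule differentiable_bound[of "{0..t}" f "\<lambda>s h. h *\<^sub>R D s"])
    show "(f has_derivative (\<lambda>h. h *\<^sub>R D s)) (at s within {0..t})" if "s \<in> {0..t}" for s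
      using assms(1)[OF that] by (simp add: has_vector_derivative_def)
    show "onorm (\<lambda>h. h *\<^sub>R D s) \<le> B" if "s \<in> {0..t}" for s
      using assms(2)[OF that] by (intro onorm_le) (simp add: mult.commute[of B] mult_left_mono)
  qed (use assms(3) in auto)
  then show ?thesis using assms(3) by simp
qed

section \<open>The embedding \<open>iota\<close> and contractivity\<close>

locale birth_death_hs = birth_death +
  fixes T TT :: "real \<Rightarrow> mat \<Rightarrow> mat"
  assumes minimal: "minimal_qds r lam mu zp zm T"
    and extension: "hs_extension nu T TT"
begin

abbreviation rho :: "nat \<Rightarrow> real" where "rho n \<equiv> rho14 nu n"

lemma rho_pos: "0 < rho n"
  unfolding rho14_def using nu_bounds nu_squared_less_1 by simp

lemma rho_squared: "(rho n)\<^sup>2 = sqrt (1 - nu\<^sup>2) * nu ^ n"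
proof -
  let ?a = "(1 - nu\<^sup>2) * nu ^ (2 * n)"
  have a: "0 \<le> ?a" using nu_bounds nu_squared_less_1 by simp
  have "(rho n)\<^sup>2 = ?a powr (1/4 + 1/4)"
    unfolding rho14_def power2_eq_square powr_add ..
  also have "\<dots> = sqrt ?a" using a by (simp add: powr_half_sqrt)
  also have "\<dots> = sqrt (1 - nu\<^sup>2) * nu ^ n"
    using nu_bounds by (simp add: real_sqrt_mult power_even_eq)
  finally show ?thesis .
qed

lemma rho_mult_squared: "(rho m * rho n)\<^sup>2 = wt m n"
  using nu_squared_less_1
  by (simp add: power_mult_distrib rho_squared wt_def power_add)

lemma norm_iota: "cmod (iota nu x m n) = rho m * rho n * cmod (x m n)"
  using rho_pos[of m] rho_pos[of n] by (simp add: iota_def norm_mult)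

lemma hsn_iota: "(hsn (iota nu x) K)\<^sup>2 = energy K x"
  by (simp add: L2_set_def sum_nonneg energy_def norm_iota power_mult_distrib rho_mult_squared[symmetric]
      sum.cartesian_product case_prod_unfold)

lemma energy_le_hs_norm: "iota nu x \<in> hs \<Longrightarrow> energy K x \<le> (hs_norm (iota nu x))\<^sup>2"
  unfolding hsn_iota[symmetric] by (intro power_mono hsn_le_hs_norm) auto

text \<open>The weights decay geometrically in both indices, so the embedded all-ones matrix is a
  Hilbert-Schmidt majorant for every matrix with bounded entries.\<close>

lemma iota_ones_hs: "iota nu (\<lambda>m n. 1) \<in> hs"
proof -
  have "hsn (iota nu (\<lambda>m n. 1)) K \<le> 1 / (1 - nu)" for K
  proof (rule power2_le_imp_le)
    have g: "(\<Sum>n<K. nu ^ n) \<le> 1 / (1 - nu)"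
      using nu_bounds sum_le_suminf[of "\<lambda>n. nu ^ n" "{..<K}"] by (simp add: suminf_geometric summable_geometric)
    have "(hsn (iota nu (\<lambda>m n. 1)) K)\<^sup>2 = (1 - nu\<^sup>2) * ((\<Sum>m<K. nu ^ m) * (\<Sum>n<K. nu ^ n))"
      unfolding hsn_iota energy_def wt_def
      by (simp add: sum_product sum_distrib_left power_add mult_ac)
    also have "\<dots> \<le> 1 * (1 / (1 - nu) * (1 / (1 - nu)))"
      using nu_bounds nu_squared_less_1 by (intro mult_mono g mult_nonneg_nonneg sum_nonneg) auto
    finally show "(hsn (iota nu (\<lambda>m n. 1)) K)\<^sup>2 \<le> (1 / (1 - nu))\<^sup>2"
      by (simp add: power2_eq_square)
    show "0 \<le> 1 / (1 - nu)" using nu_bounds by simp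
  qed
  then show ?thesis by (rule hs_boundI)
qed

lemma iota_bounded_hs:
  assumes "\<And>m n. cmod (x m n) \<le> M"
  shows "iota nu x \<in> hs"
proof -
  have M: "0 \<le> M" using assms[of 0 0] norm_ge_zero order_trans by blast
  show ?thesis
  proof (rule hs_mono(1)[OF hs_cmult(1)[OF iota_ones_hs, of "complex_of_real M"]])
    fix m n
    show "cmod (iota nu x m n) \<le> cmod (complex_of_real M * iota nu (\<lambda>m n. 1) m n)"
      using assms[of m n] rho_pos[of m] rho_pos[of n] M
      by (simp add: norm_mult norm_iota mult.commute[of M] mult_left_mono)
  qed
qed

text \<open>Dominated convergence in Hilbert-Schmidt norm: outside a large corner the all-ones
  majorant is small uniformly in \<open>t\<close>, inside it finitely many entries tend to
  0.\<close>

lemma bounded_iota_tendsto_0: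
  fixes Z :: "real \<Rightarrow> mat"
  assumes M: "\<forall>\<^sub>F t in F. \<forall>m n. cmod (Z t m n) \<le> M"
    and lim: "\<And>m n. ((\<lambda>t. Z t m n) \<longlongrightarrow> 0) F"
  shows "((\<lambda>t. hs_norm (iota nu (Z t))) \<longlongrightarrow> 0) F"
proof (rule tendstoI)
  fix e :: real assume e: "0 < e"
  let ?o = "iota nu (\<lambda>m n. 1)"
  have "(\<lambda>K. \<bar>M\<bar> * hs_norm (\<lambda>m n. ?o m n - hs_trunc ?o K m n)) \<longlonglongrightarrow> \<bar>M\<bar> * 0"
    by (intro tendsto_intros hs_trunc_tendsto iota_ones_hs)
  then have "\<forall>\<^sub>F K in sequentially. \<bar>M\<bar> * hs_norm (\<lambda>m n. ?o m n - hs_trunc ?o K m n) < e / 2"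
    using e by (intro order_tendstoD) auto
  then obtain K where K: "\<bar>M\<bar> * hs_norm (\<lambda>m n. ?o m n - hs_trunc ?o K m n) < e / 2"
    unfolding eventually_sequentially by blast
  have "((\<lambda>t. hsn (iota nu (Z t)) K) \<longlongrightarrow> L2_set (\<lambda>p. cmod (complex_of_real (rho (fst p)) * 0 * complex_of_real (rho (snd p)))) ({..<K} \<times> {..<K})) F"
    unfolding L2_set_def iota_def by (intro tendsto_intros lim)
  then have "((\<lambda>t. hsn (iota nu (Z t)) K) \<longlongrightarrow> 0) F"
    by (simp add: L2_set_def)
  then have "\<forall>\<^sub>F t in F. hsn (iota nu (Z t)) K < e / 2"
    using e by (intro order_tendstoD) auto
  with M show "\<forall>\<^sub>F t in F. dist (hs_norm (iota nu (Z t))) 0 < e"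
  proof eventually_elim
    case (elim t)
    let ?z = "iota nu (Z t)"
    let ?d = "\<lambda>m n. ?o m n - hs_trunc ?o K m n"
    have d: "?d \<in> hs" by (intro hs_diff hs_norm_trunc iota_ones_hs)
    have md: "(\<lambda>m n. complex_of_real M * ?d m n) \<in> hs"
      "hs_norm (\<lambda>m n. complex_of_real M * ?d m n) \<le> cmod (complex_of_real M) * hs_norm ?d"
      by (rule hs_cmult[OF d])+
    have le: "cmod (?z m n - hs_trunc ?z K m n) \<le> cmod (complex_of_real M * ?d m n)" for m n
    proof (cases "m < K \<and> n < K")
      case False
      have "cmod (?z m n) \<le> rho m * rho n * M"
        unfolding norm_iota using elim(1) rho_pos[of m] rho_pos[of n] by (intro mult_left_mono) auto
      also have "\<dots> \<le> rho m * rho n * \<bar>M\<bar>"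
        using rho_pos[of m] rho_pos[of n] by (intro mult_left_mono) auto
      finally show ?thesis using False
        by (auto simp: hs_trunc_def norm_mult norm_iota mult_ac)
    qed (simp add: hs_trunc_def)
    have 1: "(\<lambda>m n. ?z m n - hs_trunc ?z K m n) \<in> hs"
      "hs_norm (\<lambda>m n. ?z m n - hs_trunc ?z K m n) \<le> \<bar>M\<bar> * hs_norm ?d"
      using hs_mono[OF md(1), of "\<lambda>m n. ?z m n - hs_trunc ?z K m n", OF le] md(2) by auto
    have "hs_norm ?z \<le> hs_norm (hs_trunc ?z K) + hs_norm (\<lambda>m n. ?z m n - hs_trunc ?z K m n)"
      using hs_add_mult(2)[OF hs_norm_trunc(1)[of ?z K] 1(1), of 1] by simp
    also have "\<dots> < e / 2 + e / 2"
      using hs_norm_trunc(2)[of ?z K] elim(2) 1(2) K by (intro add_strict_mono) auto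
    finally show ?case by simp
  qed
qed

lemma qds_T: "qds_solution r lam mu zp zm T"
  using minimal by (simp add: minimal_qds_def)

lemma T_ode:
  assumes "form_bd C x" "t \<in> {0..b}"
  shows "((\<lambda>t. T t x m n) has_vector_derivative gen (T t x) m n) (at t within {0..b})"
  using assms(1) by (intro mild_solution_ode(1)[where x = x, OF qds_mild_equation[OF qds_T] assms(2)])
    (auto simp: bounded_op_iff)

lemma T_zero: "form_bd C x \<Longrightarrow> T 0 x = x"
  by (rule mild_solution_ode(2)[of "\<lambda>t. T t x" x 0 0, OF qds_mild_equation[OF qds_T]])
    (auto simp: bounded_op_iff)

lemma T_entry_le: "form_bd C x \<Longrightarrow> 0 \<le> t \<Longrightarrow> cmod (T t x m n) \<le> 6 * C"
  by (rule form_bd_entry[OF minimal_qds_form_bd[OF minimal]])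

text \<open>Minimality enters through the entry bound 6 C, which is the \<open>M\<close> demanded by
  \<open>energy_bound\<close>.\<close>

lemma T_contraction:
  assumes x: "form_bd C x" and t: "0 \<le> t"
  shows "hs_norm (iota nu (T t x)) \<le> hs_norm (iota nu x)"
proof -
  have hs: "iota nu x \<in> hs" by (rule iota_bounded_hs) (rule form_bd_entry[OF x])
  have "energy K (T t x) \<le> (hs_norm (iota nu x))\<^sup>2" for K
  proof (rule energy_bound[OF T_ode[OF x] _ _ t])
    show "cmod (T s x m n) \<le> 6 * C" if "s \<in> {0..t}" for s m n
      using T_entry_le[OF x] that by simp
    show "energy K (T 0 x) \<le> (hs_norm (iota nu x))\<^sup>2" for K
      unfolding T_zero[OF x] by (rule energy_le_hs_norm[OF hs])
  qed
  then have "hsn (iota nu (T t x)) K \<le> hs_norm (iota nu x)" for K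
    unfolding hsn_iota[symmetric] by (rule power2_le_imp_le) simp
  then show ?thesis by (rule hs_boundI)
qed

lemma TT_hs: "0 \<le> t \<Longrightarrow> \<xi> \<in> hs \<Longrightarrow> TT t \<xi> \<in> hs"
  using extension unfolding hs_extension_def by blast

lemma TT_add_mult: "0 \<le> t \<Longrightarrow> \<xi> \<in> hs \<Longrightarrow> \<eta> \<in> hs \<Longrightarrow>
    TT t (\<lambda>m n. \<xi> m n + a * \<eta> m n) = (\<lambda>m n. TT t \<xi> m n + a * TT t \<eta> m n)"
  using extension unfolding hs_extension_def by blast

lemma TT_iota: "0 \<le> t \<Longrightarrow> form_bd C x \<Longrightarrow> TT t (iota nu x) = iota nu (T t x)"
  using extension unfolding hs_extension_def bounded_op_iff by blast

text \<open>Entrywise inverse of \<open>iota\<close>, total because the weights are positive; its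
  values need not be bounded operators.\<close>

definition unweight :: "mat \<Rightarrow> mat" where
  "unweight \<xi> = (\<lambda>m n. \<xi> m n / complex_of_real (rho m * rho n))"

lemma iota_unweight: "iota nu (unweight \<xi>) = \<xi>"
  using rho_pos by (simp add: iota_def unweight_def fun_eq_iff less_imp_neq[THEN not_sym])

lemma unweight_iota: "unweight (iota nu x) = x"
  using rho_pos by (simp add: iota_def unweight_def fun_eq_iff less_imp_neq[THEN not_sym])

lemma hs_trunc_iota:
  obtains C x where "form_bd C x" "hs_trunc \<xi> K = iota nu x"
proof -
  have "\<exists>C. form_bd C (unweight (hs_trunc \<xi> K))"
    by (rule form_bd_finite[of K]) (auto simp: unweight_def hs_trunc_def)
  then obtain C where "form_bd C (unweight (hs_trunc \<xi> K))" ..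
  then show ?thesis using that[of C "unweight (hs_trunc \<xi> K)"] by (simp add: iota_unweight)
qed

lemma hs_split_trunc: "\<xi> = (\<lambda>m n. hs_trunc \<xi> K m n + 1 * (\<xi> m n - hs_trunc \<xi> K m n))"
  by simp

lemma hs_rest: "\<xi> \<in> hs \<Longrightarrow> (\<lambda>m n. \<xi> m n - hs_trunc \<xi> K m n) \<in> hs"
  by (intro hs_diff hs_norm_trunc)

text \<open>The extension comes with an arbitrary constant for each time. Once a finite corner is
  split off, which contracts by \<open>T_contraction\<close>, that constant multiplies only a
  vanishing tail.\<close>

lemma TT_contraction:
  assumes \<xi>: "\<xi> \<in> hs" and t: "0 \<le> t"
  shows "hs_norm (TT t \<xi>) \<le> hs_norm \<xi>"
proof -
  obtain C where C: "\<And>\<eta>. \<eta> \<in> hs \<Longrightarrow> hs_norm (TT t \<eta>) \<le> C * hs_norm \<eta>"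
    using extension t unfolding hs_extension_def by blast
  let ?d = "\<lambda>K m n. \<xi> m n - hs_trunc \<xi> K m n"
  have le: "hs_norm (TT t \<xi>) \<le> hs_norm \<xi> + C * hs_norm (?d K)" for K
  proof -
    obtain D x where x: "form_bd D x" "hs_trunc \<xi> K = iota nu x" using hs_trunc_iota .
    have tr: "hs_trunc \<xi> K \<in> hs" "hs_norm (hs_trunc \<xi> K) \<le> hs_norm \<xi>"
      using hs_norm_trunc[of \<xi> K] hsn_le_hs_norm[OF \<xi>, of K] by auto
    have "TT t \<xi> = (\<lambda>m n. TT t (hs_trunc \<xi> K) m n + 1 * TT t (?d K) m n)"
      by (subst hs_split_trunc[of \<xi> K]) (intro TT_add_mult t tr hs_rest \<xi>)
    then have "hs_norm (TT t \<xi>) \<le> hs_norm (TT t (hs_trunc \<xi> K)) + cmod 1 * hs_norm (TT t (?d K))"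
      using hs_add_mult(2)[OF TT_hs[OF t tr(1)] TT_hs[OF t hs_rest[OF \<xi>]], of 1] by simp
    also have "\<dots> \<le> hs_norm \<xi> + C * hs_norm (?d K)"
    proof (rule add_mono)
      show "hs_norm (TT t (hs_trunc \<xi> K)) \<le> hs_norm \<xi>"
        using T_contraction[OF x(1) t] tr(2) by (simp add: x(2) TT_iota[OF t x(1)])
      show "cmod 1 * hs_norm (TT t (?d K)) \<le> C * hs_norm (?d K)"
        using C[OF hs_rest[OF \<xi>], of K] by simp
    qed
    finally show ?thesis .
  qed
  have "(\<lambda>K. hs_norm \<xi> + C * hs_norm (?d K)) \<longlonglongrightarrow> hs_norm \<xi> + C * 0"
    by (intro tendsto_intros hs_trunc_tendsto \<xi>)
  then have "(\<lambda>K. hs_norm \<xi> + C * hs_norm (?d K)) \<longlonglongrightarrow> hs_norm \<xi>" by simp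
  then show ?thesis by (rule LIMSEQ_le_const) (use le in blast)
qed

section \<open>Identification of the generator, entry by entry\<close>

definition hgen :: "mat \<Rightarrow> mat" where
  "hgen \<xi> = iota nu (gen (unweight \<xi>))"

lemma hgen_iota: "hgen (iota nu x) = iota nu (gen x)"
  by (simp add: hgen_def unweight_iota)

lemma hgen_local:
  assumes "\<xi> m n = \<eta> m n" "\<xi> (m - 1) (n - 1) = \<eta> (m - 1) (n - 1)" "\<xi> (Suc m) (Suc n) = \<eta> (Suc m) (Suc n)"
  shows "hgen \<xi> m n = hgen \<eta> m n"
  using assms by (simp add: hgen_def iota_def gen_def jump_def unweight_def)

text \<open>For fixed (m, n) just three entries are read, each at most the norm; the constant
  depends on m and n.\<close>

lemma hgen_bound: "\<exists>B\<ge>0. \<forall>\<xi>\<in>hs. cmod (hgen \<xi> m n) \<le> B * hs_norm \<xi>"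
proof (intro exI conjI ballI)
  let ?B = "rho m * rho n * (cmod (rate m n) / (rho m * rho n)
      + (down m n / (rho (m - 1) * rho (n - 1)) + up m n / (rho (Suc m) * rho (Suc n))))"
  have nn: "0 \<le> rho i" for i using rho_pos[of i] by simp
  show "0 \<le> ?B" by (intro mult_nonneg_nonneg add_nonneg_nonneg divide_nonneg_nonneg nn) auto
  fix \<xi> assume \<xi>: "\<xi> \<in> hs"
  have u: "cmod (unweight \<xi> i j) \<le> hs_norm \<xi> / (rho i * rho j)" for i j
    using hs_entry_le[OF \<xi>, of i j] rho_pos[of i] rho_pos[of j]
    by (simp add: unweight_def norm_divide divide_right_mono norm_mult)
  have "cmod (gen (unweight \<xi>) m n) \<le> cmod (rate m n) * cmod (unweight \<xi> m n)
      + (down m n * cmod (unweight \<xi> (m - 1) (n - 1)) + up m n * cmod (unweight \<xi> (Suc m) (Suc n)))"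
    unfolding gen_def jump_def by (intro norm_triangle_mono) (auto simp: norm_mult)
  also have "\<dots> \<le> cmod (rate m n) * (hs_norm \<xi> / (rho m * rho n))
      + (down m n * (hs_norm \<xi> / (rho (m - 1) * rho (n - 1))) + up m n * (hs_norm \<xi> / (rho (Suc m) * rho (Suc n))))"
    by (intro add_mono mult_left_mono u) auto
  finally have "cmod (hgen \<xi> m n) \<le> rho m * rho n * (cmod (rate m n) * (hs_norm \<xi> / (rho m * rho n))
      + (down m n * (hs_norm \<xi> / (rho (m - 1) * rho (n - 1))) + up m n * (hs_norm \<xi> / (rho (Suc m) * rho (Suc n)))))"
    unfolding hgen_def norm_iota using nn by (intro mult_left_mono) auto
  also have "x * (c * (h / a) + (d * (h / a1) + u * (h / a2))) = x * (c / a + (d / a1 + u / a2)) * h"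
    for x c h a d a1 u a2 :: real
    by (simp add: algebra_simps)
  finally show "cmod (hgen \<xi> m n) \<le> ?B * hs_norm \<xi>" .
qed

text \<open>The mean value inequality along a trajectory of norm at most that of its start, carried
  from finite corners to \<open>hs\<close> by contractivity. Being linear in \<open>t\<close> and in
  the norm, it controls the difference quotient of a tail uniformly in \<open>t\<close>.\<close>

lemma TT_increment_bound:
  assumes B: "\<forall>\<xi>\<in>hs. cmod (hgen \<xi> m n) \<le> B * hs_norm \<xi>" "0 \<le> B" and \<xi>: "\<xi> \<in> hs" and t: "0 \<le> t"
  shows "cmod (TT t \<xi> m n - \<xi> m n) \<le> B * hs_norm \<xi> * t"
proof -
  have bdd: "cmod (TT t (iota nu x) m n - iota nu x m n) \<le> B * hs_norm (iota nu x) * t"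
    if x: "form_bd C x" for C x
  proof -
    have der: "((\<lambda>s. iota nu (T s x) m n) has_vector_derivative hgen (iota nu (T s x)) m n) (at s within {0..t})"
      if "s \<in> {0..t}" for s
      unfolding hgen_iota unfolding iota_def
      by (intro has_vector_derivative_mult_left has_vector_derivative_mult_right T_ode[OF x] that)
    have "cmod (iota nu (T t x) m n - iota nu (T 0 x) m n) \<le> B * hs_norm (iota nu x) * t"
    proof (rule norm_diff_le_of_vector_derivative[OF der _ t])
      fix s assume s: "s \<in> {0..t}"
      then have "iota nu (T s x) \<in> hs"
        by (intro iota_bounded_hs[of _ "6 * C"] T_entry_le[OF x]) auto
      then have "cmod (hgen (iota nu (T s x)) m n) \<le> B * hs_norm (iota nu (T s x))" using B by blast
      also have "\<dots> \<le> B * hs_norm (iota nu x)" using T_contraction[OF x] B s by (intro mult_left_mono) auto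
      finally show "cmod (hgen (iota nu (T s x)) m n) \<le> B * hs_norm (iota nu x)" .
    qed
    then show ?thesis by (simp add: TT_iota[OF t x] T_zero[OF x])
  qed
  let ?d = "\<lambda>K m n. \<xi> m n - hs_trunc \<xi> K m n"
  have le: "cmod (TT t \<xi> m n - \<xi> m n) \<le> B * hs_norm \<xi> * t + 2 * hs_norm (?d K)" for K
  proof -
    obtain D x where x: "form_bd D x" "hs_trunc \<xi> K = iota nu x" using hs_trunc_iota .
    have tr: "hs_trunc \<xi> K \<in> hs" "hs_norm (hs_trunc \<xi> K) \<le> hs_norm \<xi>"
      using hs_norm_trunc[of \<xi> K] hsn_le_hs_norm[OF \<xi>, of K] by auto
    have "TT t \<xi> = (\<lambda>m n. TT t (hs_trunc \<xi> K) m n + 1 * TT t (?d K) m n)"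
      by (subst hs_split_trunc[of \<xi> K]) (intro TT_add_mult t tr hs_rest \<xi>)
    then have "cmod (TT t \<xi> m n - \<xi> m n) = cmod ((TT t (hs_trunc \<xi> K) m n - hs_trunc \<xi> K m n)
        + (TT t (?d K) m n - ?d K m n))" by (simp add: algebra_simps)
    also have "\<dots> \<le> cmod (TT t (hs_trunc \<xi> K) m n - hs_trunc \<xi> K m n)
        + (cmod (TT t (?d K) m n) + cmod (?d K m n))"
      by (intro norm_triangle_mono norm_triangle_ineq4) simp
    also have "\<dots> \<le> B * hs_norm \<xi> * t + (hs_norm (?d K) + hs_norm (?d K))"
    proof (intro add_mono)
      have "B * hs_norm (hs_trunc \<xi> K) * t \<le> B * hs_norm \<xi> * t"
        using B t tr by (intro mult_right_mono mult_left_mono) auto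
      with bdd[OF x(1)] show "cmod (TT t (hs_trunc \<xi> K) m n - hs_trunc \<xi> K m n) \<le> B * hs_norm \<xi> * t"
        unfolding x(2) by linarith
      show "cmod (TT t (?d K) m n) \<le> hs_norm (?d K)"
        using hs_entry_le[OF TT_hs[OF t hs_rest[OF \<xi>]]] TT_contraction[OF hs_rest[OF \<xi>] t]
        by (rule order_trans)
      show "cmod (?d K m n) \<le> hs_norm (?d K)" by (rule hs_entry_le[OF hs_rest[OF \<xi>]])
    qed
    finally show ?thesis by simp
  qed
  have "(\<lambda>K. B * hs_norm \<xi> * t + 2 * hs_norm (?d K)) \<longlonglongrightarrow> B * hs_norm \<xi> * t + 2 * 0"
    by (intro tendsto_intros hs_trunc_tendsto \<xi>)
  then have "(\<lambda>K. B * hs_norm \<xi> * t + 2 * hs_norm (?d K)) \<longlonglongrightarrow> B * hs_norm \<xi> * t" by simp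
  then show ?thesis by (rule LIMSEQ_le_const) (use le in blast)
qed

lemma T_quotient_tendsto:
  assumes "form_bd C x"
  shows "((\<lambda>t. (T t x m n - x m n) / complex_of_real t) \<longlongrightarrow> gen x m n) (at_right 0)"
  using has_vector_derivative_at_right_quotient[OF T_ode[OF assms, of 0 1 m n]]
  by (simp add: T_zero[OF assms])

text \<open>Entrywise differentiability at 0 holds for every element of \<open>hs\<close>, in the
  domain or not. It is reduced to a bounded corner, the tail being handled by
  \<open>TT_increment_bound\<close>.\<close>

lemma TT_quotient_tendsto:
  assumes \<xi>: "\<xi> \<in> hs"
  shows "((\<lambda>t. (TT t \<xi> m n - \<xi> m n) / complex_of_real t) \<longlongrightarrow> hgen \<xi> m n) (at_right 0)"
proof (rule tendstoI)
  fix e :: real assume e: "0 < e"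
  obtain B where B: "0 \<le> B" "\<forall>\<xi>\<in>hs. cmod (hgen \<xi> m n) \<le> B * hs_norm \<xi>" using hgen_bound by blast
  let ?d = "\<lambda>K m n. \<xi> m n - hs_trunc \<xi> K m n"
  have "(\<lambda>K. B * hs_norm (?d K)) \<longlonglongrightarrow> B * 0"
    by (intro tendsto_intros hs_trunc_tendsto \<xi>)
  then have "\<forall>\<^sub>F K in sequentially. B * hs_norm (?d K) < e / 2"
    using e by (intro order_tendstoD) auto
  then have "\<forall>\<^sub>F K in sequentially. B * hs_norm (?d K) < e / 2 \<and> Suc m < K \<and> Suc n < K"
    by (intro eventually_conj eventually_gt_at_top)
  \<comment> \<open>The corner has to contain (m + 1, n + 1), the furthest entry that
    \<open>hgen\<close> reads at (m, n).\<close>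
  then obtain K where K: "B * hs_norm (?d K) < e / 2" "Suc m < K" "Suc n < K"
    unfolding eventually_sequentially by blast
  obtain D x where x: "form_bd D x" "hs_trunc \<xi> K = iota nu x" using hs_trunc_iota .
  have h: "hgen \<xi> m n = iota nu (gen x) m n"
    unfolding hgen_iota[symmetric] x(2)[symmetric] using K
    by (intro hgen_local) (auto simp: hs_trunc_def)
  have "((\<lambda>t. complex_of_real (rho m) * ((T t x m n - x m n) / complex_of_real t) * complex_of_real (rho n))
      \<longlongrightarrow> complex_of_real (rho m) * gen x m n * complex_of_real (rho n)) (at_right 0)"
    by (intro tendsto_intros T_quotient_tendsto[OF x(1)])
  then have "((\<lambda>t. (iota nu (T t x) m n - iota nu x m n) / complex_of_real t) \<longlongrightarrow> hgen \<xi> m n) (at_right 0)"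
    by (simp add: h iota_def algebra_simps diff_divide_distrib)
  then have "\<forall>\<^sub>F t in at_right 0. dist ((iota nu (T t x) m n - iota nu x m n) / complex_of_real t) (hgen \<xi> m n) < e / 2"
    using e by (intro tendstoD) auto
  then show "\<forall>\<^sub>F t in at_right 0. dist ((TT t \<xi> m n - \<xi> m n) / complex_of_real t) (hgen \<xi> m n) < e"
    using eventually_at_right_less[of "0::real"]
  proof eventually_elim
    case (elim t)
    have t: "0 \<le> t" using elim by simp
    have tr: "hs_trunc \<xi> K \<in> hs" by (rule hs_norm_trunc)
    have "TT t \<xi> = (\<lambda>m n. TT t (hs_trunc \<xi> K) m n + 1 * TT t (?d K) m n)"
      by (subst hs_split_trunc[of \<xi> K]) (intro TT_add_mult t tr hs_rest \<xi>)
    then have eq: "(TT t \<xi> m n - \<xi> m n) / complex_of_real t - hgen \<xi> m n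
        = ((iota nu (T t x) m n - iota nu x m n) / complex_of_real t - hgen \<xi> m n)
          + (TT t (?d K) m n - ?d K m n) / complex_of_real t"
      using elim by (simp add: x(2) TT_iota[OF t x(1)] field_simps)
    have "cmod (TT t (?d K) m n - ?d K m n) \<le> B * hs_norm (?d K) * t"
      by (rule TT_increment_bound[OF B(2,1) hs_rest[OF \<xi>] t])
    then have "cmod ((TT t (?d K) m n - ?d K m n) / complex_of_real t) \<le> B * hs_norm (?d K)"
      using elim by (simp add: norm_divide field_simps)
    then show ?case
      using elim K(1) norm_triangle_ineq[of "(iota nu (T t x) m n - iota nu x m n) / complex_of_real t - hgen \<xi> m n"
          "(TT t (?d K) m n - ?d K m n) / complex_of_real t"]
      unfolding dist_norm eq by linarith
  qed
qed

text \<open>Norm convergence forces convergence of each entry, and that limit is known. Hence the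
  value of the generator is unique and the choice made in \<open>genL\<close> is determined.\<close>

lemma gen_has_eq_hgen:
  assumes "\<xi> \<in> hs" "gen_has TT \<xi> \<eta>" shows "\<eta> = hgen \<xi>"
proof (intro ext)
  fix m n
  show "\<eta> m n = hgen \<xi> m n"
    using gen_has_entry_tendsto[of TT \<xi> \<eta> m n, OF TT_hs[OF _ assms(1)] assms] TT_quotient_tendsto[OF assms(1)]
    by (rule tendsto_unique[OF trivial_limit_at_right_real])
qed

lemma genL_gen_has: "\<xi> \<in> genD TT \<Longrightarrow> gen_has TT \<xi> (genL TT \<xi>)"
  using someI_ex[of "gen_has TT \<xi>"] by (simp add: genD_def genL_def)

lemma genL_eq_hgen: "\<xi> \<in> genD TT \<Longrightarrow> genL TT \<xi> = hgen \<xi>"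
  using gen_has_eq_hgen[OF _ genL_gen_has] by (simp add: genD_def)

text \<open>This is the lower bound that makes the infimum in \<open>spectral_gap\<close>
  meaningful.\<close>

lemma dirichlet_nonneg:
  assumes "\<xi> \<in> genD TT" shows "0 \<le> dirichlet TT \<xi>"
proof -
  have "\<xi> \<in> hs" using assms by (simp add: genD_def)
  then have "Re (hs_inner \<xi> (genL TT \<xi>)) \<le> 0"
    by (intro gen_has_dissipative[OF TT_hs TT_contraction _ genL_gen_has[OF assms]])
  then show ?thesis by (simp add: dirichlet_def)
qed

end

section \<open>The test vector\<close>

context birth_death_hs
begin

text \<open>The difference of both sides is a bounded solution of the evolution equation with zero
  initial value, so its energy vanishes.\<close>

lemma T_minus_id_eq_integral:
  assumes x: "form_bd C x" and y: "form_bd D y" and gen: "gen x = y" and b: "0 \<le> b"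
  shows "T b x m n - x m n = integral {0..b} (\<lambda>s. T s y m n)"
proof -
  define I where "I t m n = integral {0..t} (\<lambda>s. T s y m n)" for t m n
  define X where "X t = (\<lambda>m n. (T t x m n - x m n) - I t m n)" for t
  have Tc: "continuous_on {0..t} (\<lambda>s. T s y m n)" for t m n
    by (rule continuous_on_vector_derivative[OF T_ode[OF y]])
  have Ih: "((\<lambda>s. T s y m n) has_integral I t m n) {0..t}" for t m n
    unfolding I_def by (intro integrable_integral integrable_continuous_interval Tc)
  \<comment> \<open>An entry of \<open>gen\<close> is a finite combination, so it commutes with the
    integral; the integrand is then the time derivative of \<open>T s y\<close>.\<close>
  have genI: "gen (I t) m n = T t y m n - y m n" if "0 \<le> t" for t m n
  proof (rule has_integral_unique)
    show "((\<lambda>s. gen (T s y) m n) has_integral gen (I t) m n) {0..t}"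
      unfolding gen_def jump_def by (intro has_integral_add has_integral_mult_right Ih)
    show "((\<lambda>s. gen (T s y) m n) has_integral (T t y m n - y m n)) {0..t}"
      using fundamental_theorem_of_calculus[OF that T_ode[OF y]] by (simp add: T_zero[OF y])
  qed
  have ode: "((\<lambda>t. X t m n) has_vector_derivative gen (X t) m n) (at t within {0..b})"
    if t: "t \<in> {0..b}" for t m n
  proof -
    have "((\<lambda>t. X t m n) has_vector_derivative (gen (T t x) m n - 0) - T t y m n) (at t within {0..b})"
      unfolding X_def I_def
      by (intro has_vector_derivative_diff has_vector_derivative_const T_ode[OF x t]
          integral_has_vector_derivative Tc t)
    moreover have "gen (X t) m n = gen (T t x) m n - gen x m n - gen (I t) m n"
      by (simp add: gen_def jump_def X_def algebra_simps)
    ultimately show ?thesis using t by (simp add: genI gen)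
  qed
  have Ib: "cmod (I t m n) \<le> 6 * D * t" if "0 \<le> t" for t m n
    using has_integral_bound_real[of "6 * D" "{}", OF _ _ Ih[of m n t]] T_entry_le[OF y] form_bd_nonneg[OF y] that
    by simp
  have "energy (Suc (max m n)) (X b) \<le> 0"
  proof (rule energy_bound[OF ode _ _ b])
    fix t m n assume t: "t \<in> {0..b}"
    have "cmod (X t m n) \<le> (6 * C + C) + 6 * D * t"
      unfolding X_def using t Ib[of t m n] T_entry_le[OF x, of t m n] form_bd_entry[OF x, of m n]
      by (intro order_trans[OF norm_triangle_ineq4] add_mono) auto
    also have "\<dots> \<le> (6 * C + C) + 6 * D * b"
      using t form_bd_nonneg[OF y] by (simp add: mult_left_mono)
    finally show "cmod (X t m n) \<le> (6 * C + C) + 6 * D * b" .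
  next
    show "energy K (X 0) \<le> 0" for K
      by (simp add: X_def I_def T_zero[OF x] energy_def)
  qed
  moreover have "wt m n * (cmod (X b m n))\<^sup>2 \<le> energy (Suc (max m n)) (X b)"
  proof -
    have nn: "0 \<le> wt i j * (cmod (X b i j))\<^sup>2" for i j using wt_pos[of i j] by simp
    have "wt m n * (cmod (X b m n))\<^sup>2 \<le> (\<Sum>j<Suc (max m n). wt m j * (cmod (X b m j))\<^sup>2)"
      by (rule member_le_sum) (use nn in auto)
    also have "\<dots> \<le> energy (Suc (max m n)) (X b)"
      unfolding energy_def
      by (rule member_le_sum[of m _ "\<lambda>i. \<Sum>j<Suc (max m n). wt i j * (cmod (X b i j))\<^sup>2"])
        (use nn in \<open>auto intro!: sum_nonneg simp del: sum.lessThan_Suc\<close>)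
    finally show ?thesis .
  qed
  ultimately have "wt m n * (cmod (X b m n))\<^sup>2 \<le> 0" by linarith
  then have "X b m n = 0" using wt_pos[of m n] by (simp add: mult_le_0_iff)
  then show ?thesis by (simp add: X_def I_def)
qed

text \<open>The integral formula bounds all entries of the difference quotient by 6 D at once. With
  entrywise convergence, \<open>bounded_iota_tendsto_0\<close> upgrades this to norm
  convergence.\<close>

lemma gen_has_iota:
  assumes x: "form_bd C x" and y: "form_bd D y" and gen: "gen x = y"
  shows "gen_has TT (iota nu x) (iota nu y)"
proof -
  define Z where "Z t = (\<lambda>m n. (T t x m n - x m n) / complex_of_real t - y m n)" for t
  have "((\<lambda>t. hs_norm (iota nu (Z t))) \<longlongrightarrow> 0) (at_right 0)"
  proof (rule bounded_iota_tendsto_0)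
    show "\<forall>\<^sub>F t in at_right 0. \<forall>m n. cmod (Z t m n) \<le> 6 * D + D"
      using eventually_at_right_less[of "0::real"]
    proof eventually_elim
      case (elim t)
      show ?case
      proof (intro allI)
        fix m n
        have "cmod (T t x m n - x m n) \<le> 6 * D * (t - 0)"
        proof -
          have "((\<lambda>s. T s y m n) has_integral (T t x m n - x m n)) {0..t}"
            unfolding T_minus_id_eq_integral[OF x y gen less_imp_le[OF elim]]
            by (intro integrable_integral integrable_continuous_interval
                continuous_on_vector_derivative[OF T_ode[OF y]])
          from has_integral_bound_real[of "6 * D" "{}", OF _ _ this] show ?thesis
            using T_entry_le[OF y] form_bd_nonneg[OF y] elim by simp
        qed
        then have "cmod ((T t x m n - x m n) / complex_of_real t) \<le> 6 * D"
          using elim by (simp add: norm_divide field_simps)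
        then show "cmod (Z t m n) \<le> 6 * D + D"
          unfolding Z_def using form_bd_entry[OF y, of m n]
          by (intro order_trans[OF norm_triangle_ineq4] add_mono) auto
      qed
    qed
    show "((\<lambda>t. Z t m n) \<longlongrightarrow> 0) (at_right 0)" for m n
      unfolding Z_def using T_quotient_tendsto[OF x, of m n] gen by (simp add: LIM_zero)
  qed
  moreover have "\<forall>\<^sub>F t in at_right 0. hs_norm (iota nu (Z t))
      = hs_norm (\<lambda>m n. (TT t (iota nu x) m n - iota nu x m n) / complex_of_real t - iota nu y m n)"
    using eventually_at_right_less[of "0::real"]
  proof eventually_elim
    case (elim t)
    have "TT t (iota nu x) = iota nu (T t x)" using elim by (intro TT_iota[OF _ x]) auto
    then show ?case
      by (simp only:) (simp add: Z_def iota_def algebra_simps diff_divide_distrib)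
  qed
  ultimately have "((\<lambda>t. hs_norm (\<lambda>m n. (TT t (iota nu x) m n - iota nu x m n) / complex_of_real t
      - iota nu y m n)) \<longlongrightarrow> 0) (at_right 0)"
    by (rule Lim_transform_eventually)
  moreover have "iota nu y \<in> hs" by (rule iota_bounded_hs) (rule form_bd_entry[OF y])
  ultimately show ?thesis by (simp add: gen_has_def)
qed

text \<open>No current flows below state 0, so stationarity there equates the first two unweighted
  entries, and the three-term recursion propagates equality. Thus on the diagonal the kernel sees
  only multiples of rho^(1/2).\<close>

lemma genKer_diagonal:
  assumes "\<eta> \<in> genKer TT"
  shows "\<eta> n n = unweight \<eta> 0 0 * complex_of_real ((rho n)\<^sup>2)"
proof -
  have "hgen \<eta> = (\<lambda>m n. 0)"
    using assms genL_eq_hgen[of \<eta>] by (simp add: genKer_def)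
  then have "iota nu (gen (unweight \<eta>)) m n = 0" for m n
    unfolding hgen_def by (rule fun_cong[OF fun_cong])
  then have g: "gen (unweight \<eta>) m n = 0" for m n
    using norm_iota[of "gen (unweight \<eta>)" m n] rho_pos[of m] rho_pos[of n] by simp
  define y where "y n = unweight \<eta> n n" for n
  have "y (Suc n) = y n" for n
  proof (induction n)
    case 0
    have "complex_of_real (up 0 0) * (y (Suc 0) - y 0) = 0"
      using g[of 0 0] by (simp add: gen_def jump_def rate_diagonal y_def algebra_simps)
    moreover have "0 < up 0 0" using r_pos lam_pos by (simp add: up_def omega_def)
    ultimately show ?case by simp
  next
    case (Suc n)
    have "complex_of_real (up (Suc n) (Suc n)) * (y (Suc (Suc n)) - y (Suc n)) = 0"
      using g[of "Suc n" "Suc n"] Suc by (simp add: gen_def jump_def rate_diagonal y_def algebra_simps)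
    moreover have "0 < up (Suc n) (Suc n)" using r_pos lam_pos by (simp add: up_def omega_def)
    ultimately show ?case by simp
  qed
  then have "y n = y 0" by (induction n) simp_all
  moreover have "\<eta> n n = y n * complex_of_real ((rho n)\<^sup>2)"
    using rho_pos[of n] by (simp add: y_def unweight_def power2_eq_square)
  ultimately show ?thesis by (simp add: y_def)
qed

section \<open>Weighted sums and the Rayleigh quotient of the test sequence\<close>

lemma wt_diagonal: "wt n n = (1 - nu\<^sup>2) * nu ^ (2 * n)"
  by (simp add: wt_def mult_2)

lemma hs_inner_diag:
  "hs_inner \<xi> (iota nu (diag d)) = (\<Sum>\<^sub>\<infinity>n. cnj (\<xi> n n) * (complex_of_real ((rho n)\<^sup>2) * d n))"
proof -
  let ?f = "\<lambda>p. cnj (\<xi> (fst p) (snd p)) * iota nu (diag d) (fst p) (snd p)"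
  have "hs_inner \<xi> (iota nu (diag d)) = infsum ?f (range (\<lambda>n. (n, n)))"
    unfolding hs_inner_alt by (rule infsum_cong_neutral) (auto simp: iota_def diag_def)
  also have "\<dots> = infsum (?f \<circ> (\<lambda>n. (n, n))) UNIV"
    by (rule infsum_reindex) (auto intro: injI)
  finally show ?thesis by (simp add: o_def iota_def diag_def power2_eq_square mult_ac)
qed

lemma summable_weighted:
  fixes g :: "nat \<Rightarrow> real"
  assumes "\<And>n. \<bar>g n\<bar> \<le> M"
  shows "summable (\<lambda>n. norm (g n * nu ^ (2 * n)))"
proof (rule summable_comparison_test)
  show "summable (\<lambda>n. M * (nu\<^sup>2) ^ n)"
    using nu_squared_less_1 by (intro summable_mult summable_geometric) simp
  have "norm (norm (g n * nu ^ (2 * n))) \<le> M * (nu\<^sup>2) ^ n" for n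
    using assms[of n] nu_bounds by (simp add: abs_mult power_mult mult_right_mono)
  then show "\<exists>N. \<forall>n\<ge>N. norm (norm (g n * nu ^ (2 * n))) \<le> M * (nu\<^sup>2) ^ n" by blast
qed

lemma infsum_weighted:
  fixes g :: "nat \<Rightarrow> real"
  assumes "\<And>n. \<bar>g n\<bar> \<le> M"
  shows "(\<Sum>\<^sub>\<infinity>n. complex_of_real (wt n n * g n)) = complex_of_real ((1 - nu\<^sup>2) * (\<Sum>n. g n * nu ^ (2 * n)))"
proof -
  have s: "summable (\<lambda>n. norm (g n * nu ^ (2 * n)))" by (rule summable_weighted[OF assms])
  have "((\<lambda>n. g n * nu ^ (2 * n)) has_sum (\<Sum>n. g n * nu ^ (2 * n))) UNIV"
    by (rule norm_summable_imp_has_sum[OF s summable_sums[OF summable_norm_cancel[OF s]]])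
  then have "((\<lambda>n. (1 - nu\<^sup>2) * (g n * nu ^ (2 * n))) has_sum (1 - nu\<^sup>2) * (\<Sum>n. g n * nu ^ (2 * n))) UNIV"
    by (rule has_sum_cmult_right)
  then have "((\<lambda>n. complex_of_real ((1 - nu\<^sup>2) * (g n * nu ^ (2 * n)))) has_sum
      complex_of_real ((1 - nu\<^sup>2) * (\<Sum>n. g n * nu ^ (2 * n)))) UNIV"
    by (rule has_sum_of_real)
  from infsumI[OF this] show ?thesis by (simp add: wt_diagonal mult_ac)
qed

abbreviation cc :: real where "cc \<equiv> cnr nu r"

text \<open>The difference of 1/(n + r) and 1/(n + 1 + r) is 1/((n + r)(n + 1 + r)), whose first
  factor cancels n + r in the upward rate (n + 1)(n + r). So the generator maps this sequence to a
  bounded one although the rates grow quadratically. The constant \<open>cc\<close> is its mean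
  under the stationary weights.\<close>

definition test :: "nat \<Rightarrow> real" where
  "test n = 1 / (real n + r) - cc"

definition test_gen :: "nat \<Rightarrow> real" where
  "test_gen n = mu\<^sup>2 * (real n / (real n + r)) - lam\<^sup>2 * (real (Suc n) / (real (Suc n) + r))"

definition den :: real where "den = (\<Sum>j. (1 / (real j + r) - cc)\<^sup>2 * nu ^ (2 * j))"

definition num :: real where
  "num = (\<Sum>j. (real j + 1) / ((real j + r + 1)\<^sup>2 * (real j + r)) * nu ^ (2 * j))"

lemma inverse_shift_bound: "\<bar>1 / (real n + r)\<bar> \<le> 1 / r"
  using r_pos by (simp add: frac_le)

lemma test_bound: "\<bar>test n\<bar> \<le> 1 / r + \<bar>cc\<bar>"
  using inverse_shift_bound[of n] unfolding test_def by linarith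

lemma quotient_bound: "\<bar>real n / (real n + r)\<bar> \<le> 1"
  using r_pos by simp

lemma test_gen_bound: "\<bar>test_gen n\<bar> \<le> mu\<^sup>2 + lam\<^sup>2"
proof -
  have "\<bar>a\<^sup>2 * (real i / (real i + r))\<bar> \<le> a\<^sup>2 * 1" for a i
    unfolding abs_mult abs_power2 by (intro mult_left_mono quotient_bound) simp
  from this[of mu n] this[of lam "Suc n"]
  show ?thesis unfolding test_gen_def by linarith
qed

lemma gen_test:
  "gen (diag (\<lambda>n. complex_of_real (k * test n))) = diag (\<lambda>n. complex_of_real (k * test_gen n))"
proof (intro ext)
  fix m n
  show "gen (diag (\<lambda>n. complex_of_real (k * test n))) m n = diag (\<lambda>n. complex_of_real (k * test_gen n)) m n"
  proof (cases "m = n")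
    case False
    then show ?thesis
      by (cases m; cases n) (auto simp: gen_def jump_def diag_def)
  next
    case True
    have up: "up n n * (test (Suc n) - test n) = - lam\<^sup>2 * (real (Suc n) / (real (Suc n) + r))" for n
    proof -
      have "real n + r \<noteq> 0" "real n + 1 + r \<noteq> 0" using r_pos by auto
      then have "1 / (real n + 1 + r) - 1 / (real n + r) = - 1 / ((real n + r) * (real n + 1 + r))"
        by (simp add: field_simps)
      moreover have "test (Suc n) - test n = 1 / (real n + 1 + r) - 1 / (real n + r)"
        by (simp add: test_def add.commute)
      moreover have "up n n = lam\<^sup>2 * om (Suc n)" by (simp add: up_def)
      moreover have "om (Suc n) = (real n + 1) * (real n + r)" by (simp add: omega_def add.commute)
      ultimately have "up n n * (test (Suc n) - test n) = lam\<^sup>2 * ((real n + 1) * (real n + r)) * (- 1 / ((real n + r) * (real n + 1 + r)))"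
        by presburger
      also have "\<dots> = - lam\<^sup>2 * (real (Suc n) / (real (Suc n) + r))"
      proof -
        have "c * (p * a) * (- 1 / (a * b)) = - c * (p / b)" if "a \<noteq> 0" for a b c p :: real
          using that by simp
        from this[OF \<open>real n + r \<noteq> 0\<close>] show ?thesis by (simp add: add.commute)
      qed
      finally show ?thesis .
    qed
    \<comment> \<open>The rate down from j + 1 and the rate up from j share
      \<open>om (Suc j)\<close>, so the downward term is read off from \<open>up\<close>.\<close>
    have down: "down n n * (test (n - 1) - test n) = mu\<^sup>2 * (real n / (real n + r))"
    proof (cases n)
      case (Suc j)
      have "lam\<^sup>2 * down (Suc j) (Suc j) = mu\<^sup>2 * up j j" by (simp add: up_def down_def)
      moreover have "lam\<^sup>2 * (down n n * (test (n - 1) - test n))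
          = (lam\<^sup>2 * down (Suc j) (Suc j)) * (test j - test (Suc j))"
        by (simp add: Suc)
      ultimately have "lam\<^sup>2 * (down n n * (test (n - 1) - test n))
          = (mu\<^sup>2 * up j j) * (test j - test (Suc j))"
        by (simp only:)
      also have "\<dots> = - mu\<^sup>2 * (up j j * (test (Suc j) - test j))"
        by (simp add: algebra_simps)
      also have "\<dots> = lam\<^sup>2 * (mu\<^sup>2 * (real n / (real n + r)))"
        unfolding up by (simp add: Suc)
      finally show ?thesis using lam_pos by (simp only: mult_cancel_left) simp
    qed simp
    have "gen (diag (\<lambda>n. complex_of_real (k * test n))) n n
        = complex_of_real (k * (down n n * (test (n - 1) - test n) + up n n * (test (Suc n) - test n)))"
      by (cases n) (simp_all add: gen_def jump_def diag_def rate_diagonal algebra_simps)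
    also have "down n n * (test (n - 1) - test n) + up n n * (test (Suc n) - test n) = test_gen n"
      unfolding up down test_gen_def by simp
    finally show ?thesis using True by (simp add: diag_def)
  qed
qed

lemma nu_geometric: "(\<Sum>n. nu ^ (2 * n)) = 1 / (1 - nu\<^sup>2)" "summable (\<lambda>n. nu ^ (2 * n))"
  using nu_squared_less_1 by (simp_all add: power_mult suminf_geometric summable_geometric)

lemma summable_inverse: "summable (\<lambda>n. nu ^ (2 * n) / (real n + r))"
  using summable_norm_cancel[OF summable_weighted[OF inverse_shift_bound]] by simp

lemma test_mean: "(\<Sum>n. test n * nu ^ (2 * n)) = 0"
proof -
  have "(\<Sum>n. test n * nu ^ (2 * n)) = (\<Sum>n. nu ^ (2 * n) / (real n + r) - cc * nu ^ (2 * n))"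
    by (simp add: test_def algebra_simps)
  also have "\<dots> = (\<Sum>n. nu ^ (2 * n) / (real n + r)) - (\<Sum>n. cc * nu ^ (2 * n))"
    by (intro suminf_diff[symmetric] summable_inverse summable_mult nu_geometric)
  also have "(\<Sum>n. cc * nu ^ (2 * n)) = cc * (1 / (1 - nu\<^sup>2))"
    using suminf_mult[OF nu_geometric(2)] nu_geometric(1) by simp
  also have "\<dots> = (\<Sum>n. nu ^ (2 * n) / (real n + r))"
    using nu_squared_less_1 by (simp add: cnr_def)
  finally show ?thesis by simp
qed

text \<open>Since p 0 = 0, the sum with mu^2 may be shifted by one; the resulting nu^2 turns mu^2
  into lam^2. Both sums then merge into the increment of \<open>test\<close> times
  \<open>p (Suc n)\<close>, which is minus a summand of \<open>num\<close>.\<close>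

lemma test_gen_energy: "(\<Sum>n. test n * test_gen n * nu ^ (2 * n)) = - lam\<^sup>2 * num"
proof -
  define p where "p n = real n / (real n + r)" for n
  have pt: "\<bar>test n * p i\<bar> \<le> (1 / r + \<bar>cc\<bar>) * 1" for n i
    unfolding abs_mult p_def by (intro mult_mono test_bound quotient_bound) (use r_pos in auto)
  have s: "summable (\<lambda>n. (test n * p n) * nu ^ (2 * n))" "summable (\<lambda>n. (test n * p (Suc n)) * nu ^ (2 * n))"
    "summable (\<lambda>n. (test (Suc n) * p (Suc n)) * nu ^ (2 * n))"
    by (rule summable_norm_cancel[OF summable_weighted[OF pt]])+
  have "(\<Sum>n. test n * test_gen n * nu ^ (2 * n))
      = (\<Sum>n. mu\<^sup>2 * ((test n * p n) * nu ^ (2 * n)) - lam\<^sup>2 * ((test n * p (Suc n)) * nu ^ (2 * n)))"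
    by (intro suminf_cong) (simp add: test_gen_def p_def algebra_simps)
  also have "\<dots> = mu\<^sup>2 * (\<Sum>n. (test n * p n) * nu ^ (2 * n)) - lam\<^sup>2 * (\<Sum>n. (test n * p (Suc n)) * nu ^ (2 * n))"
    using s by (simp add: suminf_diff[symmetric] suminf_mult summable_mult)
  also have "(\<Sum>n. (test n * p n) * nu ^ (2 * n)) = (\<Sum>n. (test (Suc n) * p (Suc n)) * nu ^ (2 * Suc n))"
    using suminf_split_head[OF s(1)] by (simp add: p_def)
  also have "\<dots> = nu\<^sup>2 * (\<Sum>n. (test (Suc n) * p (Suc n)) * nu ^ (2 * n))"
    using suminf_mult[OF s(3), of "nu\<^sup>2"] by (simp add: power2_eq_square mult_ac)
  also have "mu\<^sup>2 * \<dots> = lam\<^sup>2 * (\<Sum>n. (test (Suc n) * p (Suc n)) * nu ^ (2 * n))"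
    using mu_pos by (simp add: nu_def power_divide)
  also have "\<dots> - lam\<^sup>2 * (\<Sum>n. (test n * p (Suc n)) * nu ^ (2 * n))
      = lam\<^sup>2 * (\<Sum>n. (test (Suc n) * p (Suc n)) * nu ^ (2 * n) - (test n * p (Suc n)) * nu ^ (2 * n))"
    using s by (simp add: suminf_diff[symmetric] right_diff_distrib)
  also have "(\<Sum>n. (test (Suc n) * p (Suc n)) * nu ^ (2 * n) - (test n * p (Suc n)) * nu ^ (2 * n))
      = (\<Sum>j. - ((real j + 1) / ((real j + r + 1)\<^sup>2 * (real j + r)) * nu ^ (2 * j)))"
  proof (rule suminf_cong)
    fix j
    have 1: "real j + r \<noteq> 0" "real j + r + 1 \<noteq> 0" using r_pos by auto
    then have "test (Suc j) - test j = - 1 / ((real j + r) * (real j + r + 1))"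
      by (simp add: test_def field_simps)
    moreover have "p (Suc j) = (real j + 1) / (real j + r + 1)" by (simp add: p_def add_ac)
    ultimately have "(test (Suc j) - test j) * p (Suc j) = - ((real j + 1) / ((real j + r + 1)\<^sup>2 * (real j + r)))"
      by (simp only: power2_eq_square) (simp add: mult_ac)
    then show "(test (Suc j) * p (Suc j)) * nu ^ (2 * j) - (test j * p (Suc j)) * nu ^ (2 * j)
        = - ((real j + 1) / ((real j + r + 1)\<^sup>2 * (real j + r)) * nu ^ (2 * j))"
      by (metis left_diff_distrib mult_minus_left)
  qed
  also have "\<dots> = - num"
    unfolding num_def
  proof (rule suminf_minus)
    have "\<bar>(real j + 1) / ((real j + r + 1)\<^sup>2 * (real j + r))\<bar> \<le> 1 / r" for j
    proof -
      have "(real j + 1) / ((real j + r + 1)\<^sup>2 * (real j + r)) \<le> 1 / r"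
      proof -
        have "(real j + 1) * r \<le> (real j + r + 1)\<^sup>2 * (real j + r)"
          using r_pos by (intro mult_mono) (auto simp: power2_eq_square algebra_simps)
        then show ?thesis using r_pos by (simp add: divide_simps)
      qed
      then show ?thesis using r_pos by simp
    qed
    then show "summable (\<lambda>j. (real j + 1) / ((real j + r + 1)\<^sup>2 * (real j + r)) * nu ^ (2 * j))"
      by (intro summable_norm_cancel[OF summable_weighted])
  qed
  finally show ?thesis by simp
qed

lemma test_squared_bound: "\<bar>(test n)\<^sup>2\<bar> \<le> (1 / r + \<bar>cc\<bar>)\<^sup>2"
  using power_mono[OF test_bound[of n] abs_ge_zero, of 2] by simp

lemma den_alt: "den = (\<Sum>n. (test n)\<^sup>2 * nu ^ (2 * n))" "summable (\<lambda>n. (test n)\<^sup>2 * nu ^ (2 * n))"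
  using summable_norm_cancel[OF summable_weighted[OF test_squared_bound]] by (simp_all add: den_def test_def)

text \<open>The sequence 1/(n + r) takes different values at 0 and 1, so it cannot equal its mean at
  both.\<close>

lemma den_pos: "0 < den"
proof -
  have "test 0 \<noteq> 0 \<or> test 1 \<noteq> 0"
  proof -
    have "1 / (1 + r) < 1 / r" using r_pos by (intro divide_strict_left_mono) auto
    then show ?thesis by (auto simp: test_def)
  qed
  then obtain i where "test i \<noteq> 0" by blast
  then show ?thesis
    unfolding den_alt(1) using nu_bounds
    by (intro suminf_pos2[OF den_alt(2), of i]) auto
qed

definition gap_set :: "real set" where
  "gap_set = {dirichlet TT \<xi> | \<xi>. \<xi> \<in> genD TT \<and> \<xi> \<in> hs_perp (genKer TT) \<and> hs_norm \<xi> = 1}"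

lemma gap_bound_mem_gap_set: "gap_bound lam nu r \<in> gap_set"
proof -
  \<comment> \<open>The squared norm of the embedded test sequence is (1 - nu^2) \<open>den\<close>,
    and \<open>k\<close> normalises it.\<close>
  define k where "k = 1 / sqrt ((1 - nu\<^sup>2) * den)"
  have k2: "k * k * ((1 - nu\<^sup>2) * den) = 1"
  proof -
    define X where "X = (1 - nu\<^sup>2) * den"
    have "0 < X" unfolding X_def using den_pos nu_squared_less_1 by simp
    then show ?thesis unfolding k_def X_def[symmetric] by simp
  qed
  define x where "x = diag (\<lambda>n. complex_of_real (k * test n))"
  define y where "y = diag (\<lambda>n. complex_of_real (k * test_gen n))"
  define \<xi> where "\<xi> = iota nu x"
  have x: "form_bd (\<bar>k\<bar> * (1 / r + \<bar>cc\<bar>)) x"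
    unfolding x_def
    by (rule form_bd_diag) (simp only: norm_of_real abs_mult, intro mult_left_mono test_bound abs_ge_zero)
  have y: "form_bd (\<bar>k\<bar> * (mu\<^sup>2 + lam\<^sup>2)) y"
    unfolding y_def
    by (rule form_bd_diag) (simp only: norm_of_real abs_mult, intro mult_left_mono test_gen_bound abs_ge_zero)
  have g: "gen_has TT \<xi> (iota nu y)"
    unfolding \<xi>_def by (rule gen_has_iota[OF x y]) (simp only: x_def y_def gen_test)
  have hs: "\<xi> \<in> hs" unfolding \<xi>_def by (rule iota_bounded_hs) (rule form_bd_entry[OF x])
  have D: "\<xi> \<in> genD TT" using g hs by (auto simp: genD_def)
  have L: "genL TT \<xi> = iota nu y"
    using genL_eq_hgen[OF D] gen_has_eq_hgen[OF hs g] by simp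
  have \<xi>n: "\<xi> n n = complex_of_real ((rho n)\<^sup>2 * (k * test n))" for n
    by (simp add: \<xi>_def x_def iota_def diag_def power2_eq_square mult_ac)
  have w: "(rho n)\<^sup>2 * (rho n)\<^sup>2 = wt n n" for n
    using rho_mult_squared[of n n] by (simp add: power2_eq_square mult_ac)
  have inner: "hs_inner \<xi> (iota nu (diag (\<lambda>n. complex_of_real (k * h n))))
      = complex_of_real (k * k * ((1 - nu\<^sup>2) * (\<Sum>n. test n * h n * nu ^ (2 * n))))"
    if h: "\<And>n. \<bar>h n\<bar> \<le> M" for h :: "nat \<Rightarrow> real" and M
  proof -
    have th: "\<bar>test n * h n\<bar> \<le> (1 / r + \<bar>cc\<bar>) * M" for n
      unfolding abs_mult by (intro mult_mono test_bound h) (use r_pos in auto)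
    have "hs_inner \<xi> (iota nu (diag (\<lambda>n. complex_of_real (k * h n))))
        = (\<Sum>\<^sub>\<infinity>n. complex_of_real (k * k) * complex_of_real (wt n n * (test n * h n)))"
      unfolding hs_inner_diag
      by (intro infsum_cong) (simp add: \<xi>n w[symmetric] mult_ac)
    also have "\<dots> = complex_of_real (k * k) * (\<Sum>\<^sub>\<infinity>n. complex_of_real (wt n n * (test n * h n)))"
      by (rule infsum_cmult_right')
    also have "\<dots> = complex_of_real (k * k * ((1 - nu\<^sup>2) * (\<Sum>n. test n * h n * nu ^ (2 * n))))"
      unfolding infsum_weighted[OF th] by simp
    finally show ?thesis .
  qed
  have norm: "hs_norm \<xi> = 1"
  proof -
    have "complex_of_real ((hs_norm \<xi>)\<^sup>2) = hs_inner \<xi> (iota nu (diag (\<lambda>n. complex_of_real (k * test n))))"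
      using hs_inner_self[OF hs] by (simp add: \<xi>_def x_def)
    also have "\<dots> = complex_of_real (k * k * ((1 - nu\<^sup>2) * den))"
      unfolding inner[OF test_bound] den_alt by (simp add: power2_eq_square)
    finally have "(hs_norm \<xi>)\<^sup>2 = 1" unfolding k2 of_real_eq_iff .
    then show ?thesis using hs_norm_nonneg[of \<xi>] by (simp add: power2_eq_1_iff)
  qed
  have perp: "\<xi> \<in> hs_perp (genKer TT)"
    unfolding hs_perp_def
  proof (intro CollectI conjI ballI hs)
    fix \<eta> assume \<eta>: "\<eta> \<in> genKer TT"
    have "hs_inner \<eta> \<xi> = (\<Sum>\<^sub>\<infinity>n. (cnj (unweight \<eta> 0 0) * complex_of_real k) * complex_of_real (wt n n * test n))"
      unfolding \<xi>_def x_def hs_inner_diag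
      by (intro infsum_cong) (simp add: genKer_diagonal[OF \<eta>] w[symmetric] mult_ac)
    also have "\<dots> = (cnj (unweight \<eta> 0 0) * complex_of_real k) * (\<Sum>\<^sub>\<infinity>n. complex_of_real (wt n n * test n))"
      by (rule infsum_cmult_right')
    also have "\<dots> = 0" unfolding infsum_weighted[OF test_bound] test_mean by simp
    finally show "hs_inner \<eta> \<xi> = 0" .
  qed
  have "dirichlet TT \<xi> = - (k * k * ((1 - nu\<^sup>2) * (- lam\<^sup>2 * num)))"
    unfolding dirichlet_def L y_def inner[OF test_gen_bound] test_gen_energy Re_complex_of_real ..
  also have "\<dots> = gap_bound lam nu r"
  proof -
    have "k * k * (1 - nu\<^sup>2) = 1 / den" using k2 den_pos by (simp add: field_simps)
    moreover have "- (k * k * ((1 - nu\<^sup>2) * (- lam\<^sup>2 * num))) = (k * k * (1 - nu\<^sup>2)) * (lam\<^sup>2 * num)"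
      by simp
    ultimately have "- (k * k * ((1 - nu\<^sup>2) * (- lam\<^sup>2 * num))) = 1 / den * (lam\<^sup>2 * num)"
      by (simp only:)
    then show ?thesis by (simp add: gap_bound_def num_def den_def)
  qed
  finally have "dirichlet TT \<xi> = gap_bound lam nu r" .
  with D perp norm show ?thesis unfolding gap_set_def by force
qed

text \<open>Each bound on \<open>Inf\<close> needs a side condition: nonemptiness comes from the
  test vector, boundedness below from \<open>dirichlet_nonneg\<close>.\<close>

lemma spectral_gap_bounds: "0 \<le> spectral_gap TT" "spectral_gap TT \<le> gap_bound lam nu r"
proof -
  have nn: "0 \<le> v" if "v \<in> gap_set" for v
    using that dirichlet_nonneg by (auto simp: gap_set_def)
  have eq: "spectral_gap TT = Inf gap_set" by (simp add: spectral_gap_def gap_set_def)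
  show "0 \<le> spectral_gap TT"
    unfolding eq using gap_bound_mem_gap_set nn by (intro cInf_greatest) auto
  show "spectral_gap TT \<le> gap_bound lam nu r"
    unfolding eq using nn by (intro cInf_lower gap_bound_mem_gap_set bdd_belowI)
qed

end

section \<open>Decay of the bound as r tends to 0\<close>

lemma gap_bound_le:
  fixes lam nu r :: real
  assumes nu: "0 < nu" "nu < 1" and r: "0 < r" "r < 1"
  shows "gap_bound lam nu r \<le> lam\<^sup>2 * (r / ((1 - nu\<^sup>2) * (nu\<^sup>2 * (1 - r))\<^sup>2))"
proof -
  have nu2: "0 < nu\<^sup>2" "nu\<^sup>2 < 1" using nu by (simp_all add: power_less_one_iff)
  have geo: "(\<lambda>j. nu ^ (2 * j)) sums (1 / (1 - nu\<^sup>2))"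
    using geometric_sums[of "nu\<^sup>2"] nu2 by (simp add: power_mult)
  have bounded: "summable (\<lambda>j. g j * nu ^ (2 * j))" if "\<And>j. \<bar>g j\<bar> \<le> M" for g :: "nat \<Rightarrow> real" and M
  proof (rule summable_comparison_test)
    show "summable (\<lambda>j. M * nu ^ (2 * j))" by (intro summable_mult sums_summable[OF geo])
    show "\<exists>N. \<forall>j\<ge>N. norm (g j * nu ^ (2 * j)) \<le> M * nu ^ (2 * j)"
      using that nu by (auto simp: abs_mult intro!: mult_right_mono)
  qed
  define num where "num = (\<Sum>j. (real j + 1) / ((real j + r + 1)\<^sup>2 * (real j + r)) * nu ^ (2 * j))"
  define den where "den = (\<Sum>j. (1 / (real j + r) - cnr nu r)\<^sup>2 * nu ^ (2 * j))"
  have nle: "(real j + 1) / ((real j + r + 1)\<^sup>2 * (real j + r)) \<le> 1 / r" for j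
  proof -
    have "(real j + 1) * r \<le> (real j + r + 1)\<^sup>2 * (real j + r)"
      using r by (intro mult_mono) (auto simp: power2_eq_square algebra_simps)
    then show ?thesis using r by (simp add: divide_simps)
  qed
  have ile: "1 / (real j + r) \<le> 1 / r" for j using r by (simp add: frac_le)
  \<comment> \<open>Bounding every coefficient by 1/r keeps the right order, since the term j = 0
    has that size for small r.\<close>
  have num: "num \<le> 1 / (r * (1 - nu\<^sup>2))"
  proof -
    have "num \<le> (\<Sum>j. 1 / r * nu ^ (2 * j))"
      unfolding num_def
      by (intro suminf_le bounded[of _ "1 / r"] mult_right_mono nle) (use nle nu r in auto)
    also have "\<dots> = 1 / (r * (1 - nu\<^sup>2))"
      using sums_unique[OF sums_mult[OF geo, of "1 / r"]] by simp
    finally show ?thesis .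
  qed
  have c: "cnr nu r \<le> (1 - nu\<^sup>2) / r + nu\<^sup>2"
  proof -
    \<comment> \<open>A majorant: 1/(j + r) is at most 1 for j >= 1, and the extra 1/r - 1 corrects
      the term j = 0 to its exact value.\<close>
    have s1: "(\<lambda>j. nu ^ (2 * j) + (if j = 0 then 1 / r - 1 else 0)) sums (1 / (1 - nu\<^sup>2) + (1 / r - 1))"
      by (intro sums_add geo) (rule sums_single)
    have "(\<Sum>j. nu ^ (2 * j) / (real j + r)) \<le> (\<Sum>j. nu ^ (2 * j) + (if j = 0 then 1 / r - 1 else 0))"
    proof (intro suminf_le sums_summable[OF s1])
      show "summable (\<lambda>j. nu ^ (2 * j) / (real j + r))"
        using bounded[of "\<lambda>j. 1 / (real j + r)" "1 / r"] ile r by simp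
      fix j
      show "nu ^ (2 * j) / (real j + r) \<le> nu ^ (2 * j) + (if j = 0 then 1 / r - 1 else 0)"
      proof (cases "j = 0")
        case False
        have "nu ^ (2 * j) / (real j + r) \<le> nu ^ (2 * j) / 1"
          using False r nu by (intro divide_left_mono) auto
        with False show ?thesis by simp
      qed simp
    qed
    also have "\<dots> = 1 / (1 - nu\<^sup>2) + (1 / r - 1)" using sums_unique[OF s1] by simp
    finally have "cnr nu r \<le> (1 - nu\<^sup>2) * (1 / (1 - nu\<^sup>2) + (1 / r - 1))"
      unfolding cnr_def using nu2 by (intro mult_left_mono) auto
    also have "\<dots> = (1 - nu\<^sup>2) / r + nu\<^sup>2" using nu2 by (simp add: field_simps)
    finally show ?thesis .
  qed
  have d: "nu\<^sup>2 * (1 - r) / r \<le> 1 / r - cnr nu r"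
    using c r by (simp add: diff_divide_distrib algebra_simps)
  have d0: "0 < nu\<^sup>2 * (1 - r) / r" using nu2 r by simp
  \<comment> \<open>The term j = 0 alone has order 1/r^2, because \<open>cnr\<close> stays below 1/r
    by the margin nu^2 (1 - r) / r, positive for r < 1. Together with the order 1/r of
    \<open>num\<close> this makes the quotient of order r.\<close>
  have den: "(nu\<^sup>2 * (1 - r) / r)\<^sup>2 \<le> den"
  proof -
    have sd: "summable (\<lambda>j. (1 / (real j + r) - cnr nu r)\<^sup>2 * nu ^ (2 * j))"
    proof (rule bounded)
      fix j
      have "\<bar>1 / (real j + r) - cnr nu r\<bar> \<le> 1 / r + \<bar>cnr nu r\<bar>"
        using ile[of j] r abs_triangle_ineq4[of "1 / (real j + r)" "cnr nu r"] by simp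
      from power_mono[OF this abs_ge_zero, of 2]
      show "\<bar>(1 / (real j + r) - cnr nu r)\<^sup>2\<bar> \<le> (1 / r + \<bar>cnr nu r\<bar>)\<^sup>2" by simp
    qed
    have "(nu\<^sup>2 * (1 - r) / r)\<^sup>2 \<le> (1 / r - cnr nu r)\<^sup>2" using d d0 by (intro power_mono) auto
    also have "\<dots> = (\<Sum>j\<in>{0}. (1 / (real j + r) - cnr nu r)\<^sup>2 * nu ^ (2 * j))" by simp
    also have "\<dots> \<le> den"
      unfolding den_def using nu by (intro sum_le_suminf sd) auto
    finally show ?thesis .
  qed
  have "num / den \<le> (1 / (r * (1 - nu\<^sup>2))) / (nu\<^sup>2 * (1 - r) / r)\<^sup>2"
    using num den d0 nu2 r by (intro frac_le) auto
  also have "\<dots> = r / ((1 - nu\<^sup>2) * (nu\<^sup>2 * (1 - r))\<^sup>2)"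
  proof -
    have "1 / (r * a) / (b / r)\<^sup>2 = r / (a * b\<^sup>2)" for a b :: real
      using r by (simp add: power_divide power2_eq_square)
    then show ?thesis .
  qed
  finally show ?thesis
    unfolding gap_bound_def num_def[symmetric] den_def[symmetric] by (intro mult_left_mono) auto
qed

theorem theorem6p12:
  fixes lam mu zp zm :: real
    and T :: "real \<Rightarrow> real \<Rightarrow> mat \<Rightarrow> mat"
    and TT :: "real \<Rightarrow> real \<Rightarrow> mat \<Rightarrow> mat"
  assumes "0 < lam" and "lam < mu"
    and "\<And>r. r > 0 \<Longrightarrow> minimal_qds r lam mu zp zm (T r)"
    and "\<And>r. r > 0 \<Longrightarrow> hs_extension (lam / mu) (T r) (TT r)"
  shows "(\<forall>r>0. spectral_gap (TT r) \<le> gap_bound lam (lam / mu) r)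
         \<and> ((\<lambda>r. spectral_gap (TT r)) \<longlongrightarrow> 0) (at_right 0)"
proof -
  have gap: "0 \<le> spectral_gap (TT r)" "spectral_gap (TT r) \<le> gap_bound lam (lam / mu) r" if "0 < r" for r
  proof -
    interpret bd: birth_death r lam mu zp zm using that assms by unfold_locales
    interpret birth_death_hs r lam mu zp zm "T r" "TT r"
      using that assms by unfold_locales (simp_all add: bd.nu_def)
    show "0 \<le> spectral_gap (TT r)" "spectral_gap (TT r) \<le> gap_bound lam (lam / mu) r"
      using spectral_gap_bounds by (simp_all add: bd.nu_def)
  qed
  have nu: "0 < lam / mu" "lam / mu < 1" using assms(1,2) by auto
  let ?b = "\<lambda>r. lam\<^sup>2 * (r / ((1 - (lam / mu)\<^sup>2) * ((lam / mu)\<^sup>2 * (1 - r))\<^sup>2))"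
  have "(lam / mu)\<^sup>2 < 1" using nu by (simp add: power_less_one_iff)
  then have "(?b \<longlongrightarrow> lam\<^sup>2 * (0 / ((1 - (lam / mu)\<^sup>2) * ((lam / mu)\<^sup>2 * (1 - 0))\<^sup>2))) (at_right 0)"
    using nu assms(1,2) by (intro tendsto_intros) auto
  then have lim: "(?b \<longlongrightarrow> 0) (at_right 0)" by simp
  have small: "\<forall>\<^sub>F r in at_right 0. r < (1::real)"
    using eventually_at_right_real[of 0 1] by (auto elim: eventually_mono)
  have "((\<lambda>r. spectral_gap (TT r)) \<longlongrightarrow> 0) (at_right 0)"
  proof (rule tendsto_sandwich[OF _ _ tendsto_const lim])
    show "\<forall>\<^sub>F r in at_right 0. 0 \<le> spectral_gap (TT r)"
      using eventually_at_right_less[of "0::real"] by eventually_elim (rule gap)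
    show "\<forall>\<^sub>F r in at_right 0. spectral_gap (TT r) \<le> ?b r"
      using eventually_at_right_less[of "0::real"] small
      by eventually_elim (use gap gap_bound_le[OF nu] order_trans in blast)
  qed
  with gap show ?thesis by blast
qed

end
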